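(* Suppose $1<\vec r<\vec r_1<\infty$ and $1<\vec{\tilde r}<\vec{\tilde r}_1<\infty$, where $\vec r=(r_1,\dots,r_m)$, $\vec{\tilde r}=(\tilde r_1,\dots,\tilde r_m)$, $\vec r_j=(r_{j1},\dots,r_{jm})$, $\vec{\tilde r}_j=(\tilde r_{j1},\dots,\tilde r_{jm})$ for $j=1,2$, and let $$\frac1{r_i}=\frac1{r_{1i}}+\frac1{r_{2i}},\qquad \frac1{\tilde r_i}=\frac1{\tilde r_{1i}}+\frac1{\tilde r_{2i}},\qquad i=1,\dots,m.$$ Let $-\frac1{N_k}\sum_{i=1}^m\frac{N_{k^{(i)}}}{r_{1i}}<\lambda$. Further suppose that $\varphi$ is a non-negative locally integrable function on $(0,1]$. Then the commutator $\mathcal{H}_\varphi^b$ is bounded from $\dot B^{\vec r_1,\vec{\tilde r}_1,\lambda}_k(\mathbb{R}^n)$ to $\dot B^{\vec r,\vec{\tilde r},\lambda}_k(\mathbb{R}^n)$ for all $b\in\mathrm{CMO}_{\vec r_2,\vec{\tilde r}_2,k}(\mathbb{R}^n)$ if and only if $$\int_0^1 t^{N_k\lambda}\log\frac1t\,\varphi(t)\,\mathrm{d}t<\infty.$$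
   Context: Setting. Let $n\ge 2$, $\mathbb{R}^n=\mathbb{R}^{n_1}\times\cdots\times\mathbb{R}^{n_m}$ with $\sum_{i=1}^m n_i=n$, $n_i\ge1$. Let $k=(k_1,\dots,k_n)$ with all $k_j\ge 0$, split into blocks $k=(k^{(1)},\dots,k^{(m)})$ with $k^{(i)}=(k^{(i)}_1,\dots,k^{(i)}_{n_i})$. Put $N_{k^{(i)}}=n_i+2\sum_{v=1}^{n_i}k^{(i)}_v$ and $N_k=n+2\sum_{j=1}^n k_j=\sum_{i=1}^m N_{k^{(i)}}$. The Dunkl measure is $\mathrm{d}\mu_k(x)=\prod_{j=1}^n|x_j|^{2k_j}\,\mathrm{d}x$; write $|E|_k=\mu_k(E)$. $B(0,R)$ is the open Euclidean ball in $\mathbb{R}^n$ of center $0$ and radius $R$. On each unit sphere $\mathbb{S}^{n_i-1}\subset\mathbb{R}^{n_i}$ let $\mathrm{d}\sigma_{k^{(i)}}(\omega)=\prod_{v=1}^{n_i}|\omega_v|^{2k^{(i)}_v}\,\mathrm{d}\sigma(\omega)$, $\mathrm{d}\sigma$ the surface measure (counting measure on $\{\pm1\}$ if $n_i=1$). Vector inequalities are understood componentwise. Mixed-norm radial-angular Dunkl--Lebesgue space. For vectors $1<\vec u,\vec w<\infty$ in $\mathbb{R}^m$ and measurable $f:\mathbb{R}^n\to\mathbb{C}$, writing $x_i=\rho_i\omega_i\in\mathbb{R}^{n_i}$ in polar coordinates, $\|f\|_{L^{\vec u}_{\mathrm{rad},k}L^{\vec w}_{\mathrm{ang},k}(\mathbb{R}^n)}$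 is obtained by taking successively, for $i=1,2,\dots,m$ (block $1$ innermost), first the $L^{w_i}(\mathbb{S}^{n_i-1},\mathrm{d}\sigma_{k^{(i)}})$ norm in $\omega_i$ and then the $L^{u_i}((0,\infty),\rho_i^{N_{k^{(i)}}-1}\mathrm{d}\rho_i)$ norm in $\rho_i$; i.e. $$\|f\|=\Biggl(\int_0^\infty\Biggl(\int_{\mathbb{S}^{n_m-1}}\cdots\Biggl(\int_0^\infty\Biggl(\int_{\mathbb{S}^{n_1-1}}|f(\rho_1\omega_1,\dots,\rho_m\omega_m)|^{w_1}\mathrm{d}\sigma_{k^{(1)}}(\omega_1)\Biggr)^{\frac{u_1}{w_1}}\rho_1^{N_{k^{(1)}}-1}\mathrm{d}\rho_1\Biggr)^{\frac{w_2}{u_1}}\cdots\mathrm{d}\sigma_{k^{(m)}}(\omega_m)\Biggr)^{\frac{u_m}{w_m}}\rho_m^{N_{k^{(m)}}-1}\mathrm{d}\rho_m\Biggr)^{\frac1{u_m}}.$$ Mixed-norm radial-angular Dunkl $\lambda$-central Morrey space. For $\lambda\in\mathbb{R}$, $\dot B^{\vec u,\vec w,\lambda}_k(\mathbb{R}^n)$ is the set of measurable $f$ with $$\|f\|_{\dot B^{\vec u,\vec w,\lambda}_k(\mathbb{R}^n)}=\sup_{R>0}\frac{\|f\chi_{B(0,R)}\|_{L^{\vec u}_{\mathrm{rad},k}L^{\vec w}_{\mathrm{ang},k}(\mathbb{R}^n)}}{|B(0,R)|_k^{\lambda}\,\|\chi_{B(0,R)}\|_{L^{\vec u}_{\mathrm{rad},k}L^{\vec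 w}_{\mathrm{ang},k}(\mathbb{R}^n)}}<\infty.$$ Mixed-norm radial-angular Dunkl central bounded mean oscillation space. With $b_{B(0,R),k}=\frac1{|B(0,R)|_k}\int_{B(0,R)}b\,\mathrm{d}\mu_k$, $\mathrm{CMO}_{\vec u,\vec w,k}(\mathbb{R}^n)$ is the set of locally ($\mu_k$-)integrable $b$ with $$\|b\|_{\mathrm{CMO}_{\vec u,\vec w,k}(\mathbb{R}^n)}=\sup_{R>0}\frac{\|(b-b_{B(0,R),k})\chi_{B(0,R)}\|_{L^{\vec u}_{\mathrm{rad},k}L^{\vec w}_{\mathrm{ang},k}(\mathbb{R}^n)}}{\|\chi_{B(0,R)}\|_{L^{\vec u}_{\mathrm{rad},k}L^{\vec w}_{\mathrm{ang},k}(\mathbb{R}^n)}}<\infty.$$ Operators. $\mathcal{H}_\varphi f(x)=\int_0^1 f(tx)\varphi(t)\,\mathrm{d}t$ and $\mathcal{H}_\varphi^b f(x)=b(x)\mathcal{H}_\varphi f(x)-\mathcal{H}_\varphi(bf)(x)=\int_0^1(b(x)-b(tx))f(tx)\varphi(t)\,\mathrm{d}t$, whenever well defined. Bounded from $X$ to $Y$ means: $\mathcal{H}_\varphi^b f$ is defined almost everywhere for every $f\in X$ and $\|\mathcal{H}_\varphi^b f\|_Y\le C\|f\|_X$ with $C$ independent of $f$. Locally integrable on $(0,1]$ means integrable on every compact subset of $(0,1]$. *)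

theory Defs
  imports "HOL-Analysis.Analysis"
begin

text \<open>
  The number of blocks \<open>m\<close>, the block dimensions \<open>d i\<close> and the weights \<open>k i v\<close> are ordinary
  terms. The space \<open>R^p\<close> is \<open>{1..p} \<rightarrow>\<^sub>E UNIV\<close>, and
  \<open>R^n = R^(d 1) \<times> ... \<times> R^(d m)\<close> is the product over \<open>{1..m}\<close> of these spaces; so \<open>x i v\<close> is
  the \<open>v\<close>-th coordinate of the \<open>i\<close>-th block of \<open>x\<close>.
\<close>

section \<open>One block\<close>

definition euclid :: "nat \<Rightarrow> (nat \<Rightarrow> real) measure" where
  "euclid p = (\<Pi>\<^sub>M v\<in>{1..p}. lborel)"

definition usphere :: "nat \<Rightarrow> (nat \<Rightarrow> real) set" where
  "usphere p = {\<omega> \<in> space (euclid p). L2_set \<omega> {1..p} = 1}"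

text \<open>
  Surface measure on the unit sphere as the cone measure: \<open>\<sigma>(A)\<close> is \<open>p\<close> times the Lebesgue measure
  of \<open>{t \<omega> | 0 < t \<le> 1, \<omega> \<in> A}\<close>, written as the image of \<open>p\<close> times Lebesgue measure on the punctured
  unit ball under the radial projection (see \<open>emeasure_surface_measure\<close> below). For \<open>p = 1\<close> it is the
  counting measure on the two unit vectors (\<open>surface_measure_1\<close>).
\<close>

definition punctured_ball :: "nat \<Rightarrow> (nat \<Rightarrow> real) set" where
  "punctured_ball p = {x \<in> space (euclid p). 0 < L2_set x {1..p} \<and> L2_set x {1..p} \<le> 1}"

definition radial_proj :: "nat \<Rightarrow> (nat \<Rightarrow> real) \<Rightarrow> nat \<Rightarrow> real" where
  "radial_proj p x = (\<lambda>v\<in>{1..p}. x v / L2_set x {1..p})"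

definition surface_measure :: "nat \<Rightarrow> (nat \<Rightarrow> real) measure" where
  "surface_measure p =
     distr (scale_measure (of_nat p) (restrict_space (euclid p) (punctured_ball p)))
           (restrict_space (euclid p) (usphere p)) (radial_proj p)"

text \<open>
  Since \<open>0 powr 0 = 0\<close> in HOL, the weights below vanish where a coordinate with weight \<open>0\<close> is zero.
  This is a null set, so the measures are the intended ones.
\<close>

definition dunkl_sphere :: "nat \<Rightarrow> (nat \<Rightarrow> real) \<Rightarrow> (nat \<Rightarrow> real) measure" where
  "dunkl_sphere p \<kappa> =
     density (surface_measure p) (\<lambda>\<omega>. ennreal (\<Prod>v=1..p. \<bar>\<omega> v\<bar> powr (2 * \<kappa> v)))"

definition hom_dim :: "nat \<Rightarrow> (nat \<Rightarrow> real) \<Rightarrow> real" where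
  "hom_dim p \<kappa> = real p + 2 * (\<Sum>v=1..p. \<kappa> v)"

definition dunkl_radial :: "nat \<Rightarrow> (nat \<Rightarrow> real) \<Rightarrow> real measure" where
  "dunkl_radial p \<kappa> =
     density (restrict_space lborel {0<..}) (\<lambda>\<rho>. ennreal (\<rho> powr (hom_dim p \<kappa> - 1)))"

section \<open>The whole space\<close>

definition leb :: "nat \<Rightarrow> (nat \<Rightarrow> nat) \<Rightarrow> (nat \<Rightarrow> nat \<Rightarrow> real) measure" where
  "leb m d = completion (\<Pi>\<^sub>M i\<in>{1..m}. euclid (d i))"

definition dunkl_measure ::
    "nat \<Rightarrow> (nat \<Rightarrow> nat) \<Rightarrow> (nat \<Rightarrow> nat \<Rightarrow> real) \<Rightarrow> (nat \<Rightarrow> nat \<Rightarrow> real) measure" where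
  "dunkl_measure m d k =
     density (leb m d) (\<lambda>x. ennreal (\<Prod>i=1..m. \<Prod>v=1..d i. \<bar>x i v\<bar> powr (2 * k i v)))"

definition total_dim :: "nat \<Rightarrow> (nat \<Rightarrow> nat) \<Rightarrow> nat" where
  "total_dim m d = (\<Sum>i=1..m. d i)"

definition total_hom_dim :: "nat \<Rightarrow> (nat \<Rightarrow> nat) \<Rightarrow> (nat \<Rightarrow> nat \<Rightarrow> real) \<Rightarrow> real" where
  "total_hom_dim m d k = real (total_dim m d) + 2 * (\<Sum>i=1..m. \<Sum>v=1..d i. k i v)"

definition oball :: "nat \<Rightarrow> (nat \<Rightarrow> nat) \<Rightarrow> real \<Rightarrow> (nat \<Rightarrow> nat \<Rightarrow> real) set" where
  "oball m d R = {x \<in> space (leb m d). sqrt (\<Sum>i=1..m. \<Sum>v=1..d i. (x i v)\<^sup>2) < R}"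

definition dil :: "nat \<Rightarrow> (nat \<Rightarrow> nat) \<Rightarrow> real \<Rightarrow> (nat \<Rightarrow> nat \<Rightarrow> real) \<Rightarrow> nat \<Rightarrow> nat \<Rightarrow> real" where
  "dil m d t x = (\<lambda>i\<in>{1..m}. \<lambda>v\<in>{1..d i}. t * x i v)"

section \<open>Mixed norms\<close>

text \<open>Powers with positive real exponent on \<open>[0,\<infinity>]\<close>.\<close>

definition epowr :: "ennreal \<Rightarrow> real \<Rightarrow> ennreal" where
  "epowr x a = (if x = \<infinity> then \<infinity> else ennreal (enn2real x powr a))"

definition Lp_norm :: "'a measure \<Rightarrow> real \<Rightarrow> ('a \<Rightarrow> ennreal) \<Rightarrow> ennreal" where
  "Lp_norm M p g = epowr (\<integral>\<^sup>+x. epowr (g x) p \<partial>M) (1 / p)"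

text \<open>
  \<open>iter_norm d k u w j F x\<close> is the function obtained from \<open>F\<close> by taking the norms in the blocks
  \<open>1, ..., j\<close>, evaluated at the remaining blocks of \<open>x\<close>; it does not depend on the blocks
  \<open>1, ..., j\<close> of \<open>x\<close>. For \<open>j = m\<close> no block remains; the base point must be \<open>undefined\<close> outside
  \<open>{1..m}\<close> for all arguments of \<open>F\<close> to lie in the product space.
\<close>

primrec iter_norm ::
    "(nat \<Rightarrow> nat) \<Rightarrow> (nat \<Rightarrow> nat \<Rightarrow> real) \<Rightarrow> (nat \<Rightarrow> real) \<Rightarrow> (nat \<Rightarrow> real) \<Rightarrow> nat \<Rightarrow>
     ((nat \<Rightarrow> nat \<Rightarrow> real) \<Rightarrow> ennreal) \<Rightarrow> (nat \<Rightarrow> nat \<Rightarrow> real) \<Rightarrow> ennreal" where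
  "iter_norm d k u w 0 F x = F x"
| "iter_norm d k u w (Suc j) F x =
     Lp_norm (dunkl_radial (d (Suc j)) (k (Suc j))) (u (Suc j)) (\<lambda>\<rho>.
       Lp_norm (dunkl_sphere (d (Suc j)) (k (Suc j))) (w (Suc j)) (\<lambda>\<omega>.
         iter_norm d k u w j F (x(Suc j := (\<lambda>v\<in>{1..d (Suc j)}. \<rho> * \<omega> v)))))"

definition mixed_norm ::
    "nat \<Rightarrow> (nat \<Rightarrow> nat) \<Rightarrow> (nat \<Rightarrow> nat \<Rightarrow> real) \<Rightarrow> (nat \<Rightarrow> real) \<Rightarrow> (nat \<Rightarrow> real) \<Rightarrow>
     ((nat \<Rightarrow> nat \<Rightarrow> real) \<Rightarrow> complex) \<Rightarrow> ennreal" where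
  "mixed_norm m d k u w f = iter_norm d k u w m (\<lambda>x. ennreal (cmod (f x))) (\<lambda>_. undefined)"

section \<open>Function spaces\<close>

definition morrey_norm ::
    "nat \<Rightarrow> (nat \<Rightarrow> nat) \<Rightarrow> (nat \<Rightarrow> nat \<Rightarrow> real) \<Rightarrow> (nat \<Rightarrow> real) \<Rightarrow> (nat \<Rightarrow> real) \<Rightarrow> real \<Rightarrow>
     ((nat \<Rightarrow> nat \<Rightarrow> real) \<Rightarrow> complex) \<Rightarrow> ennreal" where
  "morrey_norm m d k u w l f =
     (SUP R\<in>{0<..}.
        mixed_norm m d k u w (\<lambda>x. f x * indicator (oball m d R) x) /
        (ennreal (measure (dunkl_measure m d k) (oball m d R) powr l) *
         mixed_norm m d k u w (indicator (oball m d R))))"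

definition morrey_space ::
    "nat \<Rightarrow> (nat \<Rightarrow> nat) \<Rightarrow> (nat \<Rightarrow> nat \<Rightarrow> real) \<Rightarrow> (nat \<Rightarrow> real) \<Rightarrow> (nat \<Rightarrow> real) \<Rightarrow> real \<Rightarrow>
     ((nat \<Rightarrow> nat \<Rightarrow> real) \<Rightarrow> complex) set" where
  "morrey_space m d k u w l =
     {f \<in> borel_measurable (leb m d). morrey_norm m d k u w l f < \<infinity>}"

definition ball_mean ::
    "nat \<Rightarrow> (nat \<Rightarrow> nat) \<Rightarrow> (nat \<Rightarrow> nat \<Rightarrow> real) \<Rightarrow> ((nat \<Rightarrow> nat \<Rightarrow> real) \<Rightarrow> complex) \<Rightarrow> real \<Rightarrow> complex"
  where
  "ball_mean m d k b R =
     (LINT x:oball m d R|dunkl_measure m d k. b x) /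
     of_real (measure (dunkl_measure m d k) (oball m d R))"

definition cmo_norm ::
    "nat \<Rightarrow> (nat \<Rightarrow> nat) \<Rightarrow> (nat \<Rightarrow> nat \<Rightarrow> real) \<Rightarrow> (nat \<Rightarrow> real) \<Rightarrow> (nat \<Rightarrow> real) \<Rightarrow>
     ((nat \<Rightarrow> nat \<Rightarrow> real) \<Rightarrow> complex) \<Rightarrow> ennreal" where
  "cmo_norm m d k u w b =
     (SUP R\<in>{0<..}.
        mixed_norm m d k u w (\<lambda>x. (b x - ball_mean m d k b R) * indicator (oball m d R) x) /
        mixed_norm m d k u w (indicator (oball m d R)))"

text \<open>Local integrability is integrability on every centred ball: these exhaust the compact sets.\<close>

definition cmo_space ::
    "nat \<Rightarrow> (nat \<Rightarrow> nat) \<Rightarrow> (nat \<Rightarrow> nat \<Rightarrow> real) \<Rightarrow> (nat \<Rightarrow> real) \<Rightarrow> (nat \<Rightarrow> real) \<Rightarrow>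
     ((nat \<Rightarrow> nat \<Rightarrow> real) \<Rightarrow> complex) set" where
  "cmo_space m d k u w =
     {b. (\<forall>R>0. set_integrable (dunkl_measure m d k) (oball m d R) b) \<and>
         cmo_norm m d k u w b < \<infinity>}"

section \<open>Operators\<close>

definition hardy_defined ::
    "nat \<Rightarrow> (nat \<Rightarrow> nat) \<Rightarrow> (real \<Rightarrow> real) \<Rightarrow> ((nat \<Rightarrow> nat \<Rightarrow> real) \<Rightarrow> complex) \<Rightarrow>
     (nat \<Rightarrow> nat \<Rightarrow> real) \<Rightarrow> bool" where
  "hardy_defined m d \<phi> f x \<longleftrightarrow>
     set_integrable lebesgue {0<..1} (\<lambda>t. f (dil m d t x) * complex_of_real (\<phi> t))"

definition hardy ::
    "nat \<Rightarrow> (nat \<Rightarrow> nat) \<Rightarrow> (real \<Rightarrow> real) \<Rightarrow> ((nat \<Rightarrow> nat \<Rightarrow> real) \<Rightarrow> complex) \<Rightarrow>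
     (nat \<Rightarrow> nat \<Rightarrow> real) \<Rightarrow> complex" where
  "hardy m d \<phi> f x = (LINT t:{0<..1}|lebesgue. f (dil m d t x) * complex_of_real (\<phi> t))"

definition commutator_defined ::
    "nat \<Rightarrow> (nat \<Rightarrow> nat) \<Rightarrow> (real \<Rightarrow> real) \<Rightarrow> ((nat \<Rightarrow> nat \<Rightarrow> real) \<Rightarrow> complex) \<Rightarrow>
     ((nat \<Rightarrow> nat \<Rightarrow> real) \<Rightarrow> complex) \<Rightarrow> (nat \<Rightarrow> nat \<Rightarrow> real) \<Rightarrow> bool" where
  "commutator_defined m d \<phi> b f x \<longleftrightarrow>
     hardy_defined m d \<phi> f x \<and> hardy_defined m d \<phi> (\<lambda>y. b y * f y) x"

definition commutator ::
    "nat \<Rightarrow> (nat \<Rightarrow> nat) \<Rightarrow> (real \<Rightarrow> real) \<Rightarrow> ((nat \<Rightarrow> nat \<Rightarrow> real) \<Rightarrow> complex) \<Rightarrow>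
     ((nat \<Rightarrow> nat \<Rightarrow> real) \<Rightarrow> complex) \<Rightarrow> (nat \<Rightarrow> nat \<Rightarrow> real) \<Rightarrow> complex" where
  "commutator m d \<phi> b f x = b x * hardy m d \<phi> f x - hardy m d \<phi> (\<lambda>y. b y * f y) x"

definition commutator_bounded ::
    "nat \<Rightarrow> (nat \<Rightarrow> nat) \<Rightarrow> (nat \<Rightarrow> nat \<Rightarrow> real) \<Rightarrow> (real \<Rightarrow> real) \<Rightarrow>
     ((nat \<Rightarrow> nat \<Rightarrow> real) \<Rightarrow> complex) \<Rightarrow>
     (nat \<Rightarrow> real) \<Rightarrow> (nat \<Rightarrow> real) \<Rightarrow> (nat \<Rightarrow> real) \<Rightarrow> (nat \<Rightarrow> real) \<Rightarrow> real \<Rightarrow> bool" where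
  "commutator_bounded m d k \<phi> b u w u' w' l \<longleftrightarrow>
     (\<exists>C::real. \<forall>f\<in>morrey_space m d k u w l.
        (AE x in leb m d. commutator_defined m d \<phi> b f x) \<and>
        commutator m d \<phi> b f \<in> morrey_space m d k u' w' l \<and>
        morrey_norm m d k u' w' l (commutator m d \<phi> b f) \<le> ennreal C * morrey_norm m d k u w l f)"

section \<open>Consistency of the definitions\<close>

lemma commutator_eq_integral:
  assumes "commutator_defined m d \<phi> b f x"
  shows "commutator m d \<phi> b f x =
    (LINT t:{0<..1}|lebesgue. (b x - b (dil m d t x)) * f (dil m d t x) * complex_of_real (\<phi> t))"
proof -
  let ?g = "\<lambda>t. f (dil m d t x) * complex_of_real (\<phi> t)"
  have 1: "set_integrable lebesgue {0<..1} (\<lambda>t. b x * ?g t)"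
    using assms unfolding commutator_defined_def hardy_defined_def by (intro set_integrable_mult_right) auto
  have 2: "set_integrable lebesgue {0<..1} (\<lambda>t. b (dil m d t x) * f (dil m d t x) * complex_of_real (\<phi> t))"
    using assms unfolding commutator_defined_def hardy_defined_def by auto
  have "commutator m d \<phi> b f x = (LINT t:{0<..1}|lebesgue. b x * ?g t) -
      (LINT t:{0<..1}|lebesgue. b (dil m d t x) * f (dil m d t x) * complex_of_real (\<phi> t))"
    unfolding commutator_def hardy_def by simp
  also have "\<dots> = (LINT t:{0<..1}|lebesgue. b x * ?g t -
      b (dil m d t x) * f (dil m d t x) * complex_of_real (\<phi> t))"
    using 1 2 by (simp add: set_integral_diff)
  finally show ?thesis by (simp add: algebra_simps)
qed

lemma L2_set_measurable [measurable]:
  "(\<lambda>x. L2_set x {1..p}) \<in> borel_measurable (euclid p)"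
  unfolding euclid_def L2_set_def by measurable

lemma radial_proj_measurable [measurable]:
  "radial_proj p \<in> restrict_space (euclid p) (punctured_ball p) \<rightarrow>\<^sub>M restrict_space (euclid p) (usphere p)"
proof (rule measurable_restrict_space3)
  show "radial_proj p \<in> euclid p \<rightarrow>\<^sub>M euclid p"
  proof -
    have c: "(\<lambda>x. x v) \<in> borel_measurable (euclid p)" if "v \<in> {1..p}" for v
      using that unfolding euclid_def by measurable
    have "(\<lambda>x. \<lambda>v\<in>{1..p}. x v / L2_set x {1..p}) \<in> euclid p \<rightarrow>\<^sub>M (\<Pi>\<^sub>M v\<in>{1..p}. lborel)"
      by (rule measurable_restrict)
        (use c L2_set_measurable in \<open>auto simp: measurable_lborel1 intro!: borel_measurable_divide\<close>)
    then show ?thesis unfolding radial_proj_def[abs_def] by (simp add: euclid_def)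
  qed
  show "radial_proj p \<in> punctured_ball p \<rightarrow> usphere p"
  proof
    fix x assume x: "x \<in> punctured_ball p"
    define c where "c = L2_set x {1..p}"
    have c: "c > 0" using x by (simp add: c_def punctured_ball_def)
    have "L2_set (radial_proj p x) {1..p} = L2_set (\<lambda>v. (1/c) * x v) {1..p}"
      by (rule L2_set_cong) (auto simp: radial_proj_def c_def)
    also have "\<dots> = (1/c) * c"
      using c unfolding c_def by (subst L2_set_right_distrib) auto
    finally have "L2_set (radial_proj p x) {1..p} = 1" using c by simp
    then show "radial_proj p x \<in> usphere p"
      by (auto simp: usphere_def radial_proj_def euclid_def space_PiM)
  qed
qed

lemma emeasure_surface_measure:
  assumes "A \<in> sets (restrict_space (euclid p) (usphere p))"
  shows "emeasure (surface_measure p) A =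
    of_nat p * emeasure (euclid p) {\<lambda>v\<in>{1..p}. t * \<omega> v | t \<omega>. 0 < t \<and> t \<le> 1 \<and> \<omega> \<in> A}"
proof -
  have pb: "punctured_ball p \<in> sets (euclid p)"
    unfolding punctured_ball_def by measurable
  have A: "A \<subseteq> usphere p"
    using sets.sets_into_space[OF assms] by (auto simp: space_restrict_space)
  have eq: "radial_proj p -` A \<inter> punctured_ball p =
      {\<lambda>v\<in>{1..p}. t * \<omega> v | t \<omega>. 0 < t \<and> t \<le> 1 \<and> \<omega> \<in> A}" (is "?L = ?R")
  proof (intro equalityI subsetI)
    fix x assume x: "x \<in> ?L"
    let ?c = "L2_set x {1..p}"
    have c: "0 < ?c" "?c \<le> 1" and e: "x \<in> extensional {1..p}"
      using x by (auto simp: punctured_ball_def euclid_def space_PiM PiE_def)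
    have "x = (\<lambda>v\<in>{1..p}. ?c * radial_proj p x v)"
      using c e by (auto simp: radial_proj_def fun_eq_iff extensional_def)
    then show "x \<in> ?R" using c x by blast
  next
    fix x assume "x \<in> ?R"
    then obtain t \<omega> where x: "x = (\<lambda>v\<in>{1..p}. t * \<omega> v)" and t: "0 < t" "t \<le> 1" and w: "\<omega> \<in> A" by blast
    have w1: "L2_set \<omega> {1..p} = 1" and we: "\<omega> \<in> extensional {1..p}"
      using w A by (auto simp: usphere_def euclid_def space_PiM PiE_def)
    have "L2_set x {1..p} = L2_set (\<lambda>v. t * \<omega> v) {1..p}"
      by (rule L2_set_cong) (auto simp: x)
    also have "\<dots> = t" using t w1 by (subst L2_set_right_distrib[symmetric]) auto
    finally have c: "L2_set x {1..p} = t" .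
    have "radial_proj p x = \<omega>"
      unfolding radial_proj_def c using we t by (auto simp: x fun_eq_iff extensional_def)
    then show "x \<in> ?L"
      using c t w by (auto simp: punctured_ball_def euclid_def space_PiM x)
  qed
  have "emeasure (surface_measure p) A =
     emeasure (scale_measure (of_nat p) (restrict_space (euclid p) (punctured_ball p)))
       (radial_proj p -` A \<inter> punctured_ball p)"
    unfolding surface_measure_def
    using assms radial_proj_measurable[of p] sets.sets_into_space[OF pb]
    by (subst emeasure_distr) (auto simp: space_scale_measure space_restrict_space Int_absorb1 Int_absorb2)
  also have "\<dots> = of_nat p * emeasure (euclid p) (radial_proj p -` A \<inter> punctured_ball p)"
    using pb sets.sets_into_space[OF pb] by (simp add: emeasure_restrict_space)
  finally show ?thesis unfolding eq .
qed

lemma usphere_1: "usphere 1 = {\<lambda>v\<in>{1}. 1, \<lambda>v\<in>{1}. - 1}"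
proof -
  have "\<omega> \<in> usphere 1 \<longleftrightarrow> \<omega> \<in> extensional {1} \<and> \<bar>\<omega> 1\<bar> = 1" for \<omega>
    by (auto simp: usphere_def euclid_def space_PiM PiE_def)
  then show ?thesis
    by (auto simp: extensional_def fun_eq_iff abs_if split: if_splits)
qed

lemma surface_measure_1:
  assumes "A \<subseteq> usphere 1"
  shows "emeasure (surface_measure 1) A = of_nat (card A)"
proof -
  have sing: "{\<omega>} \<in> sets (restrict_space (euclid 1) (usphere 1)) \<and> emeasure (surface_measure 1) {\<omega>} = 1"
    if w: "\<omega> \<in> usphere 1" for \<omega>
  proof -
    have e: "\<omega> \<in> extensional {1}" using w by (auto simp: usphere_def euclid_def space_PiM PiE_def)
    have "{\<omega>} = (\<Pi>\<^sub>E v\<in>{1}. {\<omega> v})"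
      using e by (simp add: PiE_singleton)
    moreover have "(\<Pi>\<^sub>E v\<in>{1}. {\<omega> v}) \<in> sets (euclid 1)"
      using sets_PiM_I_finite[of "{1}" "\<lambda>v. {\<omega> v}" "\<lambda>_. lborel"] by (simp add: euclid_def)
    moreover have us: "usphere 1 \<in> sets (euclid 1)"
      unfolding usphere_def by measurable
    ultimately have S: "{\<omega>} \<in> sets (restrict_space (euclid 1) (usphere 1))"
      using w by (subst sets_restrict_space_iff) (auto simp: Int_absorb2 dest: sets.sets_into_space)
    define I where "I = (if \<omega> 1 = 1 then {0<..1} else {- 1..<0::real})"
    have w1: "\<omega> 1 = 1 \<or> \<omega> 1 = - 1" using w unfolding usphere_1 by auto
    have "{\<lambda>v\<in>{1..1::nat}. t * \<omega>' v | t \<omega>'. 0 < t \<and> t \<le> (1::real) \<and> \<omega>' \<in> {\<omega>}} = (\<Pi>\<^sub>E v\<in>{1}. I)"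
      (is "?L = ?R")
    proof (intro equalityI subsetI)
      fix x assume "x \<in> ?L" then show "x \<in> ?R" using w1 by (auto simp: I_def split: if_splits)
    next
      fix x assume x: "x \<in> ?R"
      then have "x = (\<lambda>v\<in>{1..1}. \<bar>x 1\<bar> * \<omega> v)" "0 < \<bar>x 1\<bar>" "\<bar>x 1\<bar> \<le> 1"
        using w1 by (auto simp: I_def PiE_def extensional_def fun_eq_iff split: if_splits)
      then show "x \<in> ?L" by blast
    qed
    moreover interpret product_sigma_finite "\<lambda>_::nat. lborel :: real measure" by standard
    have "emeasure (euclid 1) (\<Pi>\<^sub>E v\<in>{1}. I) = 1"
      unfolding euclid_def by (simp, subst emeasure_PiM) (auto simp: I_def)
    ultimately show ?thesis using emeasure_surface_measure[OF S] S by simp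
  qed
  have fin: "finite A" using assms unfolding usphere_1 by (rule finite_subset) simp
  have "emeasure (surface_measure 1) A = (\<Sum>\<omega>\<in>A. emeasure (surface_measure 1) {\<omega>})"
    using sing assms fin
    by (intro emeasure_eq_sum_singleton) (auto simp: surface_measure_def)
  also have "\<dots> = (\<Sum>\<omega>\<in>A. 1)" using sing assms by (intro sum.cong) auto
  finally show ?thesis by simp
qed

end

theory Submission
  imports Defs
begin

text \<open>
  For the forward direction take \<open>b = ln \<bar>x\<bar>\<close> and \<open>f = \<bar>x\<bar> powr (N l)\<close>: the first has
  central bounded mean oscillation, the second lies in the Morrey space because of the lower bound
  on \<open>l\<close>, and the commutator is defined at a point \<open>x \<noteq> 0\<close> only if
  \<open>t powr (N l) * ln t * \<phi> t\<close> is integrable on \<open>(0, 1]\<close>.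

  Conversely, dilation by \<open>t\<close> multiplies the Morrey norm by at most \<open>t powr (N l)\<close>, and comparing the
  means of \<open>b\<close> over dyadic balls shows that the norm of \<open>b(x) - b(t x)\<close> over a ball is
  \<open>O(1 + ln (1 / t))\<close> times the norm of its indicator. Hoelder's inequality and Minkowski's integral
  inequality for the mixed norm then bound the commutator by the integral of
  \<open>t powr (N l) * (1 + ln (1 / t)) * \<phi> t\<close>. Polar coordinates enter through the identity between
  the mixed norm with all exponents \<open>1\<close> and the integral with respect to the Dunkl measure.
\<close>

section \<open>Powers and Lebesgue norms with values in the extended half-line\<close>

text \<open>The obstacle that shapes the proof is measurability. The functions in the spaces are
  measurable for a completed product measure, while the mixed norm integrates over slices, and
  slices of such functions need not be measurable. Hoelder and Minkowski are therefore shown for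
  functions measurable on the uncompleted product, and \<open>f\<close>, \<open>b\<close> and
  \<open>\<phi>\<close> are replaced by Borel representatives. This is legitimate because a null set
  of the whole space meets almost every slice in a null set, which is read off from the norm with
  all exponents 1 (\<open>mnorm_cong_AE\<close>), and because preimages of null sets under dilations
  are null (\<open>AE_dil\<close>).

  The lower bound on \<open>l\<close> makes the power of the radius locally of finite mixed norm: it
  is dominated by a product of powers of the block radii, and the exponent can be shared among the
  blocks so that every block converges. The summand 1 in \<open>1 + ln (1 / t)\<close> is harmless:
  away from \<open>t = 1\<close> the logarithm dominates it, and near \<open>t = 1\<close> the local
  integrability of \<open>\<phi>\<close> takes over.\<close>

lemma epowr_0 [simp]: "epowr 0 a = 0"
  by (simp add: epowr_def)

lemma epowr_top [simp]: "epowr top a = top"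
  by (simp add: epowr_def)

lemma epowr_ennreal: "0 \<le> x \<Longrightarrow> epowr (ennreal x) a = ennreal (x powr a)"
  by (simp add: epowr_def)

lemma epowr_1 [simp]: "epowr x 1 = x"
  by (cases x) (auto simp: epowr_ennreal)

lemma epowr_eq_0_iff [simp]: "epowr x a = 0 \<longleftrightarrow> x = 0"
  by (cases x) (auto simp: epowr_ennreal)

lemma epowr_eq_top_iff [simp]: "epowr x a = top \<longleftrightarrow> x = top"
  by (cases x) (auto simp: epowr_ennreal)

text \<open>The power laws hold for every real exponent, since \<open>epowr\<close> fixes 0 and
  infinity whatever the exponent is. The price is that \<open>epowr x 0 = 1\<close> holds only
  strictly between these two values.\<close>

lemma epowr_mult: "epowr (x * y) a = epowr x a * epowr y a"
proof (cases x; cases y)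
  fix p q assume "0 \<le> p" "x = ennreal p" "0 \<le> q" "y = ennreal q"
  then show ?thesis
    by (simp add: epowr_ennreal powr_mult flip: ennreal_mult)
next
  fix p assume "0 \<le> p" "x = ennreal p" "y = top"
  then show ?thesis
    by (cases "p = 0") (auto simp: ennreal_mult_top epowr_ennreal)
next
  fix p assume "0 \<le> p" "y = ennreal p" "x = top"
  then show ?thesis
    by (cases "p = 0") (auto simp: ennreal_top_mult epowr_ennreal)
qed simp

lemma epowr_epowr: "epowr (epowr x a) b = epowr x (a * b)"
  by (cases x) (auto simp: epowr_ennreal powr_powr)

lemma epowr_add: "epowr x a * epowr x b = epowr x (a + b)"
  by (cases x) (auto simp: epowr_ennreal powr_add ennreal_mult)

lemma epowr_mono: "0 \<le> a \<Longrightarrow> x \<le> y \<Longrightarrow> epowr x a \<le> epowr y a"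
  by (cases x; cases y) (auto simp: epowr_ennreal top_unique intro!: ennreal_leI powr_mono2)

lemma epowr_measurable [measurable]:
  assumes [measurable]: "f \<in> borel_measurable M"
  shows "(\<lambda>x. epowr (f x) a) \<in> borel_measurable M"
  unfolding epowr_def by measurable

text \<open>Weighted arithmetic and geometric means, the pointwise form of Hoelder. An infinite
  argument makes the right-hand side infinite, as both weights are positive.\<close>

lemma epowr_Young:
  assumes "0 < a" "0 < b" "a + b = 1"
  shows "epowr x a * epowr y b \<le> ennreal a * x + ennreal b * y"
proof (cases x; cases y)
  fix p q assume *: "0 \<le> p" "x = ennreal p" "0 \<le> q" "y = ennreal q"
  have "p powr a * q powr b \<le> a * p + b * q"
    using Youngs_inequality_0[of a b p q] assms * by (cases "p = 0 \<or> q = 0") auto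
  then show ?thesis
    using * assms by (simp add: epowr_ennreal flip: ennreal_mult ennreal_plus)
next
  fix p assume *: "0 \<le> p" "x = ennreal p" "y = top"
  then show ?thesis
    using assms by (auto simp: ennreal_mult_top)
next
  fix p assume "0 \<le> p" "y = ennreal p" "x = top"
  then show ?thesis
    using assms by (auto simp: ennreal_mult_top)
next
  assume "x = top" "y = top"
  then show ?thesis
    using assms by (auto simp: ennreal_mult_top)
qed

text \<open>Dividing \<open>f\<close> and \<open>g\<close> by their integrals reduces Hoelder's
  inequality to integrating Young's inequality, whose right-hand side then has integral
  \<open>a + b = 1\<close>. If an integral is 0, the product vanishes almost everywhere; if both are
  positive and one is infinite, so is the right-hand side.\<close>

lemma nn_integral_epowr_mult_le:
  assumes [measurable]: "f \<in> borel_measurable M" "g \<in> borel_measurable M"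
    and ab: "0 < a" "0 < b" "a + b = 1"
  shows "(\<integral>\<^sup>+x. epowr (f x) a * epowr (g x) b \<partial>M)
           \<le> epowr (\<integral>\<^sup>+x. f x \<partial>M) a * epowr (\<integral>\<^sup>+x. g x \<partial>M) b"
proof -
  define A where "A = (\<integral>\<^sup>+x. f x \<partial>M)"
  define B where "B = (\<integral>\<^sup>+x. g x \<partial>M)"
  consider "A = 0" | "B = 0" | "A \<noteq> 0" "B \<noteq> 0" "A = top \<or> B = top"
    | "A \<noteq> 0" "B \<noteq> 0" "A \<noteq> top" "B \<noteq> top" by blast
  then show ?thesis
  proof cases
    case 1
    then have "AE x in M. f x = 0" unfolding A_def by (subst (asm) nn_integral_0_iff_AE) auto
    then have "(\<integral>\<^sup>+x. epowr (f x) a * epowr (g x) b \<partial>M) = (\<integral>\<^sup>+x. 0 \<partial>M)"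
      by (intro nn_integral_cong_AE) auto
    then show ?thesis by simp
  next
    case 2
    then have "AE x in M. g x = 0" unfolding B_def by (subst (asm) nn_integral_0_iff_AE) auto
    then have "(\<integral>\<^sup>+x. epowr (f x) a * epowr (g x) b \<partial>M) = (\<integral>\<^sup>+x. 0 \<partial>M)"
      by (intro nn_integral_cong_AE) auto
    then show ?thesis by simp
  next
    case 3
    then have "epowr A a * epowr B b = top"
      by (auto simp: ennreal_mult_eq_top_iff)
    then show ?thesis by (simp add: A_def B_def)
  next
    case 4
    have A: "A * (f x / A) = f x" "B * (g x / B) = g x" for x
      using 4 by (simp_all add: ennreal_times_divide mult.commute[of A] mult.commute[of B] ennreal_mult_divide_eq)
    have "(\<integral>\<^sup>+x. epowr (f x) a * epowr (g x) b \<partial>M) =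
        (\<integral>\<^sup>+x. (epowr A a * epowr B b) * (epowr (f x / A) a * epowr (g x / B) b) \<partial>M)"
      by (rule nn_integral_cong) (subst A(1)[symmetric], subst A(2)[symmetric],
          simp only: epowr_mult ac_simps)
    also have "\<dots> = (epowr A a * epowr B b) * (\<integral>\<^sup>+x. epowr (f x / A) a * epowr (g x / B) b \<partial>M)"
      by (rule nn_integral_cmult) measurable
    also have "\<dots> \<le> (epowr A a * epowr B b) * (\<integral>\<^sup>+x. ennreal a * (f x / A) + ennreal b * (g x / B) \<partial>M)"
      by (intro mult_left_mono nn_integral_mono epowr_Young ab) auto
    also have "(\<integral>\<^sup>+x. ennreal a * (f x / A) + ennreal b * (g x / B) \<partial>M) =
        ennreal a * (A / A) + ennreal b * (B / B)"
      unfolding A_def B_def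
      by (subst nn_integral_add) (auto simp: nn_integral_cmult nn_integral_divide)
    also have "\<dots> = 1"
      using 4 ab by (simp add: ennreal_divide_self top.not_eq_extremum flip: ennreal_plus)
    finally show ?thesis by (simp add: A_def B_def)
  qed
qed

section \<open>Basic calculus of Lebesgue norms, with Hoelder and Minkowski\<close>

lemma Lp_norm_cong_AE:
  "AE x in M. f x = g x \<Longrightarrow> Lp_norm M p f = Lp_norm M p g"
  unfolding Lp_norm_def by (intro arg_cong[where f="\<lambda>x. epowr x _"] nn_integral_cong_AE) auto

lemma Lp_norm_cong:
  "(\<And>x. x \<in> space M \<Longrightarrow> f x = g x) \<Longrightarrow> Lp_norm M p f = Lp_norm M p g"
  by (rule Lp_norm_cong_AE) auto

lemma Lp_norm_mono_AE:
  assumes "0 < p" "AE x in M. f x \<le> g x"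
  shows "Lp_norm M p f \<le> Lp_norm M p g"
  unfolding Lp_norm_def
  using assms by (intro epowr_mono nn_integral_mono_AE) (auto elim!: eventually_mono intro: epowr_mono)

lemma Lp_norm_mono:
  "0 < p \<Longrightarrow> (\<And>x. x \<in> space M \<Longrightarrow> f x \<le> g x) \<Longrightarrow> Lp_norm M p f \<le> Lp_norm M p g"
  by (rule Lp_norm_mono_AE) auto

lemma Lp_norm_cmult:
  assumes "0 < p" "f \<in> borel_measurable M"
  shows "Lp_norm M p (\<lambda>x. c * f x) = c * Lp_norm M p f"
  using assms unfolding Lp_norm_def
  by (simp add: epowr_mult nn_integral_cmult epowr_epowr)

lemma Lp_norm_const:
  "0 < p \<Longrightarrow> Lp_norm M p (\<lambda>x. c) = c * epowr (emeasure M (space M)) (1 / p)"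
  unfolding Lp_norm_def by (simp add: epowr_mult epowr_epowr)

lemma Lp_norm_one: "Lp_norm M 1 f = (\<integral>\<^sup>+x. f x \<partial>M)"
  by (simp add: Lp_norm_def)

lemma Lp_norm_measurable [measurable (raw)]:
  assumes "sigma_finite_measure M" "(\<lambda>(y, x). f y x) \<in> borel_measurable (N \<Otimes>\<^sub>M M)"
  shows "(\<lambda>y. Lp_norm M p (f y)) \<in> borel_measurable N"
proof -
  interpret sigma_finite_measure M by fact
  note assms(2)[measurable]
  show ?thesis unfolding Lp_norm_def by measurable
qed

text \<open>Apply \<open>nn_integral_epowr_mult_le\<close> to the powers of order \<open>p\<close>
  and \<open>q\<close> with weights \<open>r / p\<close> and \<open>r / q\<close>. The case
  \<open>r = 1\<close> is the duality pairing that later yields local integrability and the control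
  of means.\<close>

lemma Lp_norm_Holder:
  assumes [measurable]: "f \<in> borel_measurable M" "g \<in> borel_measurable M"
    and pq: "0 < p" "0 < q" "0 < r" "1 / r = 1 / p + 1 / q"
  shows "Lp_norm M r (\<lambda>x. f x * g x) \<le> Lp_norm M p f * Lp_norm M q g"
proof -
  have 1: "r / p + r / q = 1" using pq(3) arg_cong[OF pq(4), of "\<lambda>x. r * x"] by (simp add: distrib_left)
  have "(\<integral>\<^sup>+x. epowr (f x * g x) r \<partial>M) =
      (\<integral>\<^sup>+x. epowr (epowr (f x) p) (r / p) * epowr (epowr (g x) q) (r / q) \<partial>M)"
    using pq by (simp add: epowr_mult epowr_epowr)
  also have "\<dots> \<le> epowr (\<integral>\<^sup>+x. epowr (f x) p \<partial>M) (r / p) * epowr (\<integral>\<^sup>+x. epowr (g x) q \<partial>M) (r / q)"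
    using pq 1 by (intro nn_integral_epowr_mult_le) auto
  finally have "epowr (\<integral>\<^sup>+x. epowr (f x * g x) r \<partial>M) (1 / r) \<le>
     epowr (epowr (\<integral>\<^sup>+x. epowr (f x) p \<partial>M) (r / p) * epowr (\<integral>\<^sup>+x. epowr (g x) q \<partial>M) (r / q)) (1 / r)"
    using pq by (intro epowr_mono) auto
  then show ?thesis
    using pq(1-3) by (simp add: Lp_norm_def epowr_mult epowr_epowr)
qed

text \<open>
  With \<open>a t\<close> the norm of \<open>F t\<close>, apply Hoelder's inequality to
  \<open>F t x = (F t x * a t powr (1 / p - 1)) * a t powr (1 - 1 / p)\<close> in \<open>t\<close>, raise to the power \<open>p\<close>
  and integrate in \<open>x\<close>. No truncation is needed, only the null set of \<open>t\<close> with \<open>a t = \<infinity>\<close> and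
  the vanishing of \<open>F t\<close> for \<open>a t = 0\<close>.
\<close>

lemma Lp_norm_Minkowski:
  assumes M: "sigma_finite_measure M" and T: "sigma_finite_measure T"
    and F[measurable]: "(\<lambda>(t, x). F t x) \<in> borel_measurable (T \<Otimes>\<^sub>M M)" and p: "1 < p"
  shows "Lp_norm M p (\<lambda>x. \<integral>\<^sup>+t. F t x \<partial>T) \<le> (\<integral>\<^sup>+t. Lp_norm M p (F t) \<partial>T)"
proof -
  interpret M: sigma_finite_measure M by fact
  interpret T: sigma_finite_measure T by fact
  interpret TM: pair_sigma_finite T M ..
  define a where "a t = Lp_norm M p (F t)" for t
  define A where "A = (\<integral>\<^sup>+t. a t \<partial>T)"
  define c where "c t = (if a t = 0 \<or> a t = top then 0 else epowr (a t) (1 - p))" for t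
  have [measurable]: "a \<in> borel_measurable T"
    unfolding a_def by (rule Lp_norm_measurable[OF M F])
  have [measurable]: "c \<in> borel_measurable T"
    unfolding c_def by measurable
  show ?thesis
  proof (cases "A = top")
    case True then show ?thesis by (simp add: A_def a_def)
  next
    case False
    have "AE t in T. a t \<noteq> top"
      using False nn_integral_PInf_AE[of a T] by (simp add: A_def)
    then have "AE t in T. AE x in M. F t x \<le> epowr (c t * epowr (F t x) p) (1 / p) * epowr (a t) (1 - 1 / p)"
    proof (rule AE_mp, intro AE_I2[of T] impI)
      fix t assume t[measurable]: "t \<in> space T" and fin: "a t \<noteq> top"
      show "AE x in M. F t x \<le> epowr (c t * epowr (F t x) p) (1 / p) * epowr (a t) (1 - 1 / p)"
      proof (cases "a t = 0")
        case True
        then have "(\<integral>\<^sup>+x. epowr (F t x) p \<partial>M) = 0" by (simp add: a_def Lp_norm_def)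
        moreover have "(\<lambda>x. epowr (F t x) p) \<in> borel_measurable M" by measurable
        ultimately have "AE x in M. epowr (F t x) p = 0" by (subst (asm) nn_integral_0_iff_AE) auto
        then show ?thesis by auto
      next
        case False
        have e: "(1 - p) * (1 / p) + (1 - 1 / p) = 0" using p by (simp add: field_simps)
        have "epowr (a t) 0 = 1"
          using False fin by (cases "a t") (auto simp: epowr_ennreal)
        then have "epowr (a t) ((1 - p) * (1 / p)) * epowr (a t) (1 - 1 / p) = 1"
          unfolding epowr_add e .
        moreover have "epowr (c t * epowr (F t x) p) (1 / p) * epowr (a t) (1 - 1 / p) =
          F t x * (epowr (a t) ((1 - p) * (1 / p)) * epowr (a t) (1 - 1 / p))" for x
          using False fin p by (simp add: c_def epowr_mult epowr_epowr ac_simps)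
        ultimately show ?thesis by simp
      qed
    qed
    then have "AE x in M. AE t in T. F t x \<le> epowr (c t * epowr (F t x) p) (1 / p) * epowr (a t) (1 - 1 / p)"
      by (subst (asm) TM.AE_commute) measurable
    then have "AE x in M. epowr (\<integral>\<^sup>+t. F t x \<partial>T) p \<le> (\<integral>\<^sup>+t. c t * epowr (F t x) p \<partial>T) * epowr A (p - 1)"
    proof (rule AE_mp, intro AE_I2 impI)
      fix x assume x[measurable]: "x \<in> space M"
        and le: "AE t in T. F t x \<le> epowr (c t * epowr (F t x) p) (1 / p) * epowr (a t) (1 - 1 / p)"
      have "(\<integral>\<^sup>+t. F t x \<partial>T) \<le> (\<integral>\<^sup>+t. epowr (c t * epowr (F t x) p) (1 / p) * epowr (a t) (1 - 1 / p) \<partial>T)"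
        by (rule nn_integral_mono_AE) fact
      also have "\<dots> \<le> epowr (\<integral>\<^sup>+t. c t * epowr (F t x) p \<partial>T) (1 / p) * epowr A (1 - 1 / p)"
        unfolding A_def using p by (intro nn_integral_epowr_mult_le) auto
      finally have "epowr (\<integral>\<^sup>+t. F t x \<partial>T) p \<le>
        epowr (epowr (\<integral>\<^sup>+t. c t * epowr (F t x) p \<partial>T) (1 / p) * epowr A (1 - 1 / p)) p"
        using p by (intro epowr_mono) auto
      moreover have "(1 - 1 / p) * p = p - 1" using p by (simp add: field_simps)
      ultimately show "epowr (\<integral>\<^sup>+t. F t x \<partial>T) p \<le> (\<integral>\<^sup>+t. c t * epowr (F t x) p \<partial>T) * epowr A (p - 1)"
        using p by (simp add: epowr_mult epowr_epowr)
    qed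
    then have "(\<integral>\<^sup>+x. epowr (\<integral>\<^sup>+t. F t x \<partial>T) p \<partial>M) \<le>
      (\<integral>\<^sup>+x. (\<integral>\<^sup>+t. c t * epowr (F t x) p \<partial>T) * epowr A (p - 1) \<partial>M)"
      by (rule nn_integral_mono_AE)
    also have "\<dots> = (\<integral>\<^sup>+x. (\<integral>\<^sup>+t. c t * epowr (F t x) p \<partial>T) \<partial>M) * epowr A (p - 1)"
      by (intro nn_integral_multc) measurable
    also have "(\<integral>\<^sup>+x. (\<integral>\<^sup>+t. c t * epowr (F t x) p \<partial>T) \<partial>M) = (\<integral>\<^sup>+t. (\<integral>\<^sup>+x. c t * epowr (F t x) p \<partial>M) \<partial>T)"
      by (intro TM.Fubini') measurable
    also have "\<dots> \<le> (\<integral>\<^sup>+t. a t \<partial>T)"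
    proof (rule nn_integral_mono)
      fix t assume t[measurable]: "t \<in> space T"
      have "(\<integral>\<^sup>+x. c t * epowr (F t x) p \<partial>M) = c t * epowr (a t) p"
        using p by (subst nn_integral_cmult) (auto simp: a_def Lp_norm_def epowr_epowr)
      also have "\<dots> \<le> a t"
        by (auto simp: c_def epowr_add)
      finally show "(\<integral>\<^sup>+x. c t * epowr (F t x) p \<partial>M) \<le> a t" .
    qed
    finally have "(\<integral>\<^sup>+x. epowr (\<integral>\<^sup>+t. F t x \<partial>T) p \<partial>M) \<le> A * epowr A (p - 1)"
      by (simp add: A_def mult_right_mono)
    also have "\<dots> = epowr A p" using epowr_add[of A 1 "p - 1"] by simp
    finally have "epowr (\<integral>\<^sup>+x. epowr (\<integral>\<^sup>+t. F t x \<partial>T) p \<partial>M) (1 / p) \<le> epowr (epowr A p) (1 / p)"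
      using p by (intro epowr_mono) auto
    then show ?thesis using p by (simp add: Lp_norm_def[of M p "\<lambda>x. \<integral>\<^sup>+t. F t x \<partial>T"] epowr_epowr A_def a_def)
  qed
qed

section \<open>Polar coordinates in one block\<close>

definition smul :: "nat \<Rightarrow> real \<Rightarrow> (nat \<Rightarrow> real) \<Rightarrow> nat \<Rightarrow> real" where
  "smul p t y = (\<lambda>v\<in>{1..p}. t * y v)"

definition weight :: "nat \<Rightarrow> (nat \<Rightarrow> real) \<Rightarrow> (nat \<Rightarrow> real) \<Rightarrow> real" where
  "weight p \<kappa> y = (\<Prod>v=1..p. \<bar>y v\<bar> powr (2 * \<kappa> v))"

lemma space_euclid: "space (euclid p) = extensional {1..p}"
  by (auto simp: euclid_def space_PiM PiE_def)

lemma euclid_component_measurable: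
  "v \<in> {1..p} \<Longrightarrow> (\<lambda>y. y v) \<in> borel_measurable (euclid p)"
  unfolding euclid_def by measurable

lemma sigma_finite_euclid: "sigma_finite_measure (euclid p)"
proof -
  interpret product_sigma_finite "\<lambda>_::nat. lborel :: real measure" by standard
  show ?thesis unfolding euclid_def by (rule sigma_finite) simp
qed

lemma smul_measurable [measurable (raw)]:
  assumes [measurable]: "f \<in> borel_measurable N" "g \<in> N \<rightarrow>\<^sub>M euclid p"
  shows "(\<lambda>x. smul p (f x) (g x)) \<in> N \<rightarrow>\<^sub>M euclid p"
proof -
  have "(\<lambda>x. \<lambda>v\<in>{1..p}. f x * g x v) \<in> N \<rightarrow>\<^sub>M (\<Pi>\<^sub>M v\<in>{1..p}. lborel)"
  proof (rule measurable_restrict)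
    fix v assume "v \<in> {1..p}"
    then have [measurable]: "(\<lambda>x. g x v) \<in> borel_measurable N"
      using measurable_compose[OF assms(2) euclid_component_measurable] by blast
    show "(\<lambda>x. f x * g x v) \<in> N \<rightarrow>\<^sub>M lborel" by simp
  qed
  then show ?thesis by (simp add: smul_def euclid_def)
qed

lemma smul_in_space [simp]: "smul p t y \<in> space (euclid p)"
  by (simp add: smul_def space_euclid)

lemma weight_measurable [measurable]: "weight p \<kappa> \<in> borel_measurable (euclid p)"
  unfolding weight_def[abs_def]
  by (intro borel_measurable_prod measurable_abs_powr euclid_component_measurable) auto

lemma weight_nonneg [simp]: "0 \<le> weight p \<kappa> y"
  unfolding weight_def by (intro prod_nonneg) auto

lemma smul_smul: "smul p s (smul p t y) = smul p (s * t) y"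
  by (auto simp: smul_def)

lemma L2_set_smul: "0 \<le> t \<Longrightarrow> L2_set (smul p t y) {1..p} = t * L2_set y {1..p}"
  unfolding smul_def by (subst L2_set_right_distrib) (auto intro!: L2_set_cong)

lemma weight_smul:
  assumes "0 < t"
  shows "weight p \<kappa> (smul p t y) = t powr (2 * (\<Sum>v=1..p. \<kappa> v)) * weight p \<kappa> y"
proof -
  have "weight p \<kappa> (smul p t y) = (\<Prod>v=1..p. t powr (2 * \<kappa> v) * \<bar>y v\<bar> powr (2 * \<kappa> v))"
    unfolding weight_def using assms
    by (intro prod.cong) (auto simp: smul_def abs_mult powr_mult)
  also have "\<dots> = t powr (2 * (\<Sum>v=1..p. \<kappa> v)) * weight p \<kappa> y"
    unfolding weight_def prod.distrib using assms by (simp add: powr_sum sum_distrib_left)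
  finally show ?thesis .
qed

text \<open>A product measure is determined by its values on boxes, and there each coordinate
  contributes one factor \<open>t\<close>.\<close>

lemma euclid_smul:
  assumes t: "0 < t"
  shows "density (distr (euclid p) (euclid p) (smul p t)) (\<lambda>_. ennreal (t ^ p)) = euclid p"
proof -
  interpret product_sigma_finite "\<lambda>_::nat. lborel :: real measure" by standard
  let ?P = "density (distr (euclid p) (euclid p) (smul p t)) (\<lambda>_. ennreal (t ^ p))"
  have "?P = (\<Pi>\<^sub>M v\<in>{1..p}. lborel)"
  proof (rule PiM_eqI)
    show "sets ?P = sets (\<Pi>\<^sub>M v\<in>{1..p}. lborel)" by (simp add: euclid_def)
    fix A :: "nat \<Rightarrow> real set" assume A: "\<And>v. v \<in> {1..p} \<Longrightarrow> A v \<in> sets lborel"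
    have one: "ennreal t * emeasure lborel ((\<lambda>s. t * s) -` A v) = emeasure lborel (A v)"
      if v: "v \<in> {1..p}" for v
    proof -
      note A[OF v, simplified, measurable]
      have "emeasure lborel (A v) = (\<integral>\<^sup>+s. indicator (A v) s \<partial>lborel)" by simp
      also have "\<dots> = ennreal t * (\<integral>\<^sup>+s. indicator (A v) (0 + t * s) \<partial>lborel)"
        using t by (subst nn_integral_real_affine[of _ t 0]) auto
      also have "(\<integral>\<^sup>+s. indicator (A v) (0 + t * s) \<partial>lborel) = (\<integral>\<^sup>+s. indicator ((\<lambda>s. t * s) -` A v) s \<partial>lborel)"
        by (intro nn_integral_cong) (auto split: split_indicator)
      also have "\<dots> = emeasure lborel ((\<lambda>s. t * s) -` A v)"
        using measurable_sets[of "\<lambda>s. t * s" borel borel "A v"] A[OF v] by (intro nn_integral_indicator) auto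
      finally show ?thesis ..
    qed
    have AA: "Pi\<^sub>E {1..p} A \<in> sets (euclid p)" unfolding euclid_def using A by (intro sets_PiM_I_finite) auto
    have B: "(\<lambda>s. t * s) -` A v \<in> sets lborel" if "v \<in> {1..p}" for v
      using measurable_sets[of "\<lambda>s. t * s" borel borel "A v"] A[OF that] by auto
    have "emeasure ?P (Pi\<^sub>E {1..p} A) = ennreal (t ^ p) * emeasure (distr (euclid p) (euclid p) (smul p t)) (Pi\<^sub>E {1..p} A)"
      using AA by (subst emeasure_density_const) auto
    also have "emeasure (distr (euclid p) (euclid p) (smul p t)) (Pi\<^sub>E {1..p} A) =
        emeasure (euclid p) (smul p t -` Pi\<^sub>E {1..p} A \<inter> space (euclid p))"
      using AA by (intro emeasure_distr) measurable
    also have "smul p t -` Pi\<^sub>E {1..p} A \<inter> space (euclid p) = (\<Pi>\<^sub>E v\<in>{1..p}. (\<lambda>s. t * s) -` A v)"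
      by (auto simp: smul_def space_euclid PiE_def Pi_def)
    also have "emeasure (euclid p) \<dots> = (\<Prod>v=1..p. emeasure lborel ((\<lambda>s. t * s) -` A v))"
      unfolding euclid_def using B by (intro emeasure_PiM) auto
    also have "ennreal (t ^ p) * \<dots> = (\<Prod>v=1..p. ennreal t * emeasure lborel ((\<lambda>s. t * s) -` A v))"
      using t by (simp add: prod.distrib ennreal_power)
    also have "\<dots> = (\<Prod>v=1..p. emeasure lborel (A v))"
      by (intro prod.cong one) auto
    finally show "emeasure ?P (Pi\<^sub>E {1..p} A) = (\<Prod>v=1..p. emeasure lborel (A v))" .
  qed simp
  then show ?thesis by (simp add: euclid_def)
qed

lemma nn_integral_euclid_smul:
  assumes [measurable]: "f \<in> borel_measurable (euclid p)" and t: "0 < t"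
  shows "(\<integral>\<^sup>+y. f (smul p t y) \<partial>euclid p) = ennreal (t powr - real p) * (\<integral>\<^sup>+y. f y \<partial>euclid p)"
proof -
  have "(\<integral>\<^sup>+y. f y \<partial>euclid p) = (\<integral>\<^sup>+y. f y \<partial>density (distr (euclid p) (euclid p) (smul p t)) (\<lambda>_. ennreal (t ^ p)))"
    by (simp add: euclid_smul[OF t])
  also have "\<dots> = ennreal (t ^ p) * (\<integral>\<^sup>+y. f (smul p t y) \<partial>euclid p)"
    by (subst nn_integral_density, simp, simp, subst nn_integral_distr)
       (auto simp: nn_integral_cmult)
  finally have "ennreal (t powr - real p) * (\<integral>\<^sup>+y. f y \<partial>euclid p) =
     ennreal (t powr - real p * t ^ p) * (\<integral>\<^sup>+y. f (smul p t y) \<partial>euclid p)"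
    using t by (simp add: ennreal_mult mult.assoc)
  also have "t powr - real p * t ^ p = 1"
    using t by (simp add: powr_minus powr_realpow)
  finally show ?thesis by simp
qed

lemma usphere_sets [measurable]: "usphere p \<in> sets (euclid p)"
  unfolding usphere_def by measurable

lemma punctured_ball_sets [measurable]: "punctured_ball p \<in> sets (euclid p)"
  unfolding punctured_ball_def by measurable

lemma space_dunkl_sphere: "space (dunkl_sphere p \<kappa>) = usphere p"
  by (auto simp: dunkl_sphere_def surface_measure_def space_restrict_space usphere_def)

lemma sets_dunkl_sphere [measurable_cong]:
  "sets (dunkl_sphere p \<kappa>) = sets (restrict_space (euclid p) (usphere p))"
  by (simp add: dunkl_sphere_def surface_measure_def)

lemma space_dunkl_radial: "space (dunkl_radial p \<kappa>) = {0<..}"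
  by (simp add: dunkl_radial_def space_restrict_space)

lemma sets_dunkl_radial [measurable_cong]:
  "sets (dunkl_radial p \<kappa>) = sets (restrict_space borel {0<..})"
  by (simp add: dunkl_radial_def sets_restrict_space)

lemma id_dunkl_sphere: "(\<lambda>\<omega>. \<omega>) \<in> dunkl_sphere p \<kappa> \<rightarrow>\<^sub>M euclid p"
  using measurable_restrict_space1[OF measurable_ident, of "euclid p" "usphere p"]
  by (simp add: measurable_cong_sets[OF sets_dunkl_sphere refl] id_def)

lemma id_dunkl_radial: "(\<lambda>\<rho>. \<rho>) \<in> borel_measurable (dunkl_radial p \<kappa>)"
  using measurable_restrict_space1[OF measurable_ident, of borel "{0<..}"]
  by (simp add: measurable_cong_sets[OF sets_dunkl_radial refl] id_def)

lemma radial_proj_smul: "radial_proj p y = smul p (1 / L2_set y {1..p}) y"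
  by (simp add: radial_proj_def smul_def)

text \<open>The spherical measure is an image of a measure on the punctured ball, so spherical
  integrals become ball integrals of functions of the direction. In this form Tonelli's theorem for
  Lebesgue measure applies to them.\<close>

lemma nn_integral_dunkl_sphere:
  assumes [measurable]: "h \<in> borel_measurable (euclid p)"
  shows "(\<integral>\<^sup>+\<omega>. h \<omega> \<partial>dunkl_sphere p \<kappa>) = of_nat p *
    (\<integral>\<^sup>+y. ennreal (weight p \<kappa> (radial_proj p y)) * h (radial_proj p y) * indicator (punctured_ball p) y \<partial>euclid p)"
proof -
  let ?S = "restrict_space (euclid p) (usphere p)" and ?B = "restrict_space (euclid p) (punctured_ball p)"
  have [measurable]: "h \<in> borel_measurable ?S" "weight p \<kappa> \<in> borel_measurable ?S"
    by (auto intro: measurable_restrict_space1)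
  have "(\<integral>\<^sup>+\<omega>. h \<omega> \<partial>dunkl_sphere p \<kappa>) =
     (\<integral>\<^sup>+\<omega>. ennreal (weight p \<kappa> \<omega>) * h \<omega> \<partial>surface_measure p)"
    unfolding dunkl_sphere_def weight_def[symmetric]
    by (subst nn_integral_density) (auto simp: surface_measure_def)
  also have "\<dots> = (\<integral>\<^sup>+y. ennreal (weight p \<kappa> (radial_proj p y)) * h (radial_proj p y) \<partial>scale_measure (of_nat p) ?B)"
    unfolding surface_measure_def by (subst nn_integral_distr) auto
  also have "\<dots> = of_nat p * (\<integral>\<^sup>+y. ennreal (weight p \<kappa> (radial_proj p y)) * h (radial_proj p y) \<partial>?B)"
    by (subst nn_integral_scale_measure) auto
  also have "(\<integral>\<^sup>+y. ennreal (weight p \<kappa> (radial_proj p y)) * h (radial_proj p y) \<partial>?B) =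
     (\<integral>\<^sup>+y. ennreal (weight p \<kappa> (radial_proj p y)) * h (radial_proj p y) * indicator (punctured_ball p) y \<partial>euclid p)"
    by (subst nn_integral_restrict_space) auto
  finally show ?thesis .
qed

lemma nn_integral_dunkl_radial:
  assumes [measurable]: "h \<in> borel_measurable borel"
  shows "(\<integral>\<^sup>+\<rho>. h \<rho> \<partial>dunkl_radial p \<kappa>) =
    (\<integral>\<^sup>+\<rho>. ennreal (\<rho> powr (hom_dim p \<kappa> - 1)) * h \<rho> * indicator {0<..} \<rho> \<partial>lborel)"
proof -
  have [measurable]: "h \<in> borel_measurable (restrict_space lborel {0<..})"
    by (rule measurable_restrict_space1) simp
  show ?thesis
    unfolding dunkl_radial_def
    by (subst nn_integral_density)
       (auto simp: nn_integral_restrict_space intro!: measurable_restrict_space1)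
qed

text \<open>The radial integral left over at the end of \<open>nn_integral_polar\<close>; its value
  cancels the cone factor \<open>p\<close> and the power of the norm there.\<close>

lemma nn_integral_powr_tail:
  assumes c: "0 < c" and p: "0 < p"
  shows "(\<integral>\<^sup>+s. ennreal (s powr (- 1 - p)) * indicator {c..} s \<partial>lborel) = ennreal (c powr - p / p)"
proof -
  have "(\<integral>\<^sup>+s. ennreal (s powr (- 1 - p)) * indicator {c..} s \<partial>lborel) = ennreal (0 - (- (c powr - p) / p))"
  proof (rule nn_integral_FTC_atLeast)
    fix x assume "c \<le> x"
    then have "((\<lambda>x. x powr - p) has_real_derivative - p * x powr (- p - 1)) (at x)"
      using c by (intro has_real_derivative_powr) simp
    from DERIV_cmult[OF this, of "- 1 / p"]
    show "((\<lambda>x. - (x powr - p) / p) has_real_derivative x powr (- 1 - p)) (at x)"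
      using p by (simp add: minus_diff_commute)
    show "0 \<le> x powr (- 1 - p)" by simp
  next
    have "((\<lambda>x. x powr - p) \<longlongrightarrow> 0) at_top"
      using p by (intro tendsto_neg_powr filterlim_ident) auto
    from tendsto_mult[OF this tendsto_const[of "- 1 / p"]]
    show "((\<lambda>x. - (x powr - p) / p) \<longlongrightarrow> 0) at_top" by simp
  qed auto
  then show ?thesis by simp
qed

lemma AE_euclid_nonzero:
  assumes "v \<in> {1..p}" shows "AE y in euclid p. y v \<noteq> 0"
proof -
  interpret product_sigma_finite "\<lambda>_::nat. lborel :: real measure" by standard
  have "{y \<in> space (euclid p). \<not> y v \<noteq> 0} = (\<Pi>\<^sub>E w\<in>{1..p}. if w = v then {0} else UNIV)"
    using assms by (auto simp: space_euclid PiE_def Pi_def split: if_splits)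
  moreover have "emeasure (euclid p) \<dots> = (\<Prod>w=1..p. emeasure lborel (if w = v then {0} else UNIV :: real set))"
    unfolding euclid_def by (rule emeasure_PiM) auto
  moreover have "\<dots> = 0"
    using assms by (intro prod_zero) (auto intro!: bexI[of _ v])
  moreover have "(\<Pi>\<^sub>E w\<in>{1..p}. if w = v then {0} else UNIV) \<in> sets (euclid p)"
    unfolding euclid_def by (rule sets_PiM_I_finite) auto
  ultimately show ?thesis
    by (intro AE_I[OF subset_refl]) auto
qed

lemma AE_weight_pos: "AE y in euclid p. 0 < weight p \<kappa> y"
proof -
  have "AE y in euclid p. \<forall>v\<in>{1..p}. y v \<noteq> 0"
    by (intro AE_ball_countable[THEN iffD2] ballI AE_euclid_nonzero) auto
  then show ?thesis
    by eventually_elim (auto simp: weight_def intro!: prod_pos)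
qed

lemma AE_L2_set_pos: assumes "1 \<le> p" shows "AE y in euclid p. 0 < L2_set y {1..p}"
proof -
  have "AE y in euclid p. y 1 \<noteq> 0" using assms by (intro AE_euclid_nonzero) auto
  then show ?thesis
  proof eventually_elim
    fix y :: "nat \<Rightarrow> real" assume "y 1 \<noteq> 0"
    then have "0 < \<bar>y 1\<bar>" by simp
    also have "\<dots> \<le> L2_set y {1..p}" using member_le_L2_set[of "{1..p}" 1 "\<lambda>v. \<bar>y v\<bar>"] assms by (simp add: L2_set_def)
    finally show "0 < L2_set y {1..p}" .
  qed
qed

text \<open>
  Inserting the cone formula for the surface measure turns the right-hand side into a double
  integral over the punctured ball and the half-line; two scalings and two applications of
  Tonelli's theorem reduce the claim to the integral of \<open>s powr (- 1 - p)\<close> over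
  \<open>s \<ge> L2_set z {1..p}\<close>.
\<close>

lemma nn_integral_polar:
  assumes p: "1 \<le> p" and G[measurable]: "G \<in> borel_measurable (euclid p)"
  shows "(\<integral>\<^sup>+\<rho>. (\<integral>\<^sup>+\<omega>. G (smul p \<rho> \<omega>) \<partial>dunkl_sphere p \<kappa>) \<partial>dunkl_radial p \<kappa>) =
    (\<integral>\<^sup>+y. ennreal (weight p \<kappa> y) * G y \<partial>euclid p)"
proof -
  interpret E: sigma_finite_measure "euclid p" by (rule sigma_finite_euclid)
  interpret LE: pair_sigma_finite lborel "euclid p" ..
  let ?N = "hom_dim p \<kappa>" and ?K = "2 * (\<Sum>v=1..p. \<kappa> v)" and ?n = "\<lambda>y. L2_set y {1..p}"
  let ?I = "\<lambda>\<rho>::real. indicator {0<..} \<rho> :: ennreal" and ?B = "\<lambda>y. indicator (punctured_ball p) y :: ennreal"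
  have [measurable]: "(\<lambda>y. smul p (1 / ?n y) y) \<in> euclid p \<rightarrow>\<^sub>M euclid p" by measurable
  have [measurable]: "(\<lambda>y. radial_proj p y) \<in> euclid p \<rightarrow>\<^sub>M euclid p"
    unfolding radial_proj_smul by measurable
  have "(\<integral>\<^sup>+\<rho>. (\<integral>\<^sup>+\<omega>. G (smul p \<rho> \<omega>) \<partial>dunkl_sphere p \<kappa>) \<partial>dunkl_radial p \<kappa>) =
     (\<integral>\<^sup>+\<rho>. of_nat p * (\<integral>\<^sup>+y. ennreal (weight p \<kappa> (radial_proj p y)) * G (smul p \<rho> (radial_proj p y)) * ?B y \<partial>euclid p) \<partial>dunkl_radial p \<kappa>)"
    by (subst nn_integral_dunkl_sphere) auto
  also have "\<dots> = (\<integral>\<^sup>+\<rho>. ennreal (\<rho> powr (?N - 1)) *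
       (of_nat p * (\<integral>\<^sup>+y. ennreal (weight p \<kappa> (radial_proj p y)) * G (smul p \<rho> (radial_proj p y)) * ?B y \<partial>euclid p)) * ?I \<rho> \<partial>lborel)"
    by (rule nn_integral_dunkl_radial) measurable
  also have "\<dots> = (\<integral>\<^sup>+\<rho>. (\<integral>\<^sup>+y. of_nat p * ennreal (weight p \<kappa> (radial_proj p y)) * ?B y *
       (ennreal (\<rho> powr (?N - 1)) * G (smul p \<rho> (radial_proj p y)) * ?I \<rho>) \<partial>euclid p) \<partial>lborel)"
    by (subst nn_integral_cmult[symmetric], measurable, subst nn_integral_cmult[symmetric], measurable,
       subst nn_integral_multc[symmetric], measurable) (simp add: ac_simps)
  also have "\<dots> = (\<integral>\<^sup>+y. (\<integral>\<^sup>+\<rho>. of_nat p * ennreal (weight p \<kappa> (radial_proj p y)) * ?B y *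
       (ennreal (\<rho> powr (?N - 1)) * G (smul p \<rho> (radial_proj p y)) * ?I \<rho>) \<partial>lborel) \<partial>euclid p)"
    by (rule LE.Fubini'[symmetric]) measurable
  also have "\<dots> = (\<integral>\<^sup>+y. (\<integral>\<^sup>+s. of_nat p * ennreal (?n y powr p) * ennreal (weight p \<kappa> y) * ?B y *
       (ennreal (s powr (?N - 1)) * G (smul p s y) * ?I s) \<partial>lborel) \<partial>euclid p)"
  proof (rule nn_integral_cong)
    fix y assume y[measurable]: "y \<in> space (euclid p)"
    show "(\<integral>\<^sup>+\<rho>. of_nat p * ennreal (weight p \<kappa> (radial_proj p y)) * ?B y *
       (ennreal (\<rho> powr (?N - 1)) * G (smul p \<rho> (radial_proj p y)) * ?I \<rho>) \<partial>lborel) =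
      (\<integral>\<^sup>+s. of_nat p * ennreal (?n y powr p) * ennreal (weight p \<kappa> y) * ?B y *
       (ennreal (s powr (?N - 1)) * G (smul p s y) * ?I s) \<partial>lborel)"
    proof (cases "y \<in> punctured_ball p")
      case True
      define c where "c = ?n y"
      have c: "0 < c" using True by (simp add: c_def punctured_ball_def)
      have rp: "radial_proj p y = smul p (1 / c) y" by (simp add: radial_proj_smul c_def)
      define k where "k \<rho> = of_nat p * ennreal (weight p \<kappa> (radial_proj p y)) * ?B y *
           (ennreal (\<rho> powr (?N - 1)) * G (smul p \<rho> (radial_proj p y)) * ?I \<rho>)" for \<rho>
      have yE: "radial_proj p y \<in> space (euclid p)" by (simp add: radial_proj_smul)
      have [measurable]: "k \<in> borel_measurable borel"
        unfolding k_def using yE by measurable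
      have "(\<integral>\<^sup>+\<rho>. k \<rho> \<partial>lborel) = ennreal c * (\<integral>\<^sup>+s. k (0 + c * s) \<partial>lborel)"
        using c nn_integral_real_affine[of k c 0] by simp
      also have "\<dots> = (\<integral>\<^sup>+s. ennreal c * k (0 + c * s) \<partial>lborel)"
        by (rule nn_integral_cmult[symmetric]) measurable
      also have "\<dots> = (\<integral>\<^sup>+s. of_nat p * ennreal (c powr p) * ennreal (weight p \<kappa> y) * ?B y *
           (ennreal (s powr (?N - 1)) * G (smul p s y) * ?I s) \<partial>lborel)"
      proof (rule nn_integral_cong)
        fix s :: real
        show "ennreal c * k (0 + c * s) =
          of_nat p * ennreal (c powr p) * ennreal (weight p \<kappa> y) * ?B y *
           (ennreal (s powr (?N - 1)) * G (smul p s y) * ?I s)"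
        proof (cases "0 < s")
          case s: True
          have "c * (weight p \<kappa> (radial_proj p y) * (c * s) powr (?N - 1)) =
             (c powr 1 * (1 / c) powr ?K * c powr (?N - 1)) * (weight p \<kappa> y * s powr (?N - 1))"
            using c s by (simp add: rp weight_smul powr_mult)
          \<comment> \<open>The exponents \<open>1\<close>, \<open>- ?K\<close> and
            \<open>?N - 1\<close> add up to \<open>p\<close>, as \<open>?N = p + ?K\<close>.\<close>
          also have "c powr 1 * (1 / c) powr ?K * c powr (?N - 1) = c powr p"
            using c by (simp only: powr_divide powr_one_eq_one powr_minus_divide[symmetric] powr_add[symmetric])
              (simp add: hom_dim_def)
          finally have "c * (weight p \<kappa> (radial_proj p y) * (c * s) powr (?N - 1)) = c powr p * (weight p \<kappa> y * s powr (?N - 1))" .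
          then have e: "ennreal c * (ennreal (weight p \<kappa> (radial_proj p y)) * ennreal ((c * s) powr (?N - 1))) =
              ennreal (c powr p) * (ennreal (weight p \<kappa> y) * ennreal (s powr (?N - 1)))"
            using c by (simp add: ennreal_mult[symmetric])
          have E: "ennreal c * k (0 + c * s) =
            (ennreal c * (ennreal (weight p \<kappa> (radial_proj p y)) * ennreal ((c * s) powr (?N - 1)))) *
            (of_nat p * ?B y * G (smul p (c * s) (radial_proj p y)) * ?I (c * s))"
            unfolding k_def by (simp only: ac_simps add_0_left)
          have B: "smul p (c * s) (radial_proj p y) = smul p s y"
            using c by (simp add: rp smul_smul)
          have I: "?I (c * s) = 1" "?I s = 1" using c s by auto
          show ?thesis unfolding E e B I by (simp only: ac_simps mult_1_right mult_1_left)
        next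
          case False
          then have "?I (c * s) = 0" "?I s = 0"
            using c by (auto simp: zero_less_mult_iff split: split_indicator)
          then show ?thesis by (simp add: k_def)
        qed
      qed
      finally show ?thesis unfolding c_def k_def .
    qed simp
  qed
  also have "\<dots> = (\<integral>\<^sup>+s. (\<integral>\<^sup>+y. of_nat p * ennreal (?n y powr p) * ennreal (weight p \<kappa> y) * ?B y *
       (ennreal (s powr (?N - 1)) * G (smul p s y) * ?I s) \<partial>euclid p) \<partial>lborel)"
    by (rule LE.Fubini') measurable
  also have "\<dots> = (\<integral>\<^sup>+s. (\<integral>\<^sup>+z. of_nat p * ennreal (?n z powr p) * ennreal (weight p \<kappa> z) * G z *
       (ennreal (s powr (- 1 - real p)) * indicator {z. 0 < ?n z \<and> ?n z \<le> s} z) \<partial>euclid p) \<partial>lborel)"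
  proof (rule nn_integral_cong)
    fix s :: real
    show "(\<integral>\<^sup>+y. of_nat p * ennreal (?n y powr p) * ennreal (weight p \<kappa> y) * ?B y *
       (ennreal (s powr (?N - 1)) * G (smul p s y) * ?I s) \<partial>euclid p) =
      (\<integral>\<^sup>+z. of_nat p * ennreal (?n z powr p) * ennreal (weight p \<kappa> z) * G z *
       (ennreal (s powr (- 1 - real p)) * indicator {z. 0 < ?n z \<and> ?n z \<le> s} z) \<partial>euclid p)"
    proof (cases "0 < s")
      case s: True
      \<comment> \<open>The integrand in the variable \<open>z = smul p s y\<close>. The Jacobian
        \<open>s powr - real p\<close> of this substitution later turns \<open>s powr (- 1)\<close>
        into \<open>s powr (- 1 - real p)\<close>.\<close>
      define H where "H z = of_nat p * ennreal (?n z powr p) * ennreal (weight p \<kappa> z) * G z *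
         (ennreal (s powr (- 1)) * indicator {z. 0 < ?n z \<and> ?n z \<le> s} z)" for z
      have [measurable]: "H \<in> borel_measurable (euclid p)"
        unfolding H_def by measurable
      have "(\<integral>\<^sup>+y. of_nat p * ennreal (?n y powr p) * ennreal (weight p \<kappa> y) * ?B y *
         (ennreal (s powr (?N - 1)) * G (smul p s y) * ?I s) \<partial>euclid p) = (\<integral>\<^sup>+y. H (smul p s y) \<partial>euclid p)"
      proof (rule nn_integral_cong)
        fix y assume y: "y \<in> space (euclid p)"
        have L: "?n (smul p s y) = s * ?n y" using s by (intro L2_set_smul) simp
        have e1: "s powr (?N - 1) = s powr p * s powr ?K * s powr (- 1)"
          using s by (simp only: powr_add[symmetric]) (simp add: hom_dim_def)
        have "?n y powr p * (weight p \<kappa> y * s powr (?N - 1)) =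
          (s * ?n y) powr p * (s powr ?K * weight p \<kappa> y * s powr (- 1))"
          unfolding e1 using s by (simp add: powr_mult)
        then have e: "ennreal (?n y powr p) * (ennreal (weight p \<kappa> y) * ennreal (s powr (?N - 1))) =
          ennreal ((s * ?n y) powr p) * (ennreal (s powr ?K * weight p \<kappa> y) * ennreal (s powr (- 1)))"
          by (simp only: ennreal_mult[symmetric] powr_ge_zero weight_nonneg mult_nonneg_nonneg)
        have B: "?B y = indicator {z. 0 < ?n z \<and> ?n z \<le> s} (smul p s y)" "?I s = 1"
          using s y L by (auto simp: punctured_ball_def zero_less_mult_iff split: split_indicator)
        have E: "of_nat p * ennreal (?n y powr p) * ennreal (weight p \<kappa> y) * ?B y *
         (ennreal (s powr (?N - 1)) * G (smul p s y) * ?I s) =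
          (ennreal (?n y powr p) * (ennreal (weight p \<kappa> y) * ennreal (s powr (?N - 1)))) *
          (of_nat p * ?B y * G (smul p s y) * ?I s)"
          by (simp only: ac_simps)
        show "of_nat p * ennreal (?n y powr p) * ennreal (weight p \<kappa> y) * ?B y *
         (ennreal (s powr (?N - 1)) * G (smul p s y) * ?I s) = H (smul p s y)"
          unfolding E unfolding H_def e B L weight_smul[OF s] by (simp only: ac_simps mult_1_right mult_1_left)
      qed
      also have "\<dots> = (\<integral>\<^sup>+z. ennreal (s powr - real p) * H z \<partial>euclid p)"
        using s by (subst nn_integral_euclid_smul) (auto simp: nn_integral_cmult)
      also have "\<dots> = (\<integral>\<^sup>+z. of_nat p * ennreal (?n z powr p) * ennreal (weight p \<kappa> z) * G z *
       (ennreal (s powr (- 1 - real p)) * indicator {z. 0 < ?n z \<and> ?n z \<le> s} z) \<partial>euclid p)"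
      proof (rule nn_integral_cong)
        fix z
        have "- real p + - 1 = - 1 - real p" by simp
        then have e: "ennreal (s powr (- 1 - real p)) = ennreal (s powr - real p) * ennreal (s powr (- 1))"
          by (simp only: ennreal_mult[symmetric] powr_ge_zero powr_add[symmetric])
        show "ennreal (s powr - real p) * H z = of_nat p * ennreal (?n z powr p) * ennreal (weight p \<kappa> z) * G z *
          (ennreal (s powr (- 1 - real p)) * indicator {z. 0 < ?n z \<and> ?n z \<le> s} z)"
          unfolding H_def e by (simp only: ac_simps)
      qed
      finally show ?thesis .
    next
      case False
      then have "?I s = 0" "indicator {z. 0 < ?n z \<and> ?n z \<le> s} = (\<lambda>_. 0::ennreal)"
        by (auto split: split_indicator)
      then show ?thesis by simp
    qed
  qed
  also have "\<dots> = (\<integral>\<^sup>+z. (\<integral>\<^sup>+s. of_nat p * ennreal (?n z powr p) * ennreal (weight p \<kappa> z) * G z *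
       (ennreal (s powr (- 1 - real p)) * indicator {z. 0 < ?n z \<and> ?n z \<le> s} z) \<partial>lborel) \<partial>euclid p)"
    by (rule LE.Fubini'[symmetric]) measurable
  also have "\<dots> = (\<integral>\<^sup>+z. ennreal (weight p \<kappa> z) * G z \<partial>euclid p)"
  proof (rule nn_integral_cong_AE)
    show "AE z in euclid p. (\<integral>\<^sup>+s. of_nat p * ennreal (?n z powr p) * ennreal (weight p \<kappa> z) * G z *
       (ennreal (s powr (- 1 - real p)) * indicator {z. 0 < ?n z \<and> ?n z \<le> s} z) \<partial>lborel) =
       ennreal (weight p \<kappa> z) * G z"
      using AE_L2_set_pos[OF p]
    proof eventually_elim
      fix z assume z: "0 < ?n z"
      have "(\<integral>\<^sup>+s. of_nat p * ennreal (?n z powr p) * ennreal (weight p \<kappa> z) * G z *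
         (ennreal (s powr (- 1 - real p)) * indicator {z. 0 < ?n z \<and> ?n z \<le> s} z) \<partial>lborel) =
         (\<integral>\<^sup>+s. of_nat p * ennreal (?n z powr p) * ennreal (weight p \<kappa> z) * G z *
         (ennreal (s powr (- 1 - real p)) * indicator {?n z..} s) \<partial>lborel)"
        using z by (intro nn_integral_cong) (auto split: split_indicator)
      also have "\<dots> = of_nat p * ennreal (?n z powr p) * ennreal (weight p \<kappa> z) * G z * ennreal (?n z powr - p / p)"
        using z p by (subst nn_integral_cmult) (auto simp: nn_integral_powr_tail)
      also have "\<dots> = ennreal (real p * (?n z powr p * (?n z powr - p / p))) * (ennreal (weight p \<kappa> z) * G z)"
        by (simp only: ennreal_mult ennreal_of_nat_eq_real_of_nat powr_ge_zero of_nat_0_le_iff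
            divide_nonneg_nonneg mult_nonneg_nonneg ac_simps)
      also have "real p * (?n z powr p * (?n z powr - p / p)) = 1"
        using z p by (simp add: powr_minus)
      finally show "(\<integral>\<^sup>+s. of_nat p * ennreal (?n z powr p) * ennreal (weight p \<kappa> z) * G z *
         (ennreal (s powr (- 1 - real p)) * indicator {z. 0 < ?n z \<and> ?n z \<le> s} z) \<partial>lborel) = ennreal (weight p \<kappa> z) * G z"
        by simp
    qed
  qed
  finally show ?thesis .
qed

section \<open>Finiteness and scaling of the spherical and radial measures\<close>

lemma radial_proj_in_usphere: "y \<in> punctured_ball p \<Longrightarrow> radial_proj p y \<in> usphere p"
  using measurable_space[OF radial_proj_measurable, of y p]
  by (auto simp: space_restrict_space punctured_ball_def usphere_def)

lemma weight_le_1: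
  assumes "\<omega> \<in> usphere p" "\<And>v. v \<in> {1..p} \<Longrightarrow> 0 \<le> \<kappa> v"
  shows "weight p \<kappa> \<omega> \<le> 1"
  unfolding weight_def
proof (intro prod_le_1 conjI)
  fix v assume v: "v \<in> {1..p}"
  have "\<bar>\<omega> v\<bar> \<le> L2_set (\<lambda>v. \<bar>\<omega> v\<bar>) {1..p}" using v by (intro member_le_L2_set) auto
  also have "\<dots> = L2_set \<omega> {1..p}" by (simp add: L2_set_def)
  also have "\<dots> = 1" using assms(1) by (simp add: usphere_def)
  finally show "\<bar>\<omega> v\<bar> powr (2 * \<kappa> v) \<le> 1" using assms(2)[OF v] by (intro powr_le1) auto
qed auto

text \<open>For non-negative parameters the weight is at most 1 on the sphere, and the punctured
  ball lies in a cube of finite volume.\<close>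

lemma finite_measure_dunkl_sphere:
  assumes "\<And>v. v \<in> {1..p} \<Longrightarrow> 0 \<le> \<kappa> v"
  shows "finite_measure (dunkl_sphere p \<kappa>)"
proof (rule finite_measureI)
  interpret product_sigma_finite "\<lambda>_::nat. lborel :: real measure" by standard
  have "emeasure (dunkl_sphere p \<kappa>) (space (dunkl_sphere p \<kappa>)) = (\<integral>\<^sup>+\<omega>. 1 \<partial>dunkl_sphere p \<kappa>)"
    by simp
  also have "\<dots> = of_nat p * (\<integral>\<^sup>+y. ennreal (weight p \<kappa> (radial_proj p y)) * 1 * indicator (punctured_ball p) y \<partial>euclid p)"
    by (rule nn_integral_dunkl_sphere) simp
  also have "\<dots> \<le> of_nat p * (\<integral>\<^sup>+y. indicator (\<Pi>\<^sub>E v\<in>{1..p}. {-1..1}) y \<partial>euclid p)"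
  proof (intro mult_left_mono nn_integral_mono)
    fix y
    show "ennreal (weight p \<kappa> (radial_proj p y)) * 1 * indicator (punctured_ball p) y \<le> indicator (\<Pi>\<^sub>E v\<in>{1..p}. {-1..1}) y"
    proof (cases "y \<in> punctured_ball p")
      case True
      have "y v \<in> {-1..1}" if v: "v \<in> {1..p}" for v
      proof -
        have "\<bar>y v\<bar> \<le> L2_set (\<lambda>v. \<bar>y v\<bar>) {1..p}" using v by (intro member_le_L2_set) auto
        also have "\<dots> = L2_set y {1..p}" by (simp add: L2_set_def)
        also have "\<dots> \<le> 1" using True by (simp add: punctured_ball_def)
        finally show ?thesis by auto
      qed
      then have "y \<in> (\<Pi>\<^sub>E v\<in>{1..p}. {-1..1})"
        using True by (auto simp: punctured_ball_def space_euclid PiE_def)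
      then show ?thesis
        using True weight_le_1[OF radial_proj_in_usphere[OF True] assms] by simp
    qed simp
  qed simp
  also have "(\<integral>\<^sup>+y. indicator (\<Pi>\<^sub>E v\<in>{1..p}. {-1..1}) y \<partial>euclid p) = emeasure (euclid p) (\<Pi>\<^sub>E v\<in>{1..p}. {-1..1})"
    unfolding euclid_def by (intro nn_integral_indicator sets_PiM_I_finite) auto
  also have "\<dots> = (\<Prod>v=1..p. emeasure lborel {-1..1::real})"
    unfolding euclid_def by (rule emeasure_PiM) auto
  also have "of_nat p * \<dots> < top"
    by (simp add: ennreal_mult_less_top of_nat_less_top power_less_top_ennreal)
  finally show "emeasure (dunkl_sphere p \<kappa>) (space (dunkl_sphere p \<kappa>)) \<noteq> \<infinity>" by simp
qed

lemma sigma_finite_dunkl_radial: "sigma_finite_measure (dunkl_radial p \<kappa>)"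
proof -
  interpret R: sigma_finite_measure "restrict_space lborel {0<..} :: real measure"
    by (rule sigma_finite_measure_restrict_space[OF lborel.sigma_finite_measure_axioms]) simp
  show ?thesis
    unfolding dunkl_radial_def
    by (subst R.sigma_finite_iff_density_finite) (auto intro!: measurable_restrict_space1)
qed

lemma nn_integral_dunkl_radial_scale:
  assumes f[measurable]: "f \<in> borel_measurable borel" and t: "0 < t"
  shows "(\<integral>\<^sup>+\<rho>. f (t * \<rho>) \<partial>dunkl_radial p \<kappa>) =
    ennreal (t powr - hom_dim p \<kappa>) * (\<integral>\<^sup>+\<rho>. f \<rho> \<partial>dunkl_radial p \<kappa>)"
proof -
  let ?N = "hom_dim p \<kappa>"
  define h where "h \<rho> = ennreal (\<rho> powr (?N - 1)) * f \<rho> * indicator {0<..} \<rho>" for \<rho>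
  have [measurable]: "h \<in> borel_measurable borel" unfolding h_def by measurable
  have "(\<integral>\<^sup>+\<rho>. f \<rho> \<partial>dunkl_radial p \<kappa>) = (\<integral>\<^sup>+\<rho>. h \<rho> \<partial>lborel)"
    unfolding h_def by (rule nn_integral_dunkl_radial) measurable
  also have "\<dots> = ennreal t * (\<integral>\<^sup>+\<rho>. h (0 + t * \<rho>) \<partial>lborel)"
    using nn_integral_real_affine[of h t 0] t by simp
  also have "(\<integral>\<^sup>+\<rho>. h (0 + t * \<rho>) \<partial>lborel) =
    (\<integral>\<^sup>+\<rho>. ennreal (t powr (?N - 1)) * (ennreal (\<rho> powr (?N - 1)) * f (t * \<rho>) * indicator {0<..} \<rho>) \<partial>lborel)"
    using t by (intro nn_integral_cong)
      (auto simp: h_def powr_mult ennreal_mult zero_less_mult_iff mult.assoc split: split_indicator)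
  also have "\<dots> = ennreal (t powr (?N - 1)) * (\<integral>\<^sup>+\<rho>. ennreal (\<rho> powr (?N - 1)) * f (t * \<rho>) * indicator {0<..} \<rho> \<partial>lborel)"
    by (rule nn_integral_cmult) measurable
  also have "(\<integral>\<^sup>+\<rho>. ennreal (\<rho> powr (?N - 1)) * f (t * \<rho>) * indicator {0<..} \<rho> \<partial>lborel) =
      (\<integral>\<^sup>+\<rho>. f (t * \<rho>) \<partial>dunkl_radial p \<kappa>)"
    by (rule nn_integral_dunkl_radial[symmetric]) measurable
  finally have "ennreal (t powr - ?N) * (\<integral>\<^sup>+\<rho>. f \<rho> \<partial>dunkl_radial p \<kappa>) =
     ennreal (t powr - ?N * (t * t powr (?N - 1))) * (\<integral>\<^sup>+\<rho>. f (t * \<rho>) \<partial>dunkl_radial p \<kappa>)"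
    using t by (simp add: ennreal_mult mult.assoc)
  also have "t powr - ?N * (t * t powr (?N - 1)) = 1"
    using t by (simp add: powr_mult_base powr_add[symmetric])
  finally show ?thesis by simp
qed

text \<open>With respect to Lebesgue measure the integrand has exponent
  \<open>a + hom_dim p \<kappa> - 1\<close>, and the hypothesis puts it above
  \<open>- 1\<close>.\<close>

lemma nn_integral_radial_powr_finite:
  assumes "0 < a + hom_dim p \<kappa>"
  shows "(\<integral>\<^sup>+\<rho>. ennreal (\<rho> powr a) * indicator {..<1} \<rho> \<partial>dunkl_radial p \<kappa>) < \<infinity>"
proof -
  let ?e = "a + hom_dim p \<kappa> - 1"
  have "(\<integral>\<^sup>+\<rho>. ennreal (\<rho> powr a) * indicator {..<1} \<rho> \<partial>dunkl_radial p \<kappa>) =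
     (\<integral>\<^sup>+\<rho>. ennreal (\<rho> powr (hom_dim p \<kappa> - 1)) * (ennreal (\<rho> powr a) * indicator {..<1} \<rho>) * indicator {0<..} \<rho> \<partial>lborel)"
    by (rule nn_integral_dunkl_radial) measurable
  also have "\<dots> \<le> (\<integral>\<^sup>+\<rho>. ennreal (\<rho> powr ?e * indicator {0..1} \<rho>) \<partial>lborel)"
    by (intro nn_integral_mono)
       (auto simp: powr_add[symmetric] ennreal_mult[symmetric] algebra_simps split: split_indicator)
  also have "\<dots> = ennreal (1 powr (?e + 1) / (?e + 1))"
  proof (rule nn_integral_has_integral_lborel)
    have "((\<lambda>x. x powr ?e) has_integral (1 powr (?e + 1) / (?e + 1))) {0..1}"
      using assms by (intro has_integral_powr_from_0) auto
    then show "((\<lambda>x. x powr ?e * indicator {0..1} x) has_integral (1 powr (?e + 1) / (?e + 1))) UNIV"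
      by (subst (asm) has_integral_restrict_UNIV[symmetric])
         (auto elim!: has_integral_eq[rotated] split: split_indicator)
  qed auto
  finally show ?thesis by (simp add: order_le_less_trans)
qed

section \<open>The mixed norm of one block\<close>

text \<open>One stage of \<open>iter_norm\<close>, isolated as an operation on functions of a single
  block. Properties of the mixed norm are shown for one stage and then carried through the blocks by
  induction.\<close>

definition block_norm ::
    "nat \<Rightarrow> (nat \<Rightarrow> real) \<Rightarrow> real \<Rightarrow> real \<Rightarrow> ((nat \<Rightarrow> real) \<Rightarrow> ennreal) \<Rightarrow> ennreal" where
  "block_norm p \<kappa> u w g =
     Lp_norm (dunkl_radial p \<kappa>) u (\<lambda>\<rho>. Lp_norm (dunkl_sphere p \<kappa>) w (\<lambda>\<omega>. g (smul p \<rho> \<omega>)))"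

context
  fixes p :: nat and \<kappa> :: "nat \<Rightarrow> real"
  assumes \<kappa>: "\<And>v. v \<in> {1..p} \<Longrightarrow> 0 \<le> \<kappa> v"
begin

interpretation S: finite_measure "dunkl_sphere p \<kappa>"
  by (rule finite_measure_dunkl_sphere[OF \<kappa>])

interpretation R: sigma_finite_measure "dunkl_radial p \<kappa>"
  by (rule sigma_finite_dunkl_radial)

text \<open>The parameter space \<open>N\<close> is general because two kinds of parameters occur:
  the blocks of a point in the induction over blocks, and the integration variable in Minkowski's
  inequality.\<close>

lemma sphere_slice_measurable:
  assumes [measurable]: "(\<lambda>(t, y). g t y) \<in> borel_measurable (N \<Otimes>\<^sub>M euclid p)"
  shows "(\<lambda>((t, \<rho>), \<omega>). g t (smul p \<rho> \<omega>)) \<in> borel_measurable ((N \<Otimes>\<^sub>M borel) \<Otimes>\<^sub>M dunkl_sphere p \<kappa>)"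
proof -
  have [measurable]: "snd \<in> (N \<Otimes>\<^sub>M borel) \<Otimes>\<^sub>M dunkl_sphere p \<kappa> \<rightarrow>\<^sub>M euclid p"
    by (rule measurable_compose[OF measurable_snd id_dunkl_sphere])
  have "(\<lambda>z. (fst (fst z), smul p (snd (fst z)) (snd z))) \<in>
      (N \<Otimes>\<^sub>M borel) \<Otimes>\<^sub>M dunkl_sphere p \<kappa> \<rightarrow>\<^sub>M N \<Otimes>\<^sub>M euclid p"
    by measurable
  from measurable_compose[OF this assms] show ?thesis by (simp add: case_prod_beta')
qed

lemma sphere_norm_measurable:
  assumes "(\<lambda>(t, y). g t y) \<in> borel_measurable (N \<Otimes>\<^sub>M euclid p)"
  shows "(\<lambda>(t, \<rho>). Lp_norm (dunkl_sphere p \<kappa>) w (\<lambda>\<omega>. g t (smul p \<rho> \<omega>))) \<in> borel_measurable (N \<Otimes>\<^sub>M borel)"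
proof -
  have "(\<lambda>z. Lp_norm (dunkl_sphere p \<kappa>) w (\<lambda>\<omega>. g (fst z) (smul p (snd z) \<omega>))) \<in> borel_measurable (N \<Otimes>\<^sub>M borel)"
    using sphere_slice_measurable[OF assms]
    by (intro Lp_norm_measurable[OF S.sigma_finite_measure_axioms]) (simp add: case_prod_beta')
  then show ?thesis by (simp add: case_prod_beta')
qed

lemma radial_slice_measurable:
  assumes "(\<lambda>(t, y). g t y) \<in> borel_measurable (N \<Otimes>\<^sub>M euclid p)"
  shows "(\<lambda>(t, \<rho>). Lp_norm (dunkl_sphere p \<kappa>) w (\<lambda>\<omega>. g t (smul p \<rho> \<omega>)))
     \<in> borel_measurable (N \<Otimes>\<^sub>M dunkl_radial p \<kappa>)"
proof -
  have "(\<lambda>z. (fst z, snd z)) \<in> N \<Otimes>\<^sub>M dunkl_radial p \<kappa> \<rightarrow>\<^sub>M N \<Otimes>\<^sub>M borel"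
    using measurable_compose[OF measurable_snd id_dunkl_radial] by (intro measurable_Pair) auto
  from measurable_compose[OF this sphere_norm_measurable[OF assms]]
  show ?thesis by (simp add: case_prod_beta')
qed

lemma block_norm_measurable:
  assumes "(\<lambda>(t, y). g t y) \<in> borel_measurable (N \<Otimes>\<^sub>M euclid p)"
  shows "(\<lambda>t. block_norm p \<kappa> u w (g t)) \<in> borel_measurable N"
  unfolding block_norm_def
  by (rule Lp_norm_measurable[OF R.sigma_finite_measure_axioms radial_slice_measurable[OF assms]])

context
  fixes g :: "(nat \<Rightarrow> real) \<Rightarrow> ennreal"
  assumes g[measurable]: "g \<in> borel_measurable (euclid p)"
begin

lemma sphere_meas1 [measurable]: "(\<lambda>\<omega>. g (smul p \<rho> \<omega>)) \<in> borel_measurable (dunkl_sphere p \<kappa>)"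
  by (rule measurable_compose[OF id_dunkl_sphere]) measurable

lemma radial_meas1 [measurable]:
  "(\<lambda>\<rho>. Lp_norm (dunkl_sphere p \<kappa>) w (\<lambda>\<omega>. g (smul p \<rho> \<omega>))) \<in> borel_measurable borel"
proof -
  \<comment> \<open>A one-point parameter space specialises the parametrised statement to a single
    function.\<close>
  have "(\<lambda>(t::unit, y). g y) \<in> borel_measurable (count_space UNIV \<Otimes>\<^sub>M euclid p)" by measurable
  from measurable_compose[OF _ sphere_norm_measurable[OF this], of "\<lambda>\<rho>. ((), \<rho>)" borel w]
  show ?thesis by simp
qed

lemma radial_meas2:
  "(\<lambda>\<rho>. Lp_norm (dunkl_sphere p \<kappa>) w (\<lambda>\<omega>. g (smul p \<rho> \<omega>))) \<in> borel_measurable (dunkl_radial p \<kappa>)"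
  by (rule measurable_compose[OF id_dunkl_radial radial_meas1])

lemma block_norm_cmult:
  assumes "0 < u" "0 < w"
  shows "block_norm p \<kappa> u w (\<lambda>y. c * g y) = c * block_norm p \<kappa> u w g"
  unfolding block_norm_def using assms
  by (simp add: Lp_norm_cmult radial_meas2)

text \<open>Dilation replaces the radius \<open>\<rho>\<close> by \<open>t * \<rho>\<close> and
  leaves the direction alone, so the factor comes from the radial measure.\<close>

lemma block_norm_scale:
  assumes t: "0 < t" and u: "0 < u"
  shows "block_norm p \<kappa> u w (\<lambda>y. g (smul p t y)) = ennreal (t powr - (hom_dim p \<kappa> / u)) * block_norm p \<kappa> u w g"
proof -
  let ?f = "\<lambda>\<rho>. epowr (Lp_norm (dunkl_sphere p \<kappa>) w (\<lambda>\<omega>. g (smul p \<rho> \<omega>))) u"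
  have "(\<integral>\<^sup>+\<rho>. ?f (t * \<rho>) \<partial>dunkl_radial p \<kappa>) =
    ennreal (t powr - hom_dim p \<kappa>) * (\<integral>\<^sup>+\<rho>. ?f \<rho> \<partial>dunkl_radial p \<kappa>)"
    using t by (intro nn_integral_dunkl_radial_scale) measurable
  then show ?thesis
    unfolding block_norm_def smul_smul Lp_norm_def[of "dunkl_radial p \<kappa>" u]
    using u by (simp add: epowr_mult epowr_ennreal powr_powr)
qed

lemma block_norm_one:
  assumes "1 \<le> p"
  shows "block_norm p \<kappa> 1 1 g = (\<integral>\<^sup>+y. ennreal (weight p \<kappa> y) * g y \<partial>euclid p)"
  unfolding block_norm_def Lp_norm_one by (rule nn_integral_polar[OF assms g])

end

lemma block_norm_Holder:
  assumes [measurable]: "g \<in> borel_measurable (euclid p)" "h \<in> borel_measurable (euclid p)"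
    and "0 < u1" "0 < u2" "0 < u" "1 / u = 1 / u1 + 1 / u2"
    and "0 < w1" "0 < w2" "0 < w" "1 / w = 1 / w1 + 1 / w2"
  shows "block_norm p \<kappa> u w (\<lambda>y. g y * h y) \<le> block_norm p \<kappa> u1 w1 g * block_norm p \<kappa> u2 w2 h"
proof -
  have "block_norm p \<kappa> u w (\<lambda>y. g y * h y) \<le> Lp_norm (dunkl_radial p \<kappa>) u
     (\<lambda>\<rho>. Lp_norm (dunkl_sphere p \<kappa>) w1 (\<lambda>\<omega>. g (smul p \<rho> \<omega>)) *
          Lp_norm (dunkl_sphere p \<kappa>) w2 (\<lambda>\<omega>. h (smul p \<rho> \<omega>)))"
    unfolding block_norm_def using assms
    by (intro Lp_norm_mono Lp_norm_Holder sphere_meas1) auto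
  also have "\<dots> \<le> block_norm p \<kappa> u1 w1 g * block_norm p \<kappa> u2 w2 h"
    unfolding block_norm_def using assms by (intro Lp_norm_Holder radial_meas2) auto
  finally show ?thesis .
qed

lemma block_norm_mono:
  assumes "0 < u" "0 < w" "\<And>y. y \<in> space (euclid p) \<Longrightarrow> g y \<le> h y"
  shows "block_norm p \<kappa> u w g \<le> block_norm p \<kappa> u w h"
  unfolding block_norm_def using assms by (intro Lp_norm_mono) auto

lemma block_norm_Minkowski:
  assumes T: "sigma_finite_measure T"
    and F[measurable]: "(\<lambda>(t, y). F t y) \<in> borel_measurable (T \<Otimes>\<^sub>M euclid p)" and uw: "1 < u" "1 < w"
  shows "block_norm p \<kappa> u w (\<lambda>y. \<integral>\<^sup>+t. F t y \<partial>T) \<le> (\<integral>\<^sup>+t. block_norm p \<kappa> u w (F t) \<partial>T)"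
proof -
  have "block_norm p \<kappa> u w (\<lambda>y. \<integral>\<^sup>+t. F t y \<partial>T) \<le> Lp_norm (dunkl_radial p \<kappa>) u
     (\<lambda>\<rho>. \<integral>\<^sup>+t. Lp_norm (dunkl_sphere p \<kappa>) w (\<lambda>\<omega>. F t (smul p \<rho> \<omega>)) \<partial>T)"
    unfolding block_norm_def
  proof (rule Lp_norm_mono)
    fix \<rho> :: real
    have "(\<lambda>z. ((fst z, \<rho>), snd z)) \<in> T \<Otimes>\<^sub>M dunkl_sphere p \<kappa> \<rightarrow>\<^sub>M (T \<Otimes>\<^sub>M borel) \<Otimes>\<^sub>M dunkl_sphere p \<kappa>"
      by measurable
    from measurable_compose[OF this sphere_slice_measurable[OF F]]
    have "(\<lambda>(t, \<omega>). F t (smul p \<rho> \<omega>)) \<in> borel_measurable (T \<Otimes>\<^sub>M dunkl_sphere p \<kappa>)"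
      by (simp add: case_prod_beta')
    then show "Lp_norm (dunkl_sphere p \<kappa>) w (\<lambda>\<omega>. \<integral>\<^sup>+t. F t (smul p \<rho> \<omega>) \<partial>T) \<le>
      (\<integral>\<^sup>+t. Lp_norm (dunkl_sphere p \<kappa>) w (\<lambda>\<omega>. F t (smul p \<rho> \<omega>)) \<partial>T)"
      using uw by (intro Lp_norm_Minkowski S.sigma_finite_measure_axioms T)
  qed (use uw in auto)
  also have "\<dots> \<le> (\<integral>\<^sup>+t. block_norm p \<kappa> u w (F t) \<partial>T)"
    unfolding block_norm_def using uw radial_slice_measurable[OF F]
    by (intro Lp_norm_Minkowski R.sigma_finite_measure_axioms T)
  finally show ?thesis .
qed

text \<open>The function \<open>h\<close> marks the exceptional set. If its integral vanishes, then
  on almost every sphere it vanishes almost everywhere, and \<open>Lp_norm\<close> ignores null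
  sets. This covers functions \<open>g\<close> and \<open>g'\<close> that are not
  measurable.\<close>

lemma block_norm_cong_null:
  assumes [measurable]: "h \<in> borel_measurable (euclid p)"
    and null: "block_norm p \<kappa> 1 1 h = 0"
    and eq: "\<And>y. y \<in> space (euclid p) \<Longrightarrow> h y = 0 \<Longrightarrow> g y = g' y"
  shows "block_norm p \<kappa> u w g = block_norm p \<kappa> u w g'"
proof -
  have "AE \<rho> in dunkl_radial p \<kappa>. Lp_norm (dunkl_sphere p \<kappa>) 1 (\<lambda>\<omega>. h (smul p \<rho> \<omega>)) = 0"
    using null unfolding block_norm_def Lp_norm_one[of "dunkl_radial p \<kappa>"]
    by (subst (asm) nn_integral_0_iff_AE) (auto intro: radial_meas2)
  then have "AE \<rho> in dunkl_radial p \<kappa>. AE \<omega> in dunkl_sphere p \<kappa>. h (smul p \<rho> \<omega>) = 0"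
    unfolding Lp_norm_one by (subst (asm) nn_integral_0_iff_AE) (auto intro: sphere_meas1)
  then have "AE \<rho> in dunkl_radial p \<kappa>. Lp_norm (dunkl_sphere p \<kappa>) w (\<lambda>\<omega>. g (smul p \<rho> \<omega>)) =
      Lp_norm (dunkl_sphere p \<kappa>) w (\<lambda>\<omega>. g' (smul p \<rho> \<omega>))"
    by (rule eventually_mono) (auto intro!: Lp_norm_cong_AE elim!: eventually_mono intro: eq)
  then show ?thesis
    unfolding block_norm_def by (rule Lp_norm_cong_AE)
qed

text \<open>The function is constant on each sphere, so the spherical norm contributes only a finite
  constant. Raising to the power \<open>u\<close> leads to
  \<open>nn_integral_radial_powr_finite\<close> with exponent \<open>a * u\<close>.\<close>

lemma block_norm_powr_finite:
  assumes "0 < u" "0 < w" "0 < a * u + hom_dim p \<kappa>"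
  shows "block_norm p \<kappa> u w (\<lambda>y. ennreal (L2_set y {1..p} powr a) * indicator {y. L2_set y {1..p} < 1} y) < \<infinity>"
proof -
  let ?s = "epowr (emeasure (dunkl_sphere p \<kappa>) (space (dunkl_sphere p \<kappa>))) (1 / w)"
  let ?f = "\<lambda>\<rho>. ennreal (\<rho> powr a) * indicator {..<1} \<rho>"
  have "block_norm p \<kappa> u w (\<lambda>y. ennreal (L2_set y {1..p} powr a) * indicator {y. L2_set y {1..p} < 1} y) =
    Lp_norm (dunkl_radial p \<kappa>) u (\<lambda>\<rho>. Lp_norm (dunkl_sphere p \<kappa>) w (\<lambda>\<omega>. ?f \<rho>))"
    unfolding block_norm_def
  proof (intro Lp_norm_cong)
    fix \<rho> \<omega> assume "\<rho> \<in> space (dunkl_radial p \<kappa>)" "\<omega> \<in> space (dunkl_sphere p \<kappa>)"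
    then have "0 \<le> \<rho>" "L2_set \<omega> {1..p} = 1"
      by (auto simp: space_dunkl_radial space_dunkl_sphere usphere_def)
    then have "L2_set (smul p \<rho> \<omega>) {1..p} = \<rho>"
      using L2_set_smul[of \<rho> p \<omega>] by simp
    then show "ennreal (L2_set (smul p \<rho> \<omega>) {1..p} powr a) * indicator {y. L2_set y {1..p} < 1} (smul p \<rho> \<omega>) = ?f \<rho>"
      by (simp add: indicator_def)
  qed
  also have "\<dots> = Lp_norm (dunkl_radial p \<kappa>) u (\<lambda>\<rho>. ?s * ?f \<rho>)"
    using assms by (simp add: Lp_norm_const ac_simps)
  also have "\<dots> = ?s * Lp_norm (dunkl_radial p \<kappa>) u ?f"
    using assms by (intro Lp_norm_cmult measurable_compose[OF id_dunkl_radial]) auto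
  also have "\<dots> < top"
  proof -
    have "?s < top" using S.emeasure_finite by (simp add: less_top[symmetric])
    moreover have "(\<integral>\<^sup>+\<rho>. epowr (?f \<rho>) u \<partial>dunkl_radial p \<kappa>) =
      (\<integral>\<^sup>+\<rho>. ennreal (\<rho> powr (a * u)) * indicator {..<1} \<rho> \<partial>dunkl_radial p \<kappa>)"
      by (intro nn_integral_cong) (auto simp: epowr_ennreal powr_powr split: split_indicator)
    then have "Lp_norm (dunkl_radial p \<kappa>) u ?f < top"
      using nn_integral_radial_powr_finite[OF assms(3)]
      by (simp add: Lp_norm_def less_top[symmetric])
    ultimately show ?thesis by (simp add: ennreal_mult_less_top)
  qed
  finally show ?thesis by simp
qed

end

section \<open>Iterated norms on the product space\<close>

text \<open>The index sets \<open>{1..m}\<close> have to survive simplification for the rules below to apply.\<close>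

declare One_nat_def [simp del]

lemma weight_component_measurable:
  assumes "i \<in> I"
  shows "(\<lambda>x. weight (d i) \<kappa> (x i)) \<in> borel_measurable (\<Pi>\<^sub>M i\<in>I. euclid (d i))"
  using measurable_compose[OF measurable_component_singleton[OF assms, of "\<lambda>i. euclid (d i)"]
      weight_measurable[of "d i" \<kappa>]] by simp

lemma iter_norm_Suc_block:
  "iter_norm d k u w (Suc j) F x = block_norm (d (Suc j)) (k (Suc j)) (u (Suc j)) (w (Suc j))
     (\<lambda>y. iter_norm d k u w j F (x(Suc j := y)))"
  by (simp add: block_norm_def smul_def)

text \<open>Frees the choice of the base point: for \<open>j = m\<close> any two base points that
  agree outside \<open>{1..m}\<close> give the same norm, so one inside the product space may be
  taken.\<close>

lemma iter_norm_indep: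
  assumes "\<And>i. i \<notin> {1..j} \<Longrightarrow> x i = y i"
  shows "iter_norm d k u w j F x = iter_norm d k u w j F y"
  using assms
proof (induction j arbitrary: x y)
  case 0
  then have "x = y" by auto
  then show ?case by simp
next
  case (Suc j)
  have "iter_norm d k u w j F (x(Suc j := z)) = iter_norm d k u w j F (y(Suc j := z))" for z
    using Suc.prems by (intro Suc.IH) auto
  then show ?case unfolding iter_norm_Suc_block by simp
qed

locale dunkl_blocks =
  fixes m :: nat and d :: "nat \<Rightarrow> nat" and k :: "nat \<Rightarrow> nat \<Rightarrow> real"
  assumes d_pos: "\<And>i. i \<in> {1..m} \<Longrightarrow> 1 \<le> d i"
    and k_nonneg: "\<And>i v. i \<in> {1..m} \<Longrightarrow> v \<in> {1..d i} \<Longrightarrow> 0 \<le> k i v"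
begin

abbreviation PM :: "(nat \<Rightarrow> nat \<Rightarrow> real) measure" where
  "PM \<equiv> (\<Pi>\<^sub>M i\<in>{1..m}. euclid (d i))"

lemma update_measurable:
  assumes "f \<in> N \<rightarrow>\<^sub>M PM" "h \<in> N \<rightarrow>\<^sub>M euclid (d i)" "i \<in> {1..m}"
  shows "(\<lambda>x. (f x)(i := h x)) \<in> N \<rightarrow>\<^sub>M PM"
  using assms by (intro measurable_fun_upd[where J="{1..m}"]) auto

lemma update_in_space:
  "x \<in> space PM \<Longrightarrow> y \<in> space (euclid (d i)) \<Longrightarrow> i \<in> {1..m} \<Longrightarrow> x(i := y) \<in> space PM"
  by (auto simp: space_PiM PiE_def extensional_def)

lemma update_slice_measurable:
  assumes F: "(\<lambda>(t, x). F t x) \<in> borel_measurable (N \<Otimes>\<^sub>M PM)" and "x \<in> space PM" "i \<in> {1..m}"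
  shows "(\<lambda>(t, y). F t (x(i := y))) \<in> borel_measurable (N \<Otimes>\<^sub>M euclid (d i))"
proof -
  have "(\<lambda>z. (fst z, x(i := snd z))) \<in> N \<Otimes>\<^sub>M euclid (d i) \<rightarrow>\<^sub>M N \<Otimes>\<^sub>M PM"
    using assms(2,3) by (intro measurable_Pair update_measurable) auto
  from measurable_compose[OF this F] show ?thesis by (simp add: case_prod_beta')
qed

lemma update_slice_measurable1:
  assumes "F \<in> borel_measurable PM" "x \<in> space PM" "i \<in> {1..m}"
  shows "(\<lambda>y. F (x(i := y))) \<in> borel_measurable (euclid (d i))"
  using assms by (intro measurable_compose[OF update_measurable assms(1)]) auto

text \<open>At each stage the pair of \<open>t\<close> and the whole point \<open>x\<close> is the
  parameter of the single-block norm; blocks that are already integrated stay in \<open>x\<close> as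
  dummies.\<close>

lemma iter_norm_measurable:
  assumes F: "(\<lambda>(t, x). F t x) \<in> borel_measurable (N \<Otimes>\<^sub>M PM)" and "j \<le> m"
  shows "(\<lambda>(t, x). iter_norm d k u w j (F t) x) \<in> borel_measurable (N \<Otimes>\<^sub>M PM)"
  using \<open>j \<le> m\<close>
proof (induction j)
  case 0 then show ?case using F by simp
next
  case (Suc j)
  then have j: "Suc j \<in> {1..m}" by auto
  have "(\<lambda>z. (fst (fst z), (snd (fst z))(Suc j := snd z))) \<in> (N \<Otimes>\<^sub>M PM) \<Otimes>\<^sub>M euclid (d (Suc j)) \<rightarrow>\<^sub>M N \<Otimes>\<^sub>M PM"
    using j by (intro measurable_Pair update_measurable) measurable
  from measurable_compose[OF this Suc.IH] Suc.prems
  have *: "(\<lambda>(z, y). iter_norm d k u w j (F (fst z)) ((snd z)(Suc j := y))) \<in>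
      borel_measurable ((N \<Otimes>\<^sub>M PM) \<Otimes>\<^sub>M euclid (d (Suc j)))"
    by (simp add: case_prod_beta')
  show ?case
    unfolding iter_norm_Suc_block case_prod_beta'
    by (rule block_norm_measurable[OF k_nonneg[OF j] *])
qed

lemma iter_norm_measurable1:
  assumes "F \<in> borel_measurable PM" "j \<le> m"
  shows "iter_norm d k u w j F \<in> borel_measurable PM"
proof -
  have "(\<lambda>(t::unit, x). F x) \<in> borel_measurable (count_space UNIV \<Otimes>\<^sub>M PM)" using assms by measurable
  from measurable_compose[OF _ iter_norm_measurable[OF this assms(2)], of "\<lambda>x. ((), x)" PM u w]
  show ?thesis by simp
qed

lemma iter_norm_mono:
  assumes uw: "\<And>i. i \<in> {1..m} \<Longrightarrow> 0 < u i" "\<And>i. i \<in> {1..m} \<Longrightarrow> 0 < w i"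
    and le: "\<And>x. x \<in> space PM \<Longrightarrow> F x \<le> G x" and "j \<le> m" "x \<in> space PM"
  shows "iter_norm d k u w j F x \<le> iter_norm d k u w j G x"
  using assms(4,5)
proof (induction j arbitrary: x)
  case 0 then show ?case using le by simp
next
  case (Suc j)
  then have j: "Suc j \<in> {1..m}" by auto
  show ?case
    unfolding iter_norm_Suc_block using Suc j
    by (intro block_norm_mono[OF k_nonneg] uw Suc.IH update_in_space) auto
qed

lemma iter_norm_cong:
  assumes "\<And>x. x \<in> space PM \<Longrightarrow> F x = G x" and "j \<le> m" "x \<in> space PM"
  shows "iter_norm d k u w j F x = iter_norm d k u w j G x"
  using assms(2,3)
proof (induction j arbitrary: x)
  case 0 then show ?case using assms(1) by simp
next
  case (Suc j)
  then have j: "Suc j \<in> {1..m}" by auto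
  show ?case
    unfolding iter_norm_Suc_block block_norm_def using Suc j
    by (intro Lp_norm_cong Suc.IH update_in_space) auto
qed

lemma iter_norm_Holder:
  assumes F: "F \<in> borel_measurable PM" and G: "G \<in> borel_measurable PM"
    and u: "\<And>i. i \<in> {1..m} \<Longrightarrow> 0 < u1 i \<and> 0 < u2 i \<and> 0 < u i \<and> 1 / u i = 1 / u1 i + 1 / u2 i"
    and w: "\<And>i. i \<in> {1..m} \<Longrightarrow> 0 < w1 i \<and> 0 < w2 i \<and> 0 < w i \<and> 1 / w i = 1 / w1 i + 1 / w2 i"
    and "j \<le> m" "x \<in> space PM"
  shows "iter_norm d k u w j (\<lambda>x. F x * G x) x \<le> iter_norm d k u1 w1 j F x * iter_norm d k u2 w2 j G x"
  using assms(5,6)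
proof (induction j arbitrary: x)
  case 0 then show ?case by simp
next
  case (Suc j)
  then have j: "Suc j \<in> {1..m}" by auto
  have "iter_norm d k u w (Suc j) (\<lambda>x. F x * G x) x \<le>
     block_norm (d (Suc j)) (k (Suc j)) (u (Suc j)) (w (Suc j))
       (\<lambda>y. iter_norm d k u1 w1 j F (x(Suc j := y)) * iter_norm d k u2 w2 j G (x(Suc j := y)))"
    unfolding iter_norm_Suc_block using Suc j u[OF j] w[OF j]
    by (intro block_norm_mono[OF k_nonneg] Suc.IH update_in_space) auto
  also have "\<dots> \<le> iter_norm d k u1 w1 (Suc j) F x * iter_norm d k u2 w2 (Suc j) G x"
    unfolding iter_norm_Suc_block using Suc j u[OF j] w[OF j] F G
    by (intro block_norm_Holder[OF k_nonneg] update_slice_measurable1 iter_norm_measurable1) auto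
  finally show ?case .
qed

lemma iter_norm_Minkowski:
  assumes T: "sigma_finite_measure T"
    and F: "(\<lambda>(t, x). F t x) \<in> borel_measurable (T \<Otimes>\<^sub>M PM)"
    and uw: "\<And>i. i \<in> {1..m} \<Longrightarrow> 1 < u i" "\<And>i. i \<in> {1..m} \<Longrightarrow> 1 < w i"
    and "j \<le> m" "x \<in> space PM"
  shows "iter_norm d k u w j (\<lambda>x. \<integral>\<^sup>+t. F t x \<partial>T) x \<le> (\<integral>\<^sup>+t. iter_norm d k u w j (F t) x \<partial>T)"
  using assms(5,6)
proof (induction j arbitrary: x)
  case 0 then show ?case by simp
next
  case (Suc j)
  then have j: "Suc j \<in> {1..m}" by auto
  have "iter_norm d k u w (Suc j) (\<lambda>x. \<integral>\<^sup>+t. F t x \<partial>T) x \<le>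
     block_norm (d (Suc j)) (k (Suc j)) (u (Suc j)) (w (Suc j))
       (\<lambda>y. \<integral>\<^sup>+t. iter_norm d k u w j (F t) (x(Suc j := y)) \<partial>T)"
    unfolding iter_norm_Suc_block using Suc j uw[OF j]
    by (intro block_norm_mono[OF k_nonneg] Suc.IH update_in_space) auto
  also have "\<dots> \<le> (\<integral>\<^sup>+t. iter_norm d k u w (Suc j) (F t) x \<partial>T)"
    unfolding iter_norm_Suc_block using Suc j uw[OF j] F
    by (intro block_norm_Minkowski[OF k_nonneg T] update_slice_measurable iter_norm_measurable) auto
  finally show ?case .
qed

lemma dil_update: "i \<in> {1..m} \<Longrightarrow> dil m d t (x(i := y)) = (dil m d t x)(i := smul (d i) t y)"
  by (auto simp: dil_def smul_def fun_eq_iff)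

lemma dil_in_space [simp]: "dil m d t x \<in> space PM"
  by (auto simp: dil_def space_PiM space_euclid PiE_def)

lemma dil_measurable [measurable (raw)]:
  assumes [measurable]: "f \<in> borel_measurable N" and g: "g \<in> N \<rightarrow>\<^sub>M PM"
  shows "(\<lambda>x. dil m d (f x) (g x)) \<in> N \<rightarrow>\<^sub>M PM"
proof -
  have "(\<lambda>x. \<lambda>i\<in>{1..m}. smul (d i) (f x) (g x i)) \<in> N \<rightarrow>\<^sub>M PM"
  proof (rule measurable_restrict)
    fix i assume "i \<in> {1..m}"
    then have [measurable]: "(\<lambda>x. g x i) \<in> N \<rightarrow>\<^sub>M euclid (d i)"
      by (rule measurable_compose[OF g measurable_component_singleton])
    show "(\<lambda>x. smul (d i) (f x) (g x i)) \<in> N \<rightarrow>\<^sub>M euclid (d i)" by measurable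
  qed
  then show ?thesis by (simp add: dil_def smul_def)
qed

lemma iter_norm_cmult:
  assumes F: "F \<in> borel_measurable PM"
    and uw: "\<And>i. i \<in> {1..m} \<Longrightarrow> 0 < u i" "\<And>i. i \<in> {1..m} \<Longrightarrow> 0 < w i"
    and "j \<le> m" "x \<in> space PM"
  shows "iter_norm d k u w j (\<lambda>x. c * F x) x = c * iter_norm d k u w j F x"
  using assms(4,5)
proof (induction j arbitrary: x)
  case 0 then show ?case by simp
next
  case (Suc j)
  then have j: "Suc j \<in> {1..m}" by auto
  have "iter_norm d k u w (Suc j) (\<lambda>x. c * F x) x =
     block_norm (d (Suc j)) (k (Suc j)) (u (Suc j)) (w (Suc j)) (\<lambda>y. c * iter_norm d k u w j F (x(Suc j := y)))"
    unfolding iter_norm_Suc_block block_norm_def using Suc j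
    by (intro Lp_norm_cong Suc.IH update_in_space) auto
  also have "\<dots> = c * iter_norm d k u w (Suc j) F x"
    unfolding iter_norm_Suc_block using Suc j uw[OF j] F
    by (intro block_norm_cmult[OF k_nonneg] update_slice_measurable1 iter_norm_measurable1) auto
  finally show ?case .
qed

text \<open>The base point on the right is dilated because the blocks beyond \<open>j\<close> have
  not been integrated yet. After the last block this dilation has no effect, which gives
  \<open>mnorm_scale\<close>.\<close>

lemma iter_norm_scale:
  assumes F: "F \<in> borel_measurable PM" and t: "0 < t"
    and uw: "\<And>i. i \<in> {1..m} \<Longrightarrow> 0 < u i" "\<And>i. i \<in> {1..m} \<Longrightarrow> 0 < w i"
    and "j \<le> m" "x \<in> space PM"
  shows "iter_norm d k u w j (\<lambda>x. F (dil m d t x)) x =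
    ennreal (t powr - (\<Sum>i=1..j. hom_dim (d i) (k i) / u i)) * iter_norm d k u w j F (dil m d t x)"
  using assms(5,6)
proof (induction j arbitrary: x)
  case 0 then show ?case using t by simp
next
  case (Suc j)
  then have j: "Suc j \<in> {1..m}" by auto
  let ?S = "\<Sum>i=1..j. hom_dim (d i) (k i) / u i"
  let ?B = "block_norm (d (Suc j)) (k (Suc j)) (u (Suc j)) (w (Suc j))"
  let ?g = "\<lambda>y. iter_norm d k u w j F ((dil m d t x)(Suc j := y))"
  have meas: "?g \<in> borel_measurable (euclid (d (Suc j)))"
    using Suc j F by (intro update_slice_measurable1 iter_norm_measurable1) auto
  have "iter_norm d k u w (Suc j) (\<lambda>x. F (dil m d t x)) x =
     ?B (\<lambda>y. ennreal (t powr - ?S) * ?g (smul (d (Suc j)) t y))"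
    unfolding iter_norm_Suc_block block_norm_def dil_update[OF j, symmetric] using Suc j
    by (intro Lp_norm_cong Suc.IH update_in_space) auto
  also have "\<dots> = ennreal (t powr - ?S) * ?B (\<lambda>y. ?g (smul (d (Suc j)) t y))"
    using uw[OF j] by (intro block_norm_cmult[OF k_nonneg[OF j]] measurable_compose[OF _ meas]) measurable
  also have "?B (\<lambda>y. ?g (smul (d (Suc j)) t y)) =
     ennreal (t powr - (hom_dim (d (Suc j)) (k (Suc j)) / u (Suc j))) * ?B ?g"
    using uw[OF j] t by (intro block_norm_scale[OF k_nonneg[OF j] meas])
  also have "ennreal (t powr - ?S) * (ennreal (t powr - (hom_dim (d (Suc j)) (k (Suc j)) / u (Suc j))) * ?B ?g) =
     ennreal (t powr - ?S * t powr - (hom_dim (d (Suc j)) (k (Suc j)) / u (Suc j))) * ?B ?g"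
    by (simp add: ennreal_mult mult.assoc)
  also have "t powr - ?S * t powr - (hom_dim (d (Suc j)) (k (Suc j)) / u (Suc j)) =
      t powr - (\<Sum>i=1..Suc j. hom_dim (d i) (k i) / u i)"
    using t by (simp add: powr_add[symmetric])
  finally show ?case unfolding iter_norm_Suc_block .
qed

text \<open>Exponent 1 serves as detector of null sets: a vanishing iterated integral of
  \<open>h\<close> forces almost every partial integral to vanish, and on those slices the induction
  hypothesis applies.\<close>

lemma iter_norm_cong_null:
  assumes h: "h \<in> borel_measurable PM"
    and eq: "\<And>x. x \<in> space PM \<Longrightarrow> h x = 0 \<Longrightarrow> F x = G x"
    and "j \<le> m" "x \<in> space PM" "iter_norm d k (\<lambda>_. 1) (\<lambda>_. 1) j h x = 0"
  shows "iter_norm d k u w j F x = iter_norm d k u w j G x"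
  using assms(3-5)
proof (induction j arbitrary: x)
  case 0 then show ?case using eq by simp
next
  case (Suc j)
  then have j: "Suc j \<in> {1..m}" by auto
  show ?case
    unfolding iter_norm_Suc_block
  proof (rule block_norm_cong_null[OF k_nonneg[OF j]])
    \<comment> \<open>The exceptional set of stage \<open>Suc j\<close> is marked by the partial
      integral of \<open>h\<close> over the first \<open>j\<close> blocks.\<close>
    show "(\<lambda>y. iter_norm d k (\<lambda>_. 1) (\<lambda>_. 1) j h (x(Suc j := y))) \<in> borel_measurable (euclid (d (Suc j)))"
      using Suc j h by (intro update_slice_measurable1 iter_norm_measurable1) auto
    show "block_norm (d (Suc j)) (k (Suc j)) 1 1 (\<lambda>y. iter_norm d k (\<lambda>_. 1) (\<lambda>_. 1) j h (x(Suc j := y))) = 0"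
      using Suc.prems(3) unfolding iter_norm_Suc_block .
  qed (use Suc j update_in_space in auto)
qed

text \<open>Factors of blocks not yet integrated are constants for the current norm. Such products
  serve as majorants for powers of the full radius.\<close>

lemma iter_norm_prod:
  assumes g: "\<And>i. i \<in> {1..m} \<Longrightarrow> g i \<in> borel_measurable (euclid (d i))"
    and uw: "\<And>i. i \<in> {1..m} \<Longrightarrow> 0 < u i" "\<And>i. i \<in> {1..m} \<Longrightarrow> 0 < w i"
    and "j \<le> m" "x \<in> space PM"
  shows "iter_norm d k u w j (\<lambda>x. \<Prod>i=1..m. g i (x i)) x =
    (\<Prod>i=1..j. block_norm (d i) (k i) (u i) (w i) (g i)) * (\<Prod>i=Suc j..m. g i (x i))"
  using assms(4,5)
proof (induction j arbitrary: x)
  case 0 then show ?case by (simp add: One_nat_def)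
next
  case (Suc j)
  then have j: "Suc j \<in> {1..m}" by auto
  let ?B = "block_norm (d (Suc j)) (k (Suc j)) (u (Suc j)) (w (Suc j))"
  let ?c = "\<Prod>i=1..j. block_norm (d i) (k i) (u i) (w i) (g i)"
  have split: "(\<Prod>i=Suc j..m. g i ((x(Suc j := y)) i)) = g (Suc j) y * (\<Prod>i=Suc (Suc j)..m. g i (x i))" for y
    using j by (subst prod.atLeast_Suc_atMost) auto
  have "iter_norm d k u w (Suc j) (\<lambda>x. \<Prod>i=1..m. g i (x i)) x =
     ?B (\<lambda>y. (?c * (\<Prod>i=Suc (Suc j)..m. g i (x i))) * g (Suc j) y)"
    unfolding iter_norm_Suc_block block_norm_def[of "d (Suc j)"]
  proof (intro Lp_norm_cong)
    fix \<rho> \<omega>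
    have "iter_norm d k u w j (\<lambda>x. \<Prod>i=1..m. g i (x i)) (x(Suc j := smul (d (Suc j)) \<rho> \<omega>)) =
      ?c * (\<Prod>i=Suc j..m. g i ((x(Suc j := smul (d (Suc j)) \<rho> \<omega>)) i))"
      using Suc j by (intro Suc.IH update_in_space) auto
    then show "iter_norm d k u w j (\<lambda>x. \<Prod>i=1..m. g i (x i)) (x(Suc j := smul (d (Suc j)) \<rho> \<omega>)) =
      ?c * (\<Prod>i=Suc (Suc j)..m. g i (x i)) * g (Suc j) (smul (d (Suc j)) \<rho> \<omega>)"
      unfolding split by (simp only: ac_simps)
  qed
  also have "\<dots> = (?c * (\<Prod>i=Suc (Suc j)..m. g i (x i))) * ?B (g (Suc j))"
    using uw[OF j] g[OF j] by (intro block_norm_cmult[OF k_nonneg[OF j]])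
  finally show ?case by (simp add: ac_simps)
qed

definition wt :: "(nat \<Rightarrow> nat \<Rightarrow> real) \<Rightarrow> real" where
  "wt x = (\<Prod>i=1..m. weight (d i) (k i) (x i))"

lemma wt_measurable [measurable]: "wt \<in> borel_measurable PM"
proof -
  have "(\<lambda>x. weight (d i) (k i) (x i)) \<in> borel_measurable PM" if "i \<in> {1..m}" for i
    using that by (rule weight_component_measurable)
  then show ?thesis unfolding wt_def[abs_def] by (intro borel_measurable_prod) auto
qed

lemma wt_nonneg [simp]: "0 \<le> wt x"
  unfolding wt_def by (intro prod_nonneg) auto

sublocale PM: product_sigma_finite "\<lambda>i. euclid (d i)"
  by (rule product_sigma_finite.intro) (rule sigma_finite_euclid)

lemma override_measurable:
  assumes x: "x \<in> space PM" and "j \<le> m"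
  shows "(\<lambda>y i. if i \<in> {1..j} then y i else x i) \<in> (\<Pi>\<^sub>M i\<in>{1..j}. euclid (d i)) \<rightarrow>\<^sub>M PM"
proof -
  have "(\<lambda>y. \<lambda>i\<in>{1..m}. if i \<in> {1..j} then y i else x i) \<in> (\<Pi>\<^sub>M i\<in>{1..j}. euclid (d i)) \<rightarrow>\<^sub>M PM"
  proof (rule measurable_restrict)
    fix i assume "i \<in> {1..m}"
    then show "(\<lambda>y. if i \<in> {1..j} then y i else x i) \<in> (\<Pi>\<^sub>M i\<in>{1..j}. euclid (d i)) \<rightarrow>\<^sub>M euclid (d i)"
      using x by (cases "i \<in> {1..j}") (auto simp: space_PiM PiE_def Pi_def)
  qed
  moreover have "(\<lambda>i\<in>{1..m}. if i \<in> {1..j} then y i else x i) = (\<lambda>i. if i \<in> {1..j} then y i else x i)" for y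
    using assms by (auto simp: space_PiM PiE_def extensional_def fun_eq_iff)
  ultimately show ?thesis by simp
qed

text \<open>By polar coordinates each stage with exponents 1 is a weighted integral over its block,
  and Tonelli's theorem assembles the stages. The conditional in the argument of \<open>F\<close>
  joins the integrated blocks to the untouched ones of \<open>x\<close>.\<close>

lemma iter_norm_one:
  assumes F: "F \<in> borel_measurable PM" and "j \<le> m" "x \<in> space PM"
  shows "iter_norm d k (\<lambda>_. 1) (\<lambda>_. 1) j F x =
    (\<integral>\<^sup>+y. ennreal (\<Prod>i=1..j. weight (d i) (k i) (y i)) * F (\<lambda>i. if i \<in> {1..j} then y i else x i)
       \<partial>(\<Pi>\<^sub>M i\<in>{1..j}. euclid (d i)))"
  using assms(2,3)
proof (induction j arbitrary: x)
  case 0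
  have "emeasure (Pi\<^sub>M {} (\<lambda>i. euclid (d i))) (space (Pi\<^sub>M {} (\<lambda>i. euclid (d i)))) = 1"
    by (simp add: space_PiM)
  then show ?case by simp
next
  case (Suc j)
  then have j: "Suc j \<in> {1..m}" by auto
  let ?ov = "\<lambda>j y x i. if i \<in> {1..j} then y i else x i"
  let ?W = "\<lambda>j y. ennreal (\<Prod>i=1..j. weight (d i) (k i) (y i))"
  let ?P = "\<lambda>j. \<Pi>\<^sub>M i\<in>{1..j}. euclid (d i)"
  have ins: "{1..Suc j} = insert (Suc j) {1..j}" by auto
  have W: "?W l \<in> borel_measurable (?P l)" for l
    by (intro measurable_compose[OF _ measurable_ennreal] borel_measurable_prod weight_component_measurable) auto
  have meas: "(\<lambda>y. ?W (Suc j) y * F (?ov (Suc j) y x)) \<in> borel_measurable (?P (Suc j))"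
    using Suc.prems by (intro borel_measurable_times_ennreal W measurable_compose[OF override_measurable F]) auto
  have "iter_norm d k (\<lambda>_. 1) (\<lambda>_. 1) (Suc j) F x =
    (\<integral>\<^sup>+z. ennreal (weight (d (Suc j)) (k (Suc j)) z) * iter_norm d k (\<lambda>_. 1) (\<lambda>_. 1) j F (x(Suc j := z)) \<partial>euclid (d (Suc j)))"
    unfolding iter_norm_Suc_block using Suc j F
    by (intro block_norm_one[OF k_nonneg] update_slice_measurable1 iter_norm_measurable1 d_pos) auto
  also have "\<dots> = (\<integral>\<^sup>+z. (\<integral>\<^sup>+y. ?W (Suc j) (y(Suc j := z)) * F (?ov (Suc j) (y(Suc j := z)) x) \<partial>?P j) \<partial>euclid (d (Suc j)))"
  proof (rule nn_integral_cong)
    fix z assume z: "z \<in> space (euclid (d (Suc j)))"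
    have xz: "x(Suc j := z) \<in> space PM" using Suc.prems j z by (intro update_in_space)
    have "ennreal (weight (d (Suc j)) (k (Suc j)) z) * iter_norm d k (\<lambda>_. 1) (\<lambda>_. 1) j F (x(Suc j := z)) =
       ennreal (weight (d (Suc j)) (k (Suc j)) z) * (\<integral>\<^sup>+y. ?W j y * F (?ov j y (x(Suc j := z))) \<partial>?P j)"
      using Suc.prems xz by (subst Suc.IH) auto
    also have "\<dots> = (\<integral>\<^sup>+y. ennreal (weight (d (Suc j)) (k (Suc j)) z) * (?W j y * F (?ov j y (x(Suc j := z)))) \<partial>?P j)"
      using Suc.prems
      by (intro nn_integral_cmult[symmetric] borel_measurable_times_ennreal W
          measurable_compose[OF override_measurable[OF xz] F]) auto
    also have "\<dots> = (\<integral>\<^sup>+y. ?W (Suc j) (y(Suc j := z)) * F (?ov (Suc j) (y(Suc j := z)) x) \<partial>?P j)"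
    proof (rule nn_integral_cong)
      fix y
      have "?ov j y (x(Suc j := z)) = ?ov (Suc j) (y(Suc j := z)) x" by (auto simp: fun_eq_iff)
      moreover have "(\<Prod>i=1..Suc j. weight (d i) (k i) ((y(Suc j := z)) i)) =
        weight (d (Suc j)) (k (Suc j)) z * (\<Prod>i=1..j. weight (d i) (k i) (y i))"
        by (simp add: mult.commute)
      ultimately show "ennreal (weight (d (Suc j)) (k (Suc j)) z) * (?W j y * F (?ov j y (x(Suc j := z)))) =
        ?W (Suc j) (y(Suc j := z)) * F (?ov (Suc j) (y(Suc j := z)) x)"
        by (simp only: ennreal_mult weight_nonneg prod_nonneg mult.assoc)
    qed
    finally show "ennreal (weight (d (Suc j)) (k (Suc j)) z) * iter_norm d k (\<lambda>_. 1) (\<lambda>_. 1) j F (x(Suc j := z)) =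
      (\<integral>\<^sup>+y. ?W (Suc j) (y(Suc j := z)) * F (?ov (Suc j) (y(Suc j := z)) x) \<partial>?P j)" .
  qed
  \<comment> \<open>\<open>product_nn_integral_insert_rev\<close> makes the new coordinate the outer
    variable, which is the order used by \<open>iter_norm\<close>.\<close>
  also have "\<dots> = (\<integral>\<^sup>+y. ?W (Suc j) y * F (?ov (Suc j) y x) \<partial>?P (Suc j))"
    using meas unfolding ins by (intro PM.product_nn_integral_insert_rev[symmetric]) auto
  finally show ?case .
qed

section \<open>The mixed norm of non-negative functions\<close>

text \<open>Values in \<open>ennreal\<close> are allowed because the majorants of the commutator are
  integrals whose finiteness is shown only afterwards, from their norms.\<close>

definition mnorm :: "(nat \<Rightarrow> real) \<Rightarrow> (nat \<Rightarrow> real) \<Rightarrow> ((nat \<Rightarrow> nat \<Rightarrow> real) \<Rightarrow> ennreal) \<Rightarrow> ennreal" where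
  "mnorm u w F = iter_norm d k u w m F (\<lambda>_. undefined)"

lemma mixed_norm_mnorm: "mixed_norm m d k u w f = mnorm u w (\<lambda>x. ennreal (cmod (f x)))"
  by (simp add: mixed_norm_def mnorm_def)

lemma mnorm_eq: "x \<in> space PM \<Longrightarrow> mnorm u w F = iter_norm d k u w m F x"
  unfolding mnorm_def by (rule iter_norm_indep) (auto simp: space_PiM PiE_def extensional_def)

text \<open>\<open>dil m d 1 x\<close> lies in the product space for every \<open>x\<close>, so it
  is an explicit admissible base point.\<close>

lemma mnorm_origin: "mnorm u w F = iter_norm d k u w m F (dil m d 1 x)"
  by (rule mnorm_eq) simp

lemma mnorm_cong: "(\<And>x. x \<in> space PM \<Longrightarrow> F x = G x) \<Longrightarrow> mnorm u w F = mnorm u w G"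
  unfolding mnorm_origin[of u w _ undefined] by (rule iter_norm_cong) auto

lemma mnorm_Minkowski:
  assumes "sigma_finite_measure T" "(\<lambda>(t, x). F t x) \<in> borel_measurable (T \<Otimes>\<^sub>M PM)"
    and "\<And>i. i \<in> {1..m} \<Longrightarrow> 1 < u i" "\<And>i. i \<in> {1..m} \<Longrightarrow> 1 < w i"
  shows "mnorm u w (\<lambda>x. \<integral>\<^sup>+t. F t x \<partial>T) \<le> (\<integral>\<^sup>+t. mnorm u w (F t) \<partial>T)"
  unfolding mnorm_origin[of u w _ undefined] using assms by (intro iter_norm_Minkowski) auto

lemma mnorm_Holder:
  assumes "F \<in> borel_measurable PM" "G \<in> borel_measurable PM"
    and "\<And>i. i \<in> {1..m} \<Longrightarrow> 0 < u1 i \<and> 0 < u2 i \<and> 0 < u i \<and> 1 / u i = 1 / u1 i + 1 / u2 i"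
    and "\<And>i. i \<in> {1..m} \<Longrightarrow> 0 < w1 i \<and> 0 < w2 i \<and> 0 < w i \<and> 1 / w i = 1 / w1 i + 1 / w2 i"
  shows "mnorm u w (\<lambda>x. F x * G x) \<le> mnorm u1 w1 F * mnorm u2 w2 G"
  unfolding mnorm_origin[of _ _ _ undefined] using assms by (intro iter_norm_Holder) auto

lemma mnorm_one:
  assumes "F \<in> borel_measurable PM"
  shows "mnorm (\<lambda>_. 1) (\<lambda>_. 1) F = (\<integral>\<^sup>+x. ennreal (wt x) * F x \<partial>PM)"
proof -
  have "mnorm (\<lambda>_. 1) (\<lambda>_. 1) F = (\<integral>\<^sup>+y. ennreal (\<Prod>i=1..m. weight (d i) (k i) (y i)) *
      F (\<lambda>i. if i \<in> {1..m} then y i else dil m d 1 undefined i) \<partial>PM)"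
    unfolding mnorm_origin[of _ _ _ undefined] by (rule iter_norm_one[OF assms]) auto
  also have "\<dots> = (\<integral>\<^sup>+x. ennreal (wt x) * F x \<partial>PM)"
    unfolding wt_def
    by (intro nn_integral_cong arg_cong2[where f="(*)"] arg_cong[where f=F] refl)
       (auto simp: space_PiM PiE_def extensional_def dil_def)
  finally show ?thesis .
qed

text \<open>The norm of the indicator of a null set with all exponents 1 is its Dunkl measure, hence
  0, and \<open>iter_norm_cong_null\<close> transfers this to all exponents. Thus norms of Lebesgue
  measurable functions can be computed from Borel representatives.\<close>

lemma mnorm_cong_AE:
  assumes "AE x in PM. F x = G x"
  shows "mnorm u w F = mnorm u w G"
proof -
  from assms obtain Z where Z: "{x \<in> space PM. F x \<noteq> G x} \<subseteq> Z" "Z \<in> null_sets PM"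
    by (auto elim!: AE_E simp: null_sets_def)
  have [measurable]: "Z \<in> sets PM" using Z by auto
  have "AE x in PM. x \<notin> Z" using Z(2) by (rule AE_not_in)
  then have "(\<integral>\<^sup>+x. ennreal (wt x) * indicator Z x \<partial>PM) = (\<integral>\<^sup>+x. 0 \<partial>PM)"
    by (intro nn_integral_cong_AE) (auto elim!: eventually_mono)
  then have "mnorm (\<lambda>_. 1) (\<lambda>_. 1) (indicator Z) = 0"
    by (subst mnorm_one) auto
  then show ?thesis
    unfolding mnorm_origin[of _ _ _ undefined] using Z
    by (intro iter_norm_cong_null[of "indicator Z"]) (auto split: split_indicator_asm)
qed

context
  fixes u w :: "nat \<Rightarrow> real"
  assumes uw: "\<And>i. i \<in> {1..m} \<Longrightarrow> 0 < u i" "\<And>i. i \<in> {1..m} \<Longrightarrow> 0 < w i"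
begin

lemma mnorm_mono: "(\<And>x. x \<in> space PM \<Longrightarrow> F x \<le> G x) \<Longrightarrow> mnorm u w F \<le> mnorm u w G"
  unfolding mnorm_origin[of u w _ undefined] using uw by (intro iter_norm_mono) auto

lemma mnorm_mono_AE:
  assumes "AE x in PM. F x \<le> G x"
  shows "mnorm u w F \<le> mnorm u w G"
proof -
  have "mnorm u w F = mnorm u w (\<lambda>x. min (F x) (G x))"
    using assms by (intro mnorm_cong_AE) (auto elim!: eventually_mono)
  also have "\<dots> \<le> mnorm u w G" by (intro mnorm_mono) auto
  finally show ?thesis .
qed

lemma mnorm_cmult:
  "F \<in> borel_measurable PM \<Longrightarrow> mnorm u w (\<lambda>x. c * F x) = c * mnorm u w F"
  unfolding mnorm_origin[of u w _ undefined] using uw by (intro iter_norm_cmult) auto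

lemma mnorm_scale:
  assumes "F \<in> borel_measurable PM" "0 < t"
  shows "mnorm u w (\<lambda>x. F (dil m d t x)) =
    ennreal (t powr - (\<Sum>i=1..m. hom_dim (d i) (k i) / u i)) * mnorm u w F"
proof -
  have "mnorm u w F = iter_norm d k u w m F (dil m d t (dil m d 1 undefined))"
    by (rule mnorm_eq) simp
  then show ?thesis
    unfolding mnorm_origin[of u w "\<lambda>x. F (dil m d t x)" undefined]
    using assms uw by (subst iter_norm_scale) auto
qed

lemma mnorm_prod:
  assumes "\<And>i. i \<in> {1..m} \<Longrightarrow> g i \<in> borel_measurable (euclid (d i))"
  shows "mnorm u w (\<lambda>x. \<Prod>i=1..m. g i (x i)) = (\<Prod>i=1..m. block_norm (d i) (k i) (u i) (w i) (g i))"
  unfolding mnorm_origin[of u w _ undefined] using assms uw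
  by (subst iter_norm_prod) auto

end

end

section \<open>Centred balls\<close>

context dunkl_blocks
begin

abbreviation dunkl :: "(nat \<Rightarrow> nat \<Rightarrow> real) measure" where
  "dunkl \<equiv> dunkl_measure m d k"

definition rnorm :: "(nat \<Rightarrow> nat \<Rightarrow> real) \<Rightarrow> real" where
  "rnorm x = sqrt (\<Sum>i=1..m. \<Sum>v=1..d i. (x i v)\<^sup>2)"

text \<open>The norm of the indicator of a centred ball grows like the radius to this power
  (\<open>mnorm_ball\<close>). With all exponents 1 it is the homogeneous dimension
  \<open>total_hom_dim m d k\<close>.\<close>

definition hdim :: "(nat \<Rightarrow> real) \<Rightarrow> real" where
  "hdim u = (\<Sum>i=1..m. hom_dim (d i) (k i) / u i)"

abbreviation ball_ind :: "real \<Rightarrow> (nat \<Rightarrow> nat \<Rightarrow> real) \<Rightarrow> ennreal" where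
  "ball_ind R \<equiv> indicator (oball m d R)"

lemma leb_eq: "leb m d = completion PM"
  by (simp add: leb_def)

lemma space_leb: "space (leb m d) = space PM"
  by (simp add: leb_eq)

lemma oball_eq: "oball m d R = {x \<in> space PM. rnorm x < R}"
  by (simp add: oball_def space_leb rnorm_def)

lemma rnorm_nonneg [simp]: "0 \<le> rnorm x"
  by (simp add: rnorm_def sum_nonneg)

lemma rnorm_measurable [measurable]: "rnorm \<in> borel_measurable PM"
proof -
  have "(\<lambda>x. x i v) \<in> borel_measurable PM" if "i \<in> {1..m}" "v \<in> {1..d i}" for i v
    using measurable_compose[OF measurable_component_singleton[OF that(1), of "\<lambda>i. euclid (d i)"]
        euclid_component_measurable[OF that(2)]] by simp
  then show ?thesis
    unfolding rnorm_def[abs_def]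
    by (intro measurable_compose[OF _ borel_measurable_sqrt] borel_measurable_sum borel_measurable_power) auto
qed

lemma oball_sets [measurable]: "oball m d R \<in> sets PM"
  unfolding oball_eq by measurable

lemma rnorm_dil: "0 \<le> t \<Longrightarrow> rnorm (dil m d t x) = t * rnorm x"
  by (simp add: rnorm_def dil_def power_mult_distrib sum_distrib_left[symmetric] real_sqrt_mult)

lemma L2_set_le_rnorm:
  assumes "i \<in> {1..m}" shows "L2_set (x i) {1..d i} \<le> rnorm x"
  unfolding L2_set_def rnorm_def
  using assms by (intro real_sqrt_le_mono member_le_sum) (auto intro: sum_nonneg)

lemma ball_ind_dil:
  assumes "0 < t" "x \<in> space PM"
  shows "ball_ind R x = ball_ind (t * R) (dil m d t x)"
  using assms by (auto simp: oball_eq rnorm_dil split: split_indicator)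

lemma hom_dim_pos: "i \<in> {1..m} \<Longrightarrow> 0 < hom_dim (d i) (k i)"
  using d_pos[of i] k_nonneg[of i] unfolding hom_dim_def
  by (intro add_pos_nonneg mult_nonneg_nonneg sum_nonneg) auto

lemma total_hom_dim_eq: "total_hom_dim m d k = hdim (\<lambda>_. 1)"
  by (simp add: total_hom_dim_def total_dim_def hdim_def hom_dim_def sum.distrib sum_distrib_left)

lemma hdim_add:
  assumes "\<And>i. i \<in> {1..m} \<Longrightarrow> 1 / u i = 1 / u1 i + 1 / u2 i"
  shows "hdim u = hdim u1 + hdim u2"
proof -
  have "hom_dim (d i) (k i) / u i = hom_dim (d i) (k i) / u1 i + hom_dim (d i) (k i) / u2 i"
    if "i \<in> {1..m}" for i
    using arg_cong[OF assms[OF that], of "\<lambda>x. hom_dim (d i) (k i) * x"] by (simp add: distrib_left)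
  then show ?thesis unfolding hdim_def sum.distrib[symmetric] by (intro sum.cong) auto
qed

lemma hdim_pos:
  assumes "1 \<le> m" "\<And>i. i \<in> {1..m} \<Longrightarrow> 0 < u i"
  shows "0 < hdim u"
  unfolding hdim_def using assms hom_dim_pos by (intro sum_pos) auto

lemma AE_PM_component:
  assumes "i \<in> {1..m}" "AE y in euclid (d i). P y"
  shows "AE x in PM. P (x i)"
proof -
  from assms(2) obtain Z where Z: "{y \<in> space (euclid (d i)). \<not> P y} \<subseteq> Z"
    "Z \<in> sets (euclid (d i))" "emeasure (euclid (d i)) Z = 0"
    by (auto elim!: AE_E)
  let ?A = "\<lambda>l. if l = i then Z else space (euclid (d l))"
  have "emeasure PM (Pi\<^sub>E {1..m} ?A) = (\<Prod>l=1..m. emeasure (euclid (d l)) (?A l))"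
    using Z by (intro PM.emeasure_PiM) auto
  also have "\<dots> = 0" using assms(1) Z by (intro prod_zero) (auto intro!: bexI[of _ i])
  finally have "Pi\<^sub>E {1..m} ?A \<in> null_sets PM"
    using Z by (intro null_setsI sets_PiM_I_finite) auto
  moreover have "{x \<in> space PM. \<not> P (x i)} \<subseteq> Pi\<^sub>E {1..m} ?A"
    using Z(1) assms(1) by (auto simp: space_PiM PiE_def Pi_def)
  ultimately show ?thesis by (rule AE_I')
qed

text \<open>The weight can vanish only on coordinate hyperplanes. Hence a null set of the Dunkl
  measure is also a Lebesgue null set.\<close>

lemma AE_wt_pos: "AE x in PM. 0 < wt x"
proof -
  have "AE x in PM. \<forall>i\<in>{1..m}. 0 < weight (d i) (k i) (x i)"
    by (intro AE_ball_countable[THEN iffD2] ballI AE_PM_component AE_weight_pos) auto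
  then show ?thesis by eventually_elim (auto simp: wt_def intro!: prod_pos)
qed

lemma AE_blocks_pos: "AE x in PM. \<forall>i\<in>{1..m}. 0 < L2_set (x i) {1..d i}"
  by (intro AE_ball_countable[THEN iffD2] ballI AE_PM_component AE_L2_set_pos d_pos) auto

lemma AE_rnorm_pos:
  assumes "1 \<le> m" shows "AE x in PM. 0 < rnorm x"
  using AE_blocks_pos
proof eventually_elim
  case (elim x)
  have 1: "1 \<in> {1..m}" using assms by simp
  with elim have "0 < L2_set (x 1) {1..d 1}" by blast
  also have "\<dots> \<le> rnorm x" by (rule L2_set_le_rnorm[OF 1])
  finally show ?case .
qed

text \<open>The space has positive measure, as a product of non-zero factors. This allows
  contradictions to be drawn from statements that hold almost everywhere.\<close>

lemma not_AE_False: "\<not> (AE x in PM. False)"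
proof
  assume "AE x in PM. False"
  then have "emeasure PM (space PM) = 0" by (auto elim!: AE_E simp: emeasure_eq_0)
  moreover have "emeasure PM (space PM) = (\<Prod>i=1..m. emeasure (euclid (d i)) (space (euclid (d i))))"
    unfolding space_PiM by (rule PM.emeasure_PiM) auto
  moreover have "emeasure (euclid p) (space (euclid p)) \<noteq> 0" for p
  proof -
    interpret product_sigma_finite "\<lambda>_::nat. lborel :: real measure" by standard
    have "emeasure (euclid p) (space (euclid p)) = (\<Prod>v=1..p. emeasure lborel (UNIV :: real set))"
      unfolding euclid_def space_PiM by (simp add: emeasure_PiM)
    then show ?thesis by simp
  qed
  ultimately show False by simp
qed

text \<open>Non-negative integrals over a completion and over the measure itself coincide, so Dunkl
  integrals can be computed on the uncompleted product.\<close>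

lemma nn_integral_dunkl:
  assumes "f \<in> borel_measurable (leb m d)"
  shows "(\<integral>\<^sup>+x. f x \<partial>dunkl) = (\<integral>\<^sup>+x. ennreal (wt x) * f x \<partial>PM)"
proof -
  have [measurable]: "wt \<in> borel_measurable (leb m d)"
    unfolding leb_eq by (intro measurable_completion wt_measurable)
  have "dunkl = density (leb m d) (\<lambda>x. ennreal (wt x))"
    by (simp add: dunkl_measure_def wt_def weight_def)
  then show ?thesis
    using assms by (simp add: nn_integral_density) (simp add: leb_eq nn_integral_completion)
qed

lemma sets_dunkl [measurable_cong]: "sets dunkl = sets (leb m d)"
  by (simp add: dunkl_measure_def)

lemma oball_sets_leb [measurable]: "oball m d R \<in> sets (leb m d)"
  unfolding leb_eq using oball_sets by auto

lemma emeasure_oball: "emeasure dunkl (oball m d R) = mnorm (\<lambda>_. 1) (\<lambda>_. 1) (ball_ind R)"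
proof -
  have "emeasure dunkl (oball m d R) = (\<integral>\<^sup>+x. ball_ind R x \<partial>dunkl)"
    by (simp add: sets_dunkl)
  also have "\<dots> = (\<integral>\<^sup>+x. ennreal (wt x) * ball_ind R x \<partial>PM)"
    by (rule nn_integral_dunkl) measurable
  also have "\<dots> = mnorm (\<lambda>_. 1) (\<lambda>_. 1) (ball_ind R)"
    by (rule mnorm_one[symmetric]) measurable
  finally show ?thesis .
qed

text \<open>The scale-free constant in the norms of balls. With all exponents 1 it is the Dunkl
  measure of the unit ball.\<close>

definition qnorm :: "(nat \<Rightarrow> real) \<Rightarrow> (nat \<Rightarrow> real) \<Rightarrow> real" where
  "qnorm u w = enn2real (mnorm u w (ball_ind 1))"

context
  fixes u w :: "nat \<Rightarrow> real"
  assumes uw: "\<And>i. i \<in> {1..m} \<Longrightarrow> 0 < u i" "\<And>i. i \<in> {1..m} \<Longrightarrow> 0 < w i"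
begin

lemma mnorm_dilate:
  assumes F: "F \<in> borel_measurable PM" and R: "0 < R" "0 < t"
  shows "mnorm u w (\<lambda>x. F (dil m d t x) * ball_ind R x) =
    ennreal (t powr - hdim u) * mnorm u w (\<lambda>x. F x * ball_ind (t * R) x)"
proof -
  note F[measurable]
  have "mnorm u w (\<lambda>x. F (dil m d t x) * ball_ind R x) =
     mnorm u w (\<lambda>x. F (dil m d t x) * ball_ind (t * R) (dil m d t x))"
    using R by (intro mnorm_cong) (simp add: ball_ind_dil[symmetric])
  also have "\<dots> = ennreal (t powr - hdim u) * mnorm u w (\<lambda>x. F x * ball_ind (t * R) x)"
    unfolding hdim_def using R uw
    by (intro mnorm_scale[of u w "\<lambda>x. F x * ball_ind (t * R) x"]) auto
  finally show ?thesis .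
qed

text \<open>Inside the unit ball the exponent may be replaced by \<open>min a 0\<close>. Each block
  radius is at most the full radius, so a product of non-positive powers of block radii is a
  majorant, and its norm factorises.\<close>

lemma mnorm_powr_finite:
  assumes a: "0 < a + hdim u" and m: "1 \<le> m"
  shows "mnorm u w (\<lambda>x. ennreal (rnorm x powr a) * ball_ind 1 x) < \<infinity>"
proof -
  \<comment> \<open>The exponent is shared among the blocks in proportion to their contributions to
    \<open>hdim u\<close>; then the integrability conditions of all blocks reduce to the single
    condition \<open>0 < min a 0 + hdim u\<close>.\<close>
  define b where "b i = min a 0 * (hom_dim (d i) (k i) / u i) / hdim u" for i
  have S: "0 < hdim u" by (rule hdim_pos[OF m uw(1)])
  have b: "b i \<le> 0" if "i \<in> {1..m}" for i
    using that S uw[of i] hom_dim_pos[of i] by (auto simp: b_def divide_nonpos_pos mult_nonpos_nonneg)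
  have sb: "(\<Sum>i=1..m. b i) = min a 0"
  proof -
    have "(\<Sum>i=1..m. b i) = (\<Sum>i=1..m. min a 0 / hdim u * (hom_dim (d i) (k i) / u i))"
      by (intro sum.cong) (auto simp: b_def)
    also have "\<dots> = min a 0 / hdim u * hdim u"
      by (simp only: sum_distrib_left[symmetric] hdim_def[symmetric])
    finally show ?thesis using S by simp
  qed
  have pos: "0 < b i * u i + hom_dim (d i) (k i)" if i: "i \<in> {1..m}" for i
  proof -
    have "b i * u i + hom_dim (d i) (k i) = hom_dim (d i) (k i) * ((min a 0 + hdim u) / hdim u)"
      using S uw[OF i] by (simp add: b_def field_simps)
    also have "\<dots> > 0" using S a hom_dim_pos[OF i] by (intro mult_pos_pos divide_pos_pos) auto
    finally show ?thesis .
  qed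
  let ?g = "\<lambda>i y. ennreal (L2_set y {1..d i} powr b i) * indicator {y. L2_set y {1..d i} < 1} y"
  have "mnorm u w (\<lambda>x. ennreal (rnorm x powr a) * ball_ind 1 x) \<le> mnorm u w (\<lambda>x. \<Prod>i=1..m. ?g i (x i))"
  proof (intro mnorm_mono_AE uw)
    show "AE x in PM. ennreal (rnorm x powr a) * ball_ind 1 x \<le> (\<Prod>i=1..m. ?g i (x i))"
      using AE_blocks_pos
    proof eventually_elim
      case (elim x)
      show ?case
      proof (cases "x \<in> oball m d 1")
        case True
        then have r1: "rnorm x < 1" by (simp add: oball_eq)
        have i1: "1 \<in> {1..m}" using m by simp
        have "0 < L2_set (x 1) {1..d 1}" using elim i1 by blast
        also have "\<dots> \<le> rnorm x" by (rule L2_set_le_rnorm[OF i1])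
        finally have r0: "0 < rnorm x" .
        have lt: "L2_set (x i) {1..d i} < 1" if "i \<in> {1..m}" for i
          using L2_set_le_rnorm[OF that, of x] r1 by simp
        have "rnorm x powr a \<le> rnorm x powr (min a 0)"
          using r0 r1 by (intro powr_mono') auto
        also have "\<dots> = (\<Prod>i=1..m. rnorm x powr b i)"
          using r0 by (simp add: sb[symmetric] powr_sum)
        also have "\<dots> \<le> (\<Prod>i=1..m. L2_set (x i) {1..d i} powr b i)"
          using elim b L2_set_le_rnorm by (intro prod_mono) (auto intro!: powr_mono2')
        finally have "ennreal (rnorm x powr a) \<le> ennreal (\<Prod>i=1..m. L2_set (x i) {1..d i} powr b i)"
          by (rule ennreal_leI)
        also have "\<dots> = (\<Prod>i=1..m. ?g i (x i))"
          using lt by (subst prod_ennreal[symmetric]) (auto intro!: prod.cong)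
        finally show ?thesis using True by simp
      qed simp
    qed
  qed
  also have "\<dots> = (\<Prod>i=1..m. block_norm (d i) (k i) (u i) (w i) (?g i))"
    by (rule mnorm_prod[OF uw]) auto
  also have "\<dots> < top"
    using block_norm_powr_finite[OF k_nonneg uw pos]
    by (auto simp: less_top[symmetric] ennreal_prod_eq_top)
  finally show ?thesis by simp
qed

lemma mnorm_ball:
  assumes "0 < R" shows "mnorm u w (ball_ind R) = ennreal (R powr hdim u) * mnorm u w (ball_ind 1)"
proof -
  have "mnorm u w (\<lambda>x. 1 * ball_ind R x) = ennreal ((1 / R) powr - hdim u) * mnorm u w (\<lambda>x. 1 * ball_ind (1 / R * R) x)"
    using assms mnorm_dilate[of "\<lambda>_. 1" R "1 / R"] by simp
  then show ?thesis using assms by (simp add: powr_divide powr_minus_divide)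
qed

lemma mnorm_ball_finite: "1 \<le> m \<Longrightarrow> mnorm u w (ball_ind 1) < \<infinity>"
proof -
  assume m: "1 \<le> m"
  \<comment> \<open>An equality almost everywhere, because \<open>0 powr 0 = 0\<close> at the
    origin.\<close>
  have "mnorm u w (ball_ind 1) = mnorm u w (\<lambda>x. ennreal (rnorm x powr 0) * ball_ind 1 x)"
    using AE_rnorm_pos[OF m] by (intro mnorm_cong_AE) (auto elim!: eventually_mono)
  also have "\<dots> < \<infinity>" using hdim_pos[OF m uw(1)] m by (intro mnorm_powr_finite) auto
  finally show ?thesis .
qed

lemma mnorm_ball_eq:
  assumes "1 \<le> m" "0 < R" shows "mnorm u w (ball_ind R) = ennreal (R powr hdim u * qnorm u w)"
  using mnorm_ball[OF assms(2)] mnorm_ball_finite[OF assms(1)]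
  by (simp add: qnorm_def ennreal_mult)

end

lemma emeasure_oball_eq:
  assumes "1 \<le> m" "0 < R"
  shows "emeasure dunkl (oball m d R) = ennreal (R powr total_hom_dim m d k * qnorm (\<lambda>_. 1) (\<lambda>_. 1))"
  unfolding emeasure_oball total_hom_dim_eq using assms by (intro mnorm_ball_eq) auto

lemma measure_oball_eq:
  assumes "1 \<le> m" "0 < R"
  shows "measure dunkl (oball m d R) = R powr total_hom_dim m d k * qnorm (\<lambda>_. 1) (\<lambda>_. 1)"
  using emeasure_oball_eq[OF assms] by (simp add: measure_def qnorm_def)

text \<open>If the unit ball were a null set, so would be every centred ball by scaling, and
  countably many of them cover the space.\<close>

lemma qnorm_one_pos:
  assumes m: "1 \<le> m" shows "0 < qnorm (\<lambda>_. 1) (\<lambda>_. 1)"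
proof (rule ccontr)
  assume "\<not> ?thesis"
  then have q: "qnorm (\<lambda>_. 1) (\<lambda>_. 1) = 0" by (auto simp: qnorm_def order_less_le)
  have "AE x in PM. ball_ind (real (Suc n)) x = 0" for n
  proof -
    have "(\<integral>\<^sup>+x. ennreal (wt x) * ball_ind (real (Suc n)) x \<partial>PM) = 0"
      using emeasure_oball_eq[OF m, of "real (Suc n)"] q mnorm_one[of "ball_ind (real (Suc n))"]
      unfolding emeasure_oball by simp
    then have "AE x in PM. ennreal (wt x) * ball_ind (real (Suc n)) x = 0"
      by (subst (asm) nn_integral_0_iff_AE) auto
    with AE_wt_pos show ?thesis by eventually_elim auto
  qed
  then have "AE x in PM. \<forall>n. ball_ind (real (Suc n)) x = 0" by (simp add: AE_all_countable)
  then have "AE x in PM. False"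
  proof (rule AE_mp, intro AE_I2 impI)
    fix x assume x: "x \<in> space PM" "\<forall>n. ball_ind (real (Suc n)) x = 0"
    obtain n where "rnorm x < real n" using reals_Archimedean2 by blast
    then have "x \<in> oball m d (real (Suc n))" using x by (simp add: oball_eq)
    then show False using x(2) by (auto dest: spec[of _ n])
  qed
  then show False using not_AE_False by simp
qed

section \<open>Duality and its consequences\<close>

definition conj_exp :: "(nat \<Rightarrow> real) \<Rightarrow> nat \<Rightarrow> real" where
  "conj_exp u i = u i / (u i - 1)"

context
  fixes u w :: "nat \<Rightarrow> real"
  assumes uw: "\<And>i. i \<in> {1..m} \<Longrightarrow> 1 < u i" "\<And>i. i \<in> {1..m} \<Longrightarrow> 1 < w i"
begin

lemma conj_exp:
  "i \<in> {1..m} \<Longrightarrow> 0 < conj_exp u i \<and> 1 / 1 = 1 / u i + 1 / conj_exp u i"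
  "i \<in> {1..m} \<Longrightarrow> 0 < conj_exp w i \<and> 1 / 1 = 1 / w i + 1 / conj_exp w i"
  using uw[of i] by (auto simp: conj_exp_def field_simps)

text \<open>Hoelder's inequality with target exponent 1 in all blocks; the indicator is its own
  square, so both factors carry one copy.\<close>

lemma nn_integral_le_mnorm:
  assumes [measurable]: "F \<in> borel_measurable PM"
  shows "(\<integral>\<^sup>+x. ennreal (wt x) * (F x * ball_ind R x) \<partial>PM) \<le>
    mnorm u w (\<lambda>x. F x * ball_ind R x) * mnorm (conj_exp u) (conj_exp w) (ball_ind R)"
proof -
  have "(\<integral>\<^sup>+x. ennreal (wt x) * (F x * ball_ind R x) \<partial>PM) =
    mnorm (\<lambda>_. 1) (\<lambda>_. 1) (\<lambda>x. (F x * ball_ind R x) * ball_ind R x)"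
    by (subst mnorm_one) (auto intro!: nn_integral_cong split: split_indicator)
  also have "\<dots> \<le> mnorm u w (\<lambda>x. F x * ball_ind R x) * mnorm (conj_exp u) (conj_exp w) (ball_ind R)"
    using uw conj_exp by (intro mnorm_Holder) (auto intro: less_trans[OF zero_less_one])
  finally show ?thesis .
qed

lemma hdim_conj: "hdim u + hdim (conj_exp u) = total_hom_dim m d k"
  unfolding total_hom_dim_eq using conj_exp by (intro hdim_add[symmetric]) auto

lemma nn_integral_le_mnorm_ball:
  assumes "1 \<le> m" "0 < R" "F \<in> borel_measurable PM"
  shows "(\<integral>\<^sup>+x. ennreal (wt x) * (F x * ball_ind R x) \<partial>PM) \<le>
    mnorm u w (\<lambda>x. F x * ball_ind R x) * ennreal (R powr hdim (conj_exp u) * qnorm (conj_exp u) (conj_exp w))"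
  using nn_integral_le_mnorm[OF assms(3), of R] conj_exp
  by (subst (asm) mnorm_ball_eq[OF _ _ assms(1,2)]) auto

text \<open>By the duality estimate, a unit ball of norm 0 would have Dunkl measure 0.\<close>

lemma qnorm_pos:
  assumes m: "1 \<le> m" shows "0 < qnorm u w"
proof (rule ccontr)
  assume "\<not> ?thesis"
  then have q: "qnorm u w = 0" by (auto simp: qnorm_def order_less_le)
  have 0: "mnorm u w (ball_ind 1) = 0"
    using mnorm_ball_eq[OF _ _ m, of u w 1] uw q by (simp add: less_trans[OF zero_less_one])
  have "emeasure dunkl (oball m d 1) \<le> 0"
    using nn_integral_le_mnorm[of "\<lambda>_. 1" 1] 0 unfolding emeasure_oball by (subst mnorm_one) auto
  then show False using emeasure_oball_eq[OF m, of 1] qnorm_one_pos[OF m] by simp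
qed

text \<open>Minkowski's integral inequality for the counting measure on two points.\<close>

lemma mnorm_add_le:
  assumes [measurable]: "F \<in> borel_measurable PM" "G \<in> borel_measurable PM"
  shows "mnorm u w (\<lambda>x. F x + G x) \<le> mnorm u w F + mnorm u w G"
proof -
  let ?T = "count_space (UNIV :: bool set)"
  have "mnorm u w (\<lambda>x. \<integral>\<^sup>+b. (if b then F x else G x) \<partial>?T) \<le> (\<integral>\<^sup>+b. mnorm u w (\<lambda>x. if b then F x else G x) \<partial>?T)"
    using uw by (intro mnorm_Minkowski sigma_finite_measure_count_space_finite) auto
  then show ?thesis by (simp add: nn_integral_count_space_finite UNIV_bool add.commute)
qed

text \<open>Finite norms give finite integrals over balls by duality, hence finite values almost
  everywhere on each of countably many balls that exhaust the space. In this way norm estimates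
  yield the existence of the commutator.\<close>

lemma mnorm_finite_imp_AE:
  assumes [measurable]: "F \<in> borel_measurable PM" and m: "1 \<le> m"
    and fin: "\<And>R. 0 < R \<Longrightarrow> mnorm u w (\<lambda>x. F x * ball_ind R x) < \<infinity>"
  shows "AE x in PM. F x < \<infinity>"
proof -
  have "AE x in PM. F x * ball_ind (real (Suc n)) x < \<infinity>" for n
  proof -
    have "(\<integral>\<^sup>+x. ennreal (wt x) * (F x * ball_ind (real (Suc n)) x) \<partial>PM) < \<infinity>"
      using fin[of "real (Suc n)"]
      by (intro order_le_less_trans[OF nn_integral_le_mnorm_ball[OF m, of "real (Suc n)" F]])
         (auto simp: ennreal_mult_less_top)
    then have "AE x in PM. ennreal (wt x) * (F x * ball_ind (real (Suc n)) x) \<noteq> \<infinity>"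
      by (intro nn_integral_PInf_AE) auto
    with AE_wt_pos show ?thesis
      by eventually_elim (auto simp: ennreal_mult_eq_top_iff less_top[symmetric])
  qed
  then have "AE x in PM. \<forall>n. F x * ball_ind (real (Suc n)) x < \<infinity>" by (simp add: AE_all_countable)
  then show ?thesis
  proof (rule AE_mp, intro AE_I2 impI)
    fix x assume x: "x \<in> space PM" "\<forall>n. F x * ball_ind (real (Suc n)) x < \<infinity>"
    obtain n where "rnorm x < real n" using reals_Archimedean2 by blast
    then have "x \<in> oball m d (real (Suc n))" using x by (simp add: oball_eq)
    then show "F x < \<infinity>" using x(2) by (auto dest: spec[of _ n])
  qed
qed

end

end

section \<open>Borel representatives\<close>

text \<open>Subsets of null sets are measurable in a completion. This supplies the measurability of
  the commutator and of its integrands along a ray, which are built from functions that need not be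
  Borel.\<close>

lemma measurable_completion_cong_AE:
  fixes f f' :: "'a \<Rightarrow> 'b :: topological_space"
  assumes "f' \<in> M \<rightarrow>\<^sub>M borel" "AE x in M. f x = f' x"
  shows "f \<in> completion M \<rightarrow>\<^sub>M borel"
proof (rule measurableI)
  fix A :: "'b set" assume A: "A \<in> sets borel"
  have ae: "AE x in completion M. f x = f' x" using assms(2) by (rule AE_completion)
  show "f -` A \<inter> space (completion M) \<in> sets (completion M)"
  proof (rule completion.in_sets_AE)
    have "f' -` A \<inter> space M \<in> sets M" using assms(1) A by (rule measurable_sets)
    then show "f' -` A \<inter> space M \<in> sets (completion M)" by auto
    show "AE x in completion M. (x \<in> f' -` A \<inter> space M) = (x \<in> f -` A \<inter> space (completion M))"
      using ae by eventually_elim auto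
  qed auto
qed auto

lemma completion_ex_borel_measurable_complex:
  fixes f :: "'a \<Rightarrow> complex"
  assumes f: "f \<in> borel_measurable (completion M)"
  obtains f' where "f' \<in> borel_measurable M" "AE x in M. f x = f' x"
proof -
  have "(\<lambda>x. Re (f x)) \<in> borel_measurable (completion M)" "(\<lambda>x. Im (f x)) \<in> borel_measurable (completion M)"
    using f by measurable
  from this[THEN completion_ex_borel_measurable_real] obtain g h
    where g: "g \<in> borel_measurable M" "AE x in M. Re (f x) = g x"
      and h: "h \<in> borel_measurable M" "AE x in M. Im (f x) = h x" by blast
  show ?thesis
  proof
    show "(\<lambda>x. Complex (g x) (h x)) \<in> borel_measurable M"
      using g(1) h(1) by (simp add: borel_measurable_complex_iff)
    show "AE x in M. f x = Complex (g x) (h x)"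
      using g(2) h(2) by eventually_elim (simp add: complex_eq_iff)
  qed
qed

lemma ennreal_divide_le_iff:
  fixes a b c :: ennreal
  assumes "0 < b" "b < top"
  shows "a / b \<le> c \<longleftrightarrow> a \<le> c * b"
  using divide_less_ennreal[of b] assms
  by (metis divide_right_mono_ennreal ennreal_divide_times ennreal_divide_self mult.right_neutral
      mult_divide_eq_ennreal mult_right_mono not_gr_zero order_less_imp_not_eq zero_le)

section \<open>Morrey and mean oscillation estimates\<close>

context dunkl_blocks
begin

definition vol :: "real \<Rightarrow> real" where
  "vol R = measure dunkl (oball m d R)"

definition bnorm :: "(nat \<Rightarrow> real) \<Rightarrow> (nat \<Rightarrow> real) \<Rightarrow> real \<Rightarrow> real" where
  "bnorm u w R = R powr hdim u * qnorm u w"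

lemma qnorm_nonneg [simp]: "0 \<le> qnorm u w"
  by (simp add: qnorm_def)

lemma bnorm_nonneg [simp]: "0 \<le> bnorm u w R"
  by (simp add: bnorm_def)

lemma total_hom_dim_nonneg: "0 \<le> total_hom_dim m d k"
  unfolding total_hom_dim_eq hdim_def using hom_dim_pos by (intro sum_nonneg) (auto intro: less_imp_le)

lemma mixed_norm_ball:
  "mixed_norm m d k u w (\<lambda>x. f x * indicator (oball m d R) x) =
     mnorm u w (\<lambda>x. ennreal (cmod (f x)) * ball_ind R x)"
  unfolding mixed_norm_mnorm by (intro mnorm_cong) (auto split: split_indicator)

lemma mixed_norm_ball_ind: "mixed_norm m d k u w (indicator (oball m d R)) = mnorm u w (ball_ind R)"
  unfolding mixed_norm_mnorm by (intro mnorm_cong) (auto split: split_indicator)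

text \<open>Subtracting \<open>c\<close> commutes with averaging. The constant is arbitrary because
  it is later the mean over a larger ball, or \<open>ln R\<close>.\<close>

lemma ball_mean_deviation:
  assumes m: "1 \<le> m" and R: "0 < R"
    and b: "set_integrable dunkl (oball m d R) b" "b \<in> borel_measurable (leb m d)"
  shows "ennreal (cmod (ball_mean m d k b R - c) * vol R) \<le>
    (\<integral>\<^sup>+x. ennreal (wt x) * (ennreal (cmod (b x - c)) * ball_ind R x) \<partial>PM)"
proof -
  let ?B = "oball m d R"
  have fin: "emeasure dunkl ?B < \<infinity>" using emeasure_oball_eq[OF m R] by simp
  have v: "0 < vol R" unfolding vol_def measure_oball_eq[OF m R] using R qnorm_one_pos[OF m] by simp
  have B: "?B \<in> sets dunkl" by (simp add: sets_dunkl)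
  have c: "set_integrable dunkl ?B (\<lambda>_. c)" using B fin by (simp add: set_integrable_def)
  have "set_integrable dunkl ?B (\<lambda>x. b x - c)" using b(1) c by (rule set_integral_diff)
  then have int: "integrable dunkl (\<lambda>x. indicator ?B x *\<^sub>R (b x - c))" by (simp add: set_integrable_def)
  have "(LINT x:?B|dunkl. b x - c) = (LINT x:?B|dunkl. b x) - (LINT x:?B|dunkl. c)"
    using b(1) c by (rule set_integral_diff)
  also have "(LINT x:?B|dunkl. c) = vol R *\<^sub>R c"
    using B fin by (simp add: vol_def set_lebesgue_integral_def)
  also have "(LINT x:?B|dunkl. b x) = vol R *\<^sub>R ball_mean m d k b R"
    using v by (simp add: ball_mean_def vol_def[symmetric] scaleR_conv_of_real)
  finally have "(LINT x:?B|dunkl. b x - c) = vol R *\<^sub>R (ball_mean m d k b R - c)"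
    by (simp add: scaleR_diff_right)
  then have "ennreal (cmod (ball_mean m d k b R - c) * vol R) = ennreal (norm (LINT x:?B|dunkl. b x - c))"
    using v by (simp add: mult.commute)
  also have "\<dots> \<le> (\<integral>\<^sup>+x. ennreal (norm (indicator ?B x *\<^sub>R (b x - c))) \<partial>dunkl)"
    unfolding set_lebesgue_integral_def by (rule integral_norm_bound_ennreal[OF int])
  also have "\<dots> = (\<integral>\<^sup>+x. ennreal (cmod (b x - c)) * ball_ind R x \<partial>dunkl)"
    by (intro nn_integral_cong) (auto split: split_indicator)
  also have "\<dots> = (\<integral>\<^sup>+x. ennreal (wt x) * (ennreal (cmod (b x - c)) * ball_ind R x) \<partial>PM)"
    using b(2) oball_sets_leb[of R]
    by (intro nn_integral_dunkl borel_measurable_times_ennreal borel_measurable_indicator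
        measurable_compose[OF _ measurable_ennreal] borel_measurable_norm borel_measurable_diff) auto
  finally show ?thesis .
qed

text \<open>Membership in \<open>cmo_space\<close> gives integrability on balls; \<open>b\<close> is
  the pointwise limit of its restrictions to growing balls.\<close>

lemma locally_integrable_measurable:
  fixes b :: "(nat \<Rightarrow> nat \<Rightarrow> real) \<Rightarrow> complex"
  assumes "\<And>R. 0 < R \<Longrightarrow> set_integrable dunkl (oball m d R) b"
  shows "b \<in> borel_measurable (leb m d)"
proof (rule borel_measurable_LIMSEQ_metric)
  fix n
  have "(\<lambda>x. indicator (oball m d (real (Suc n))) x *\<^sub>R b x) \<in> borel_measurable dunkl"
    using assms[of "real (Suc n)"] unfolding set_integrable_def by (intro borel_measurable_integrable) simp
  then show "(\<lambda>x. indicator (oball m d (real (Suc n))) x *\<^sub>R b x) \<in> borel_measurable (leb m d)"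
    by (simp add: measurable_cong_sets[OF sets_dunkl refl])
next
  fix x assume x: "x \<in> space (leb m d)"
  obtain n0 where n0: "rnorm x < real n0" using reals_Archimedean2 by blast
  have "\<forall>\<^sub>F n in sequentially. indicator (oball m d (real (Suc n))) x *\<^sub>R b x = b x"
    using eventually_ge_at_top[of n0]
  proof eventually_elim
    case (elim n)
    then have "x \<in> oball m d (real (Suc n))" using n0 x by (simp add: oball_eq space_leb)
    then show ?case by simp
  qed
  then show "(\<lambda>n. indicator (oball m d (real (Suc n))) x *\<^sub>R b x) \<longlonglongrightarrow> b x"
    by (rule tendsto_eventually)
qed

context
  fixes u w :: "nat \<Rightarrow> real"
  assumes uw: "\<And>i. i \<in> {1..m} \<Longrightarrow> 1 < u i" "\<And>i. i \<in> {1..m} \<Longrightarrow> 1 < w i"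
    and m: "1 \<le> m"
begin

lemma uw0: "i \<in> {1..m} \<Longrightarrow> 0 < u i" "i \<in> {1..m} \<Longrightarrow> 0 < w i"
  using uw[of i] by auto

lemma mnorm_ball_bnorm: "0 < R \<Longrightarrow> mnorm u w (ball_ind R) = ennreal (bnorm u w R)"
  unfolding bnorm_def by (rule mnorm_ball_eq[OF uw0 m])

lemma bnorm_pos: "0 < R \<Longrightarrow> 0 < bnorm u w R"
  using qnorm_pos[OF uw m] by (simp add: bnorm_def)

lemma vol_eq: "0 < R \<Longrightarrow> vol R = R powr total_hom_dim m d k * qnorm (\<lambda>_. 1) (\<lambda>_. 1)"
  unfolding vol_def by (rule measure_oball_eq[OF m])

lemma vol_pos: "0 < R \<Longrightarrow> 0 < vol R"
  using qnorm_one_pos[OF m] by (simp add: vol_eq)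

text \<open>The denominators are positive and finite, so the supremum of quotients becomes a family
  of inequalities without division, the form used in all estimates.\<close>

lemma morrey_norm_le_iff:
  "morrey_norm m d k u w l f \<le> C \<longleftrightarrow>
    (\<forall>R>0. mnorm u w (\<lambda>x. ennreal (cmod (f x)) * ball_ind R x) \<le> C * ennreal (vol R powr l * bnorm u w R))"
proof -
  have "mixed_norm m d k u w (\<lambda>x. f x * indicator (oball m d R) x) /
        (ennreal (measure dunkl (oball m d R) powr l) * mixed_norm m d k u w (indicator (oball m d R))) \<le> C \<longleftrightarrow>
     mnorm u w (\<lambda>x. ennreal (cmod (f x)) * ball_ind R x) \<le> C * ennreal (vol R powr l * bnorm u w R)"
    if "0 < R" for R
    unfolding mixed_norm_ball mixed_norm_ball_ind mnorm_ball_bnorm[OF that] vol_def[symmetric]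
    using that bnorm_pos[OF that] vol_pos[OF that]
    by (subst ennreal_mult[symmetric], simp, simp, subst ennreal_divide_le_iff) auto
  then show ?thesis
    unfolding morrey_norm_def by (auto simp: SUP_le_iff)
qed

lemma cmo_norm_le_iff:
  "cmo_norm m d k u w b \<le> C \<longleftrightarrow>
    (\<forall>R>0. mnorm u w (\<lambda>x. ennreal (cmod (b x - ball_mean m d k b R)) * ball_ind R x) \<le> C * ennreal (bnorm u w R))"
proof -
  have "mixed_norm m d k u w (\<lambda>x. (b x - ball_mean m d k b R) * indicator (oball m d R) x) /
        mixed_norm m d k u w (indicator (oball m d R)) \<le> C \<longleftrightarrow>
     mnorm u w (\<lambda>x. ennreal (cmod (b x - ball_mean m d k b R)) * ball_ind R x) \<le> C * ennreal (bnorm u w R)"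
    if "0 < R" for R
    unfolding mixed_norm_ball mixed_norm_ball_ind mnorm_ball_bnorm[OF that]
    using bnorm_pos[OF that] by (subst ennreal_divide_le_iff) auto
  then show ?thesis
    unfolding cmo_norm_def by (auto simp: SUP_le_iff)
qed

text \<open>The factor \<open>t powr - hdim u\<close> of the dilation cancels the factor
  \<open>t powr hdim u\<close> of the ball norm; what remains is \<open>vol (t * R) powr l\<close>,
  which contributes \<open>t powr (total_hom_dim m d k * l)\<close>.\<close>

lemma morrey_dilate:
  assumes f[measurable]: "f \<in> borel_measurable PM"
    and bd: "\<And>R. 0 < R \<Longrightarrow> mnorm u w (\<lambda>x. ennreal (cmod (f x)) * ball_ind R x) \<le> C * ennreal (vol R powr l * bnorm u w R)"
    and t: "0 < t" and R: "0 < R"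
  shows "mnorm u w (\<lambda>x. ennreal (cmod (f (dil m d t x))) * ball_ind R x) \<le>
    ennreal (t powr (total_hom_dim m d k * l)) * (C * ennreal (vol R powr l * bnorm u w R))"
proof -
  have "mnorm u w (\<lambda>x. ennreal (cmod (f (dil m d t x))) * ball_ind R x) =
     ennreal (t powr - hdim u) * mnorm u w (\<lambda>x. ennreal (cmod (f x)) * ball_ind (t * R) x)"
    using t R by (intro mnorm_dilate[OF uw0, where F="\<lambda>x. ennreal (cmod (f x))"]) auto
  also have "\<dots> \<le> ennreal (t powr - hdim u) * (C * ennreal (vol (t * R) powr l * bnorm u w (t * R)))"
    using t R by (intro mult_left_mono bd) auto
  also have "\<dots> = C * ennreal (t powr - hdim u * (vol (t * R) powr l * bnorm u w (t * R)))"
    by (subst ennreal_mult) (auto simp: ac_simps)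
  also have "t powr - hdim u * (vol (t * R) powr l * bnorm u w (t * R)) =
      (t powr - hdim u * t powr hdim u) * t powr (total_hom_dim m d k * l) * (vol R powr l * bnorm u w R)"
    using t R by (simp add: vol_eq bnorm_def powr_mult powr_powr)
  also have "t powr - hdim u * t powr hdim u = 1"
    using t by (simp add: powr_add[symmetric])
  also have "C * ennreal (1 * t powr (total_hom_dim m d k * l) * (vol R powr l * bnorm u w R)) =
    ennreal (t powr (total_hom_dim m d k * l)) * (C * ennreal (vol R powr l * bnorm u w R))"
    by (simp add: ennreal_mult ac_simps)
  finally show ?thesis .
qed

section \<open>Means over shrinking balls and oscillation under dilation\<close>

context
  fixes b b' :: "(nat \<Rightarrow> nat \<Rightarrow> real) \<Rightarrow> complex" and K :: real
  assumes int: "\<And>R. 0 < R \<Longrightarrow> set_integrable dunkl (oball m d R) b"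
    and b'[measurable]: "b' \<in> borel_measurable PM" and eq: "AE x in PM. b x = b' x"
    and K: "0 \<le> K"
    and osc: "\<And>R. 0 < R \<Longrightarrow> mnorm u w (\<lambda>x. ennreal (cmod (b' x - ball_mean m d k b R)) * ball_ind R x)
        \<le> ennreal K * ennreal (bnorm u w R)"
begin

text \<open>Bounds the change of the mean when the radius shrinks by at most one half. Duality gives
  \<open>K\<close> times two unit-ball norms, the denominator is the volume of the unit ball, and
  the power of 2 is the doubling constant of the measure.\<close>

definition step_const :: real where
  "step_const = 2 powr total_hom_dim m d k * K * qnorm u w * qnorm (conj_exp u) (conj_exp w) / qnorm (\<lambda>_. 1) (\<lambda>_. 1)"

lemma step_const_nonneg: "0 \<le> step_const"
  using K by (simp add: step_const_def)

text \<open>The two means differ by at most the average, over the small ball, of the distance of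
  \<open>b\<close> to its mean over the large ball. The integral may be enlarged to the large ball
  and estimated by duality, since the two volumes are comparable.\<close>

lemma ball_mean_step:
  assumes s: "1 / 2 \<le> s" "s \<le> 1" and R: "0 < R"
  shows "cmod (ball_mean m d k b (s * R) - ball_mean m d k b R) \<le> step_const"
proof -
  let ?N = "total_hom_dim m d k" and ?c = "ball_mean m d k b R"
  let ?x = "cmod (ball_mean m d k b (s * R) - ball_mean m d k b R)"
  have sR: "0 < s * R" using s R by simp
  have bm: "b \<in> borel_measurable (leb m d)" by (rule locally_integrable_measurable[OF int])
  have "ennreal (?x * vol (s * R)) \<le>
    (\<integral>\<^sup>+x. ennreal (wt x) * (ennreal (cmod (b x - ?c)) * ball_ind (s * R) x) \<partial>PM)"
    by (rule ball_mean_deviation[OF m sR int[OF sR] bm])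
  also have "\<dots> \<le> (\<integral>\<^sup>+x. ennreal (wt x) * (ennreal (cmod (b' x - ?c)) * ball_ind R x) \<partial>PM)"
  proof (intro nn_integral_mono_AE)
    show "AE x in PM. ennreal (wt x) * (ennreal (cmod (b x - ?c)) * ball_ind (s * R) x) \<le>
       ennreal (wt x) * (ennreal (cmod (b' x - ?c)) * ball_ind R x)"
      using eq
    proof eventually_elim
      case (elim x)
      have "s * R \<le> R" using s R by simp
      then have "oball m d (s * R) \<subseteq> oball m d R" by (auto simp: oball_eq)
      then show ?case using elim by (auto split: split_indicator)
    qed
  qed
  also have "\<dots> \<le> mnorm u w (\<lambda>x. ennreal (cmod (b' x - ?c)) * ball_ind R x) *
      ennreal (R powr hdim (conj_exp u) * qnorm (conj_exp u) (conj_exp w))"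
    by (intro nn_integral_le_mnorm_ball[OF uw m R]) measurable
  also have "\<dots> \<le> ennreal K * ennreal (bnorm u w R) * ennreal (R powr hdim (conj_exp u) * qnorm (conj_exp u) (conj_exp w))"
    by (intro mult_right_mono osc R) auto
  also have "\<dots> = ennreal (K * qnorm u w * qnorm (conj_exp u) (conj_exp w) * (R powr hdim u * R powr hdim (conj_exp u)))"
    using K by (simp add: ennreal_mult[symmetric] bnorm_def ac_simps)
  also have "R powr hdim u * R powr hdim (conj_exp u) = R powr ?N"
  proof -
    have "hdim u + hdim (conj_exp u) = ?N" by (rule hdim_conj[OF uw])
    then show ?thesis by (simp add: powr_add[symmetric])
  qed
  finally have le: "?x * vol (s * R) \<le> K * qnorm u w * qnorm (conj_exp u) (conj_exp w) * R powr ?N"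
    using K by (simp add: ennreal_le_iff)
  \<comment> \<open>Doubling: \<open>vol R\<close> is at most \<open>2 powr ?N\<close> times
    \<open>vol (s * R)\<close>.\<close>
  have "1 \<le> (2 * s) powr ?N" using s total_hom_dim_nonneg by (intro ge_one_powr_ge_zero) auto
  then have one: "1 \<le> 2 powr ?N * s powr ?N" using s by (simp add: powr_mult)
  have "?x * vol R \<le> ?x * vol R * (2 powr ?N * s powr ?N)"
    using mult_left_mono[OF one, of "?x * vol R"] vol_pos[OF R] by simp
  also have "\<dots> = 2 powr ?N * (?x * vol (s * R))"
    using s R by (simp add: vol_eq powr_mult)
  also have "\<dots> \<le> 2 powr ?N * (K * qnorm u w * qnorm (conj_exp u) (conj_exp w) * R powr ?N)"
    by (intro mult_left_mono le) auto
  also have "\<dots> = step_const * vol R"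
    using qnorm_one_pos[OF m] R by (simp add: vol_eq step_const_def)
  finally show ?thesis using vol_pos[OF R] by simp
qed

text \<open>For \<open>t < 1 / 2\<close> the radius \<open>t * R\<close> is \<open>2 * t\<close>
  times \<open>R / 2\<close>, so the induction hypothesis applies to the half ball and the last
  halving costs one more step. Hence \<open>t\<close> and \<open>R\<close> are generalised.\<close>

lemma ball_mean_telescope:
  assumes "(1 / 2) ^ n \<le> t" "t \<le> 1" "0 < R"
  shows "cmod (ball_mean m d k b (t * R) - ball_mean m d k b R) \<le> real n * step_const"
  using assms
proof (induction n arbitrary: t R)
  case 0
  then have "t = 1" by simp
  then show ?case by simp
next
  case (Suc n)
  show ?case
  proof (cases "1 / 2 \<le> t")
    case True
    have "cmod (ball_mean m d k b (t * R) - ball_mean m d k b R) \<le> 1 * step_const"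
      using ball_mean_step[OF True] Suc.prems by simp
    also have "\<dots> \<le> real (Suc n) * step_const" using step_const_nonneg by (intro mult_right_mono) auto
    finally show ?thesis .
  next
    case False
    have 1: "cmod (ball_mean m d k b ((2 * t) * (1 / 2 * R)) - ball_mean m d k b (1 / 2 * R)) \<le> real n * step_const"
      using Suc.prems False by (intro Suc.IH) auto
    have 2: "cmod (ball_mean m d k b (1 / 2 * R) - ball_mean m d k b R) \<le> step_const"
      using Suc.prems by (intro ball_mean_step) auto
    have "cmod (ball_mean m d k b (t * R) - ball_mean m d k b R) \<le>
      cmod (ball_mean m d k b (t * R) - ball_mean m d k b (1 / 2 * R)) +
      cmod (ball_mean m d k b (1 / 2 * R) - ball_mean m d k b R)"
      using norm_triangle_ineq[of "ball_mean m d k b (t * R) - ball_mean m d k b (1 / 2 * R)"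
          "ball_mean m d k b (1 / 2 * R) - ball_mean m d k b R"] by simp
    then show ?thesis using 1 2 by (simp add: algebra_simps)
  qed
qed

lemma ball_mean_log:
  assumes t: "0 < t" "t \<le> 1" and R: "0 < R"
  shows "cmod (ball_mean m d k b (t * R) - ball_mean m d k b R) \<le> (1 + 2 * ln (1 / t)) * step_const"
proof -
  \<comment> \<open>The number of halvings that lead from \<open>1\<close> to at most
    \<open>t\<close>; rounding up accounts for the summand 1 in the bound.\<close>
  define n where "n = nat \<lceil>log 2 (1 / t)\<rceil>"
  have l0: "0 \<le> log 2 (1 / t)" using t by simp
  have "real n = of_int \<lceil>log 2 (1 / t)\<rceil>" using l0 by (simp add: n_def)
  then have n1: "log 2 (1 / t) \<le> real n" and n2: "real n \<le> 1 + log 2 (1 / t)" by linarith+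
  have "1 / t \<le> 2 powr real n" using t n1 by (subst (asm) log_le_iff) auto
  then have "(1 / 2) ^ n \<le> t" using t by (simp add: powr_realpow field_simps)
  then have "cmod (ball_mean m d k b (t * R) - ball_mean m d k b R) \<le> real n * step_const"
    using t R by (intro ball_mean_telescope)
  also have "\<dots> \<le> (1 + 2 * ln (1 / t)) * step_const"
  proof (intro mult_right_mono step_const_nonneg)
    have "0 \<le> ln (1 / t)" using t by simp
    \<comment> \<open>The factor 2 stands in for \<open>1 / ln 2\<close>.\<close>
    moreover have "1 \<le> 2 * ln (2::real)" using ln2_ge_two_thirds by simp
    ultimately have "ln (1 / t) * 1 \<le> ln (1 / t) * (2 * ln 2)" by (intro mult_left_mono)
    then have "log 2 (1 / t) \<le> 2 * ln (1 / t)" by (simp add: log_def field_simps)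
    with n2 show "real n \<le> 1 + 2 * ln (1 / t)" by simp
  qed
  finally show ?thesis .
qed

text \<open>Insert the means over the balls of radius \<open>R\<close> and \<open>t * R\<close>. The
  distance of \<open>b'\<close> at the dilated point to the second mean is, after substitution, an
  oscillation over the ball of radius \<open>t * R\<close>; the difference of the means is bounded
  by \<open>ball_mean_log\<close>.\<close>

lemma oscillation_dilate:
  assumes t: "0 < t" "t \<le> 1" and R: "0 < R"
  shows "mnorm u w (\<lambda>x. ennreal (cmod (b' x - b' (dil m d t x))) * ball_ind R x) \<le>
    ennreal ((2 * K + (1 + 2 * ln (1 / t)) * step_const) * bnorm u w R)"
proof -
  let ?c = "ball_mean m d k b"
  let ?F = "\<lambda>x. ennreal (cmod (b' x - ?c R)) * ball_ind R x"
  let ?G = "\<lambda>x. ennreal (cmod (b' (dil m d t x) - ?c (t * R))) * ball_ind R x"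
  let ?H = "\<lambda>x. ennreal (cmod (?c (t * R) - ?c R)) * ball_ind R x"
  have ln0: "0 \<le> ln (1 / t)" using t by simp
  have "mnorm u w (\<lambda>x. ennreal (cmod (b' x - b' (dil m d t x))) * ball_ind R x) \<le>
    mnorm u w (\<lambda>x. ?F x + (?G x + ?H x))"
  proof (intro mnorm_mono uw0)
    fix x
    have "cmod (b' x - b' (dil m d t x)) \<le> cmod (b' x - ?c R) + (cmod (b' (dil m d t x) - ?c (t * R)) + cmod (?c (t * R) - ?c R))"
      by (smt (verit) norm_triangle_ineq4 norm_triangle_ineq diff_add_cancel diff_diff_eq2 norm_minus_commute add_diff_eq)
    then show "ennreal (cmod (b' x - b' (dil m d t x))) * ball_ind R x \<le> ?F x + (?G x + ?H x)"
      by (auto simp: ennreal_plus[symmetric] simp del: ennreal_plus split: split_indicator intro!: ennreal_leI)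
  qed
  also have "\<dots> \<le> mnorm u w ?F + mnorm u w (\<lambda>x. ?G x + ?H x)"
    by (intro mnorm_add_le uw) measurable
  also have "\<dots> \<le> mnorm u w ?F + (mnorm u w ?G + mnorm u w ?H)"
    by (intro add_left_mono mnorm_add_le uw) measurable
  also have "mnorm u w ?F \<le> ennreal (K * bnorm u w R)"
    using osc[OF R] K by (simp add: ennreal_mult)
  also have "mnorm u w ?G \<le> ennreal (K * bnorm u w R)"
  proof -
    have "mnorm u w ?G = ennreal (t powr - hdim u) * mnorm u w (\<lambda>x. ennreal (cmod (b' x - ?c (t * R))) * ball_ind (t * R) x)"
      using t R by (intro mnorm_dilate[OF uw0, where F="\<lambda>x. ennreal (cmod (b' x - ?c (t * R)))"]) auto
    also have "\<dots> \<le> ennreal (t powr - hdim u) * (ennreal K * ennreal (bnorm u w (t * R)))"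
      using t R by (intro mult_left_mono osc) auto
    also have "\<dots> = ennreal (t powr - hdim u * (K * bnorm u w (t * R)))"
      using K by (simp add: ennreal_mult)
    also have "t powr - hdim u * (K * bnorm u w (t * R)) = K * bnorm u w R"
      using t R by (simp add: bnorm_def powr_mult powr_minus field_simps)
    finally show ?thesis .
  qed
  also have "mnorm u w ?H \<le> ennreal ((1 + 2 * ln (1 / t)) * step_const * bnorm u w R)"
  proof -
    have "mnorm u w ?H = ennreal (cmod (?c (t * R) - ?c R)) * mnorm u w (ball_ind R)"
      by (intro mnorm_cmult uw0) measurable
    also have "\<dots> = ennreal (cmod (?c (t * R) - ?c R) * bnorm u w R)"
      by (simp add: mnorm_ball_bnorm[OF R] ennreal_mult)
    also have "\<dots> \<le> ennreal ((1 + 2 * ln (1 / t)) * step_const * bnorm u w R)"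
      by (intro ennreal_leI mult_right_mono ball_mean_log t R) auto
    finally show ?thesis .
  qed
  also have "ennreal (K * bnorm u w R) + (ennreal (K * bnorm u w R) + ennreal ((1 + 2 * ln (1 / t)) * step_const * bnorm u w R)) =
    ennreal ((2 * K + (1 + 2 * ln (1 / t)) * step_const) * bnorm u w R)"
    using K ln0 step_const_nonneg
    by (simp add: ennreal_plus[symmetric] algebra_simps del: ennreal_plus)
  finally show ?thesis by (simp add: add_mono)
qed

end

end

end

section \<open>The logarithm and the powers of the radius\<close>

context dunkl_blocks
begin

context
  fixes u w :: "nat \<Rightarrow> real"
  assumes uw: "\<And>i. i \<in> {1..m} \<Longrightarrow> 1 < u i" "\<And>i. i \<in> {1..m} \<Longrightarrow> 1 < w i"
    and m: "1 \<le> m"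
begin

lemma uw_pos: "i \<in> {1..m} \<Longrightarrow> 0 < u i" "i \<in> {1..m} \<Longrightarrow> 0 < w i"
  using uw[of i] by auto

text \<open>By homogeneity, rescaling to the unit ball makes the Morrey quotient independent of
  \<open>R\<close>; the lower bound on the exponent ensures finiteness on the unit ball.\<close>

lemma powr_in_morrey_space:
  assumes l: "- hdim u < total_hom_dim m d k * l"
  shows "(\<lambda>x. complex_of_real (rnorm x powr (total_hom_dim m d k * l))) \<in> morrey_space m d k u w l"
proof -
  let ?a = "total_hom_dim m d k * l"
  define P where "P = mnorm u w (\<lambda>x. ennreal (rnorm x powr ?a) * ball_ind 1 x)"
  have P: "P < \<infinity>" unfolding P_def using l by (intro mnorm_powr_finite[OF uw_pos _ m]) auto
  define p where "p = enn2real P"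
  have Pp: "P = ennreal p" "0 \<le> p" using P by (auto simp: p_def)
  let ?V = "qnorm (\<lambda>_. 1) (\<lambda>_. 1)"
  have V: "0 < ?V" by (rule qnorm_one_pos[OF m])
  have Q: "0 < qnorm u w" by (rule qnorm_pos[OF uw m])
  define C where "C = p / (?V powr l * qnorm u w)"
  have C: "0 \<le> C" using V Q Pp by (simp add: C_def)
  have "morrey_norm m d k u w l (\<lambda>x. complex_of_real (rnorm x powr ?a)) \<le> ennreal C"
  proof (rule morrey_norm_le_iff[THEN iffD2, OF uw m], assumption, assumption, intro allI impI)
    fix R :: real assume R: "0 < R"
    have vR: "vol R = R powr total_hom_dim m d k * ?V" by (rule vol_eq[OF uw m R])
    have "mnorm u w (\<lambda>x. ennreal (cmod (complex_of_real (rnorm x powr ?a))) * ball_ind R x) =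
      mnorm u w (\<lambda>x. (ennreal (R powr ?a) * ennreal (rnorm (dil m d (1 / R) x) powr ?a)) * ball_ind R x)"
      using R by (intro mnorm_cong) (simp add: rnorm_dil powr_divide ennreal_mult[symmetric])
    also have "\<dots> = ennreal ((1 / R) powr - hdim u) *
       mnorm u w (\<lambda>x. (ennreal (R powr ?a) * ennreal (rnorm x powr ?a)) * ball_ind (1 / R * R) x)"
      using R by (intro mnorm_dilate[OF uw_pos, where F="\<lambda>x. ennreal (R powr ?a) * ennreal (rnorm x powr ?a)"]) auto
    also have "mnorm u w (\<lambda>x. (ennreal (R powr ?a) * ennreal (rnorm x powr ?a)) * ball_ind (1 / R * R) x) =
       ennreal (R powr ?a) * P"
      unfolding P_def using R
      by (subst mnorm_cmult[OF uw_pos, symmetric]) (auto simp: mult.assoc)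
    also have "ennreal ((1 / R) powr - hdim u) * (ennreal (R powr ?a) * P) = ennreal (R powr hdim u * (R powr ?a * p))"
      using R Pp by (simp add: powr_divide powr_minus_divide ennreal_mult)
    also have "R powr hdim u * (R powr ?a * p) = C * (vol R powr l * bnorm u w R)"
      using R V Q by (simp add: C_def vR bnorm_def powr_mult powr_powr)
    also have "ennreal \<dots> = ennreal C * ennreal (vol R powr l * bnorm u w R)"
      using C by (intro ennreal_mult) auto
    finally show "mnorm u w (\<lambda>x. ennreal (cmod (complex_of_real (rnorm x powr ?a))) * ball_ind R x) \<le>
       ennreal C * ennreal (vol R powr l * bnorm u w R)" by simp
  qed
  then have "morrey_norm m d k u w l (\<lambda>x. complex_of_real (rnorm x powr ?a)) < \<infinity>"
    by (rule order_le_less_trans) simp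
  moreover have "(\<lambda>x. complex_of_real (rnorm x powr ?a)) \<in> borel_measurable (leb m d)"
    unfolding leb_eq by (rule measurable_completion) measurable
  ultimately show ?thesis by (simp add: morrey_space_def)
qed

lemma mnorm_ln_finite: "mnorm u w (\<lambda>x. ennreal \<bar>ln (rnorm x)\<bar> * ball_ind 1 x) < \<infinity>"
proof -
  \<comment> \<open>On the unit ball any negative power of the radius dominates the logarithm up to
    a constant. Half of the critical exponent is taken, so that \<open>- e\<close> is admissible in
    \<open>mnorm_powr_finite\<close>.\<close>
  define e where "e = hdim u / 2"
  have e: "0 < e" using hdim_pos[OF m uw_pos(1)] by (simp add: e_def)
  have "mnorm u w (\<lambda>x. ennreal \<bar>ln (rnorm x)\<bar> * ball_ind 1 x) \<le>
    mnorm u w (\<lambda>x. ennreal (1 / e) * (ennreal (rnorm x powr - e) * ball_ind 1 x))"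
  proof (rule mnorm_mono_AE[OF uw_pos])
    show "AE x in PM. ennreal \<bar>ln (rnorm x)\<bar> * ball_ind 1 x \<le> ennreal (1 / e) * (ennreal (rnorm x powr - e) * ball_ind 1 x)"
      using AE_rnorm_pos[OF m]
    proof eventually_elim
      case (elim x)
      show ?case
      proof (cases "x \<in> oball m d 1")
        case True
        then have r: "rnorm x < 1" by (simp add: oball_eq)
        have "- e * ln (rnorm x) = ln (rnorm x powr - e)" using elim by (simp add: ln_powr)
        also have "\<dots> \<le> rnorm x powr - e" using elim by (intro order_trans[OF ln_le_minus_one]) auto
        finally have "\<bar>ln (rnorm x)\<bar> \<le> 1 / e * rnorm x powr - e"
          using e r elim by (simp add: field_simps)
        then have "ennreal \<bar>ln (rnorm x)\<bar> \<le> ennreal (1 / e) * ennreal (rnorm x powr - e)"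
          using e by (subst ennreal_mult[symmetric]) (auto intro!: ennreal_leI)
        then show ?thesis using True by simp
      qed simp
    qed
  qed
  also have "\<dots> = ennreal (1 / e) * mnorm u w (\<lambda>x. ennreal (rnorm x powr - e) * ball_ind 1 x)"
    by (rule mnorm_cmult[OF uw_pos]) measurable
  also have "\<dots> < top"
    using mnorm_powr_finite[OF uw_pos _ m, where a="- e"] e
    by (simp add: ennreal_mult_less_top e_def)
  finally show ?thesis by simp
qed

text \<open>The difference \<open>ln (rnorm x) - ln R\<close> is the logarithm of the rescaled
  radius, so the ball of radius \<open>R\<close> is reduced to the unit ball with
  \<open>c - ln R\<close> in place of \<open>c\<close>.\<close>

lemma mnorm_ln_ball:
  assumes R: "0 < R"
  shows "mnorm u w (\<lambda>x. ennreal (cmod (complex_of_real (ln (rnorm x)) - c)) * ball_ind R x) \<le>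
    ennreal (R powr hdim u) * (mnorm u w (\<lambda>x. ennreal \<bar>ln (rnorm x)\<bar> * ball_ind 1 x) +
      ennreal (cmod (c - complex_of_real (ln R)) * qnorm u w))"
proof -
  let ?c = "cmod (c - complex_of_real (ln R))"
  let ?F = "\<lambda>x. ennreal \<bar>ln (rnorm x)\<bar> + ennreal ?c"
  have "mnorm u w (\<lambda>x. ennreal (cmod (complex_of_real (ln (rnorm x)) - c)) * ball_ind R x) \<le>
     mnorm u w (\<lambda>x. ?F (dil m d (1 / R) x) * ball_ind R x)"
  proof (rule mnorm_mono_AE[OF uw_pos])
    show "AE x in PM. ennreal (cmod (complex_of_real (ln (rnorm x)) - c)) * ball_ind R x \<le>
       ?F (dil m d (1 / R) x) * ball_ind R x"
      using AE_rnorm_pos[OF m]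
    proof eventually_elim
      case (elim x)
      have "ln (rnorm (dil m d (1 / R) x)) = ln (rnorm x) - ln R"
        using R elim by (simp add: rnorm_dil ln_div)
      moreover have "cmod (complex_of_real (ln (rnorm x)) - c) \<le>
          cmod (complex_of_real (ln (rnorm x) - ln R)) + cmod (complex_of_real (ln R) - c)"
        using norm_triangle_ineq[of "complex_of_real (ln (rnorm x) - ln R)" "complex_of_real (ln R) - c"] by simp
      ultimately have "cmod (complex_of_real (ln (rnorm x)) - c) \<le> \<bar>ln (rnorm (dil m d (1 / R) x))\<bar> + ?c"
        by (simp only: norm_of_real norm_minus_commute[of c])
      then have "ennreal (cmod (complex_of_real (ln (rnorm x)) - c)) \<le> ?F (dil m d (1 / R) x)"
        by (simp add: ennreal_plus[symmetric] ennreal_leI del: ennreal_plus)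
      then show ?case by (rule mult_right_mono) simp
    qed
  qed
  also have "\<dots> = ennreal ((1 / R) powr - hdim u) * mnorm u w (\<lambda>x. ?F x * ball_ind (1 / R * R) x)"
    using R by (intro mnorm_dilate[OF uw_pos, where F="?F"]) auto
  also have "mnorm u w (\<lambda>x. ?F x * ball_ind (1 / R * R) x) =
     mnorm u w (\<lambda>x. ennreal \<bar>ln (rnorm x)\<bar> * ball_ind 1 x + ennreal ?c * ball_ind 1 x)"
    using R by (simp add: distrib_right)
  also have "\<dots> \<le> mnorm u w (\<lambda>x. ennreal \<bar>ln (rnorm x)\<bar> * ball_ind 1 x) + mnorm u w (\<lambda>x. ennreal ?c * ball_ind 1 x)"
    by (intro mnorm_add_le[OF uw]) measurable
  also have "mnorm u w (\<lambda>x. ennreal ?c * ball_ind 1 x) = ennreal ?c * mnorm u w (ball_ind 1)"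
    by (rule mnorm_cmult[OF uw_pos]) measurable
  also have "mnorm u w (ball_ind 1) = ennreal (qnorm u w)"
    using mnorm_ball_eq[OF uw_pos m, where R=1] by simp
  also have "ennreal ((1 / R) powr - hdim u) = ennreal (R powr hdim u)"
    using R by (simp add: powr_divide powr_minus_divide)
  finally show ?thesis by (simp add: ennreal_mult mult_left_mono)
qed

text \<open>The mean over the ball of radius \<open>R\<close> stays within a fixed distance
  \<open>A\<close> of \<open>ln R\<close>, and subtracting \<open>ln R\<close> makes the logarithm
  scale invariant. All bounds are thus uniform in \<open>R\<close>.\<close>

lemma ln_in_cmo_space: "(\<lambda>x. complex_of_real (ln (rnorm x))) \<in> cmo_space m d k u w"
proof -
  let ?b = "\<lambda>x. complex_of_real (ln (rnorm x))"
  let ?N = "total_hom_dim m d k" and ?V = "qnorm (\<lambda>_. 1) (\<lambda>_. 1)" and ?Q' = "qnorm (conj_exp u) (conj_exp w)"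
  define L where "L = enn2real (mnorm u w (\<lambda>x. ennreal \<bar>ln (rnorm x)\<bar> * ball_ind 1 x))"
  have L: "mnorm u w (\<lambda>x. ennreal \<bar>ln (rnorm x)\<bar> * ball_ind 1 x) = ennreal L" "0 \<le> L"
    using mnorm_ln_finite by (auto simp: L_def)
  have V: "0 < ?V" by (rule qnorm_one_pos[OF m])
  have Q: "0 < qnorm u w" by (rule qnorm_pos[OF uw m])
  have bb: "?b \<in> borel_measurable PM" by measurable
  have bl: "?b \<in> borel_measurable (leb m d)"
    unfolding leb_eq by (rule measurable_completion[OF bb])
  \<comment> \<open>Stated for all \<open>c\<close> because it is used twice: \<open>c = 0\<close>
    gives integrability, \<open>c = ln R\<close> the bound for the mean.\<close>
  have dev: "(\<integral>\<^sup>+x. ennreal (wt x) * (ennreal (cmod (?b x - c)) * ball_ind R x) \<partial>PM) \<le>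
     ennreal (R powr ?N * ((L + cmod (c - complex_of_real (ln R)) * qnorm u w) * ?Q'))" if R: "0 < R" for R c
  proof -
    have "(\<integral>\<^sup>+x. ennreal (wt x) * (ennreal (cmod (?b x - c)) * ball_ind R x) \<partial>PM) \<le>
      mnorm u w (\<lambda>x. ennreal (cmod (?b x - c)) * ball_ind R x) * ennreal (R powr hdim (conj_exp u) * ?Q')"
      by (intro nn_integral_le_mnorm_ball[OF uw m R]) measurable
    also have "\<dots> \<le> (ennreal (R powr hdim u) * (ennreal L + ennreal (cmod (c - complex_of_real (ln R)) * qnorm u w))) *
        ennreal (R powr hdim (conj_exp u) * ?Q')"
      unfolding L(1)[symmetric] by (intro mult_right_mono mnorm_ln_ball R) auto
    also have "\<dots> = ennreal ((R powr hdim u * R powr hdim (conj_exp u)) *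
        ((L + cmod (c - complex_of_real (ln R)) * qnorm u w) * ?Q'))"
      using L(2) by (simp add: ennreal_plus[symmetric] ennreal_mult[symmetric] ac_simps del: ennreal_plus)
    also have "R powr hdim u * R powr hdim (conj_exp u) = R powr ?N"
    proof -
      have "hdim u + hdim (conj_exp u) = ?N" by (rule hdim_conj[OF uw])
      then show ?thesis by (simp add: powr_add[symmetric])
    qed
    finally show ?thesis .
  qed
  have int: "set_integrable dunkl (oball m d R) ?b" if R: "0 < R" for R
    unfolding set_integrable_def
  proof (rule integrableI_bounded)
    have "?b \<in> borel_measurable dunkl" using bl by (simp add: measurable_cong_sets[OF sets_dunkl refl])
    moreover have "oball m d R \<in> sets dunkl" by (simp add: sets_dunkl)
    ultimately show "(\<lambda>x. indicator (oball m d R) x *\<^sub>R ?b x) \<in> borel_measurable dunkl"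
      by (intro borel_measurable_scaleR borel_measurable_indicator)
    have "(\<integral>\<^sup>+x. ennreal (norm (indicator (oball m d R) x *\<^sub>R ?b x)) \<partial>dunkl) =
      (\<integral>\<^sup>+x. ennreal (cmod (?b x - 0)) * ball_ind R x \<partial>dunkl)"
      by (intro nn_integral_cong) (auto split: split_indicator)
    also have "\<dots> = (\<integral>\<^sup>+x. ennreal (wt x) * (ennreal (cmod (?b x - 0)) * ball_ind R x) \<partial>PM)"
    proof (rule nn_integral_dunkl)
      show "(\<lambda>x. ennreal (cmod (?b x - 0)) * ball_ind R x) \<in> borel_measurable (leb m d)"
        unfolding leb_eq by (rule measurable_completion) measurable
    qed
    also have "\<dots> < \<infinity>" by (rule order_le_less_trans[OF dev[OF R]]) simp
    finally show "(\<integral>\<^sup>+x. ennreal (norm (indicator (oball m d R) x *\<^sub>R ?b x)) \<partial>dunkl) < \<infinity>" .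
  qed
  \<comment> \<open>For \<open>c = ln R\<close> only \<open>L\<close> survives in
    \<open>dev\<close>; dividing by the volume removes the power of \<open>R\<close>.\<close>
  define A where "A = L * ?Q' / ?V"
  have A0: "0 \<le> A" using L V by (simp add: A_def)
  have mean: "cmod (ball_mean m d k ?b R - complex_of_real (ln R)) \<le> A" if R: "0 < R" for R
  proof -
    have "ennreal (cmod (ball_mean m d k ?b R - complex_of_real (ln R)) * vol R) \<le>
      ennreal (R powr ?N * ((L + cmod (complex_of_real (ln R) - complex_of_real (ln R)) * qnorm u w) * ?Q'))"
      by (rule order_trans[OF ball_mean_deviation[OF m R int[OF R] bl] dev[OF R]])
    then have "cmod (ball_mean m d k ?b R - complex_of_real (ln R)) * vol R \<le> R powr ?N * (L * ?Q')"
      using L(2) by (simp add: ennreal_le_iff)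
    also have "\<dots> = A * vol R"
    proof -
      have "vol R = R powr ?N * ?V" by (rule vol_eq[OF uw m R])
      then show ?thesis using V by (simp add: A_def)
    qed
    finally have le: "cmod (ball_mean m d k ?b R - complex_of_real (ln R)) * vol R \<le> A * vol R" .
    have "0 < vol R" by (rule vol_pos[OF uw m R])
    with le show ?thesis by simp
  qed
  define C where "C = (L + A * qnorm u w) / qnorm u w"
  have C0: "0 \<le> C" using L A0 Q by (simp add: C_def)
  have "cmo_norm m d k u w ?b \<le> ennreal C"
  proof (rule cmo_norm_le_iff[THEN iffD2, OF uw m], assumption, assumption, intro allI impI)
    fix R :: real assume R: "0 < R"
    have "mnorm u w (\<lambda>x. ennreal (cmod (?b x - ball_mean m d k ?b R)) * ball_ind R x) \<le>
      ennreal (R powr hdim u) * (ennreal L + ennreal (cmod (ball_mean m d k ?b R - complex_of_real (ln R)) * qnorm u w))"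
      unfolding L(1)[symmetric] by (rule mnorm_ln_ball[OF R])
    also have "\<dots> \<le> ennreal (R powr hdim u) * (ennreal L + ennreal (A * qnorm u w))"
      by (intro mult_left_mono add_left_mono ennreal_leI mult_right_mono mean R) auto
    also have "\<dots> = ennreal (R powr hdim u * (L + A * qnorm u w))"
      using L A0 by (simp add: ennreal_plus[symmetric] ennreal_mult[symmetric] del: ennreal_plus)
    also have "R powr hdim u * (L + A * qnorm u w) = C * bnorm u w R"
      using Q by (simp add: C_def bnorm_def)
    also have "ennreal \<dots> = ennreal C * ennreal (bnorm u w R)" using C0 by (intro ennreal_mult) auto
    finally show "mnorm u w (\<lambda>x. ennreal (cmod (?b x - ball_mean m d k ?b R)) * ball_ind R x) \<le>
       ennreal C * ennreal (bnorm u w R)" .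
  qed
  then have "cmo_norm m d k u w ?b < \<infinity>" by (rule order_le_less_trans) simp
  with int show ?thesis by (simp add: cmo_space_def)
qed

end

text \<open>
  For \<open>f = rnorm powr (N l)\<close> and \<open>b = ln rnorm\<close> the mere existence of both integrals defining the
  commutator at one point \<open>x\<close> with \<open>rnorm x > 0\<close> forces the integrability of
  \<open>t powr (N l) * ln t * \<phi> t\<close>.
\<close>

lemma commutator_defined_imp_finite:
  fixes \<phi> :: "real \<Rightarrow> real" and a :: real
  assumes def: "commutator_defined m d \<phi> (\<lambda>x. complex_of_real (ln (rnorm x))) (\<lambda>x. complex_of_real (rnorm x powr a)) x"
    and x: "0 < rnorm x" and \<phi>: "\<And>t. t \<in> {0<..1} \<Longrightarrow> 0 \<le> \<phi> t"
  shows "(\<integral>\<^sup>+t\<in>{0<..1}. ennreal (t powr a * ln (1 / t) * \<phi> t) \<partial>lebesgue) < \<infinity>"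
proof -
  define \<rho> where "\<rho> = rnorm x"
  have \<rho>: "0 < \<rho>" using x by (simp add: \<rho>_def)
  have I1: "integrable lebesgue (\<lambda>t. indicator {0<..1} t *\<^sub>R (complex_of_real (rnorm (dil m d t x) powr a) * complex_of_real (\<phi> t)))"
    and I2: "integrable lebesgue (\<lambda>t. indicator {0<..1} t *\<^sub>R
       (complex_of_real (ln (rnorm (dil m d t x))) * complex_of_real (rnorm (dil m d t x) powr a) * complex_of_real (\<phi> t)))"
    using def unfolding commutator_defined_def hardy_defined_def set_integrable_def by auto
  \<comment> \<open>\<open>ln \<rho>\<close> times the first integrand minus the second isolates
    \<open>ln \<rho> - ln (t * \<rho>) = ln (1 / t)\<close>; the factor
    \<open>\<rho> powr - a\<close> removes the remaining power of \<open>\<rho>\<close>.\<close>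
  have "integrable lebesgue (\<lambda>t. of_real (\<rho> powr - a) *
      (complex_of_real (ln \<rho>) * (indicator {0<..1} t *\<^sub>R (complex_of_real (rnorm (dil m d t x) powr a) * complex_of_real (\<phi> t))) -
       indicator {0<..1} t *\<^sub>R
       (complex_of_real (ln (rnorm (dil m d t x))) * complex_of_real (rnorm (dil m d t x) powr a) * complex_of_real (\<phi> t))))"
    (is "integrable lebesgue ?g") using I1 I2 by (intro integrable_mult_right Bochner_Integration.integrable_diff)
  then have "(\<integral>\<^sup>+t. ennreal (norm (?g t)) \<partial>lebesgue) < \<infinity>"
    by (rule integrable_iff_bounded[THEN iffD1, THEN conjunct2])
  moreover have "ennreal (norm (?g t)) = ennreal (t powr a * ln (1 / t) * \<phi> t) * indicator {0<..1} t" for t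
  proof (cases "t \<in> {0<..1}")
    case True
    then have t: "0 < t" "t \<le> 1" by auto
    have r: "rnorm (dil m d t x) = t * \<rho>" using t by (simp add: rnorm_dil \<rho>_def)
    have "?g t = complex_of_real (\<rho> powr - a * (ln \<rho> * ((t * \<rho>) powr a * \<phi> t) - ln (t * \<rho>) * (t * \<rho>) powr a * \<phi> t))"
      using True by (simp add: r)
    also have "\<rho> powr - a * (ln \<rho> * ((t * \<rho>) powr a * \<phi> t) - ln (t * \<rho>) * (t * \<rho>) powr a * \<phi> t) =
       (\<rho> powr - a * \<rho> powr a) * (t powr a * (ln \<rho> - ln (t * \<rho>)) * \<phi> t)"
      using t \<rho> by (simp add: powr_mult algebra_simps)
    also have "\<rho> powr - a * \<rho> powr a = 1" using \<rho> by (simp add: powr_minus)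
    also have "ln \<rho> - ln (t * \<rho>) = ln (1 / t)" using t \<rho> by (simp add: ln_mult ln_div)
    finally have "?g t = complex_of_real (t powr a * ln (1 / t) * \<phi> t)" by simp
    moreover have "0 \<le> t powr a * ln (1 / t) * \<phi> t" using t \<phi>[OF True] by simp
    ultimately show ?thesis using True by (simp only: norm_of_real abs_of_nonneg) simp
  qed simp
  ultimately show ?thesis by simp
qed

end

section \<open>The weight function\<close>

text \<open>Integrability on compact sets makes the cut-offs to \<open>{1 / real (Suc n)..1}\<close>
  measurable, and their pointwise limit is \<open>\<phi>\<close> cut off to the half-open interval.
  The Borel version is clipped at 0 and vanishes outside, so later integrals range over all of
  \<open>lborel\<close>.\<close>

lemma weight_representative:
  fixes \<phi> :: "real \<Rightarrow> real"
  assumes nn: "\<And>t. t \<in> {0<..1} \<Longrightarrow> 0 \<le> \<phi> t"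
    and loc: "\<And>K. compact K \<Longrightarrow> K \<subseteq> {0<..1} \<Longrightarrow> set_integrable lebesgue K \<phi>"
  obtains \<psi> :: "real \<Rightarrow> real" where "\<psi> \<in> borel_measurable borel" "\<And>t. 0 \<le> \<psi> t"
    "\<And>t. t \<notin> {0<..1} \<Longrightarrow> \<psi> t = 0" "AE t in lborel. t \<in> {0<..1} \<longrightarrow> \<phi> t = \<psi> t"
proof -
  have pos: "0 < t" if "1 / real (Suc n) \<le> t" for n t
    by (rule less_le_trans[OF _ that]) simp
  have "(\<lambda>t. indicator {0<..1} t *\<^sub>R \<phi> t) \<in> borel_measurable lebesgue"
  proof (rule borel_measurable_LIMSEQ_metric)
    fix n
    have "set_integrable lebesgue {1 / real (Suc n)..1} \<phi>"
      using pos[of n] by (intro loc) auto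
    then show "(\<lambda>t. indicator {1 / real (Suc n)..1} t *\<^sub>R \<phi> t) \<in> borel_measurable lebesgue"
      unfolding set_integrable_def by (rule borel_measurable_integrable)
  next
    fix t :: real
    show "(\<lambda>n. indicator {1 / real (Suc n)..1} t *\<^sub>R \<phi> t) \<longlonglongrightarrow> indicator {0<..1} t *\<^sub>R \<phi> t"
    proof (cases "t \<in> {0<..1}")
      case True
      then obtain n0 where n0: "1 / real (Suc n0) < t" using nat_approx_posE[of t] by auto
      have "\<forall>\<^sub>F n in sequentially. indicator {1 / real (Suc n)..1} t *\<^sub>R \<phi> t = indicator {0<..1} t *\<^sub>R \<phi> t"
        using eventually_ge_at_top[of n0]
      proof eventually_elim
        case (elim n)
        then have "1 / real (Suc n) \<le> 1 / real (Suc n0)" by (intro divide_left_mono) auto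
        then show ?case using True n0 by auto
      qed
      then show ?thesis by (rule tendsto_eventually)
    next
      case False
      then have "indicator {1 / real (Suc n)..1} t = (0::real)" for n
        using pos[of n t] by (auto simp: indicator_def)
      then show ?thesis using False by simp
    qed
  qed
  then obtain \<psi> where \<psi>: "\<psi> \<in> borel_measurable lborel" "AE t in lborel. indicator {0<..1} t *\<^sub>R \<phi> t = \<psi> t"
    using completion_ex_borel_measurable_real[of _ lborel] by blast
  show ?thesis
  proof
    show "(\<lambda>t. indicator {0<..1} t * max 0 (\<psi> t)) \<in> borel_measurable borel" using \<psi>(1) by simp
    show "AE t in lborel. t \<in> {0<..1} \<longrightarrow> \<phi> t = indicator {0<..1} t * max 0 (\<psi> t)"
      using \<psi>(2)
    proof eventually_elim
      case (elim t)
      then show ?case using nn[of t] by auto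
    qed
  qed auto
qed

text \<open>For \<open>t < 1 / 2\<close> the summand 1 is absorbed by the logarithm, which is at
  least \<open>ln 2\<close>. On \<open>{1/2..1}\<close>, where the logarithm may vanish, the factors
  beside \<open>\<psi>\<close> are bounded and local integrability applies.\<close>

lemma weight_integral_finite:
  fixes \<phi> \<psi> :: "real \<Rightarrow> real"
  assumes \<psi>: "\<psi> \<in> borel_measurable borel" "\<And>t. 0 \<le> \<psi> t" "\<And>t. t \<notin> {0<..1} \<Longrightarrow> \<psi> t = 0"
    and ae: "AE t in lborel. t \<in> {0<..1} \<longrightarrow> \<phi> t = \<psi> t"
    and loc: "set_integrable lebesgue {1/2..1} \<phi>"
    and fin: "(\<integral>\<^sup>+t\<in>{0<..1}. ennreal (t powr a * ln (1 / t) * \<phi> t) \<partial>lebesgue) < \<infinity>"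
  shows "(\<integral>\<^sup>+t. ennreal (\<psi> t * (t powr a * (1 + 2 * ln (1 / t)))) \<partial>lborel) < \<infinity>"
proof -
  note \<psi>(1)[measurable]
  have 1: "(\<integral>\<^sup>+t. ennreal (t powr a * ln (1 / t) * \<psi> t) \<partial>lborel) < \<infinity>"
  proof -
    have "(\<integral>\<^sup>+t. ennreal (t powr a * ln (1 / t) * \<psi> t) \<partial>lborel) =
      (\<integral>\<^sup>+t\<in>{0<..1}. ennreal (t powr a * ln (1 / t) * \<phi> t) \<partial>lborel)"
      using ae by (intro nn_integral_cong_AE) (auto elim!: eventually_mono simp: \<psi>(3) split: split_indicator)
    then show ?thesis using fin by (simp add: nn_integral_completion)
  qed
  have 2: "(\<integral>\<^sup>+t. ennreal (\<psi> t) * indicator {1/2..1} t \<partial>lborel) < \<infinity>"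
  proof -
    have "(\<integral>\<^sup>+t. ennreal (\<psi> t) * indicator {1/2..1} t \<partial>lborel) =
      (\<integral>\<^sup>+t. ennreal (norm (indicator {1/2..1} t *\<^sub>R \<phi> t)) \<partial>lborel)"
      using ae \<psi>(2) by (intro nn_integral_cong_AE) (auto elim!: eventually_mono split: split_indicator)
    moreover have "(\<integral>\<^sup>+t. ennreal (norm (indicator {1/2..1} t *\<^sub>R \<phi> t)) \<partial>lebesgue) < \<infinity>"
      using loc unfolding set_integrable_def by (rule integrable_iff_bounded[THEN iffD1, THEN conjunct2])
    ultimately show ?thesis by (simp add: nn_integral_completion)
  qed
  have "(\<integral>\<^sup>+t. ennreal (\<psi> t * (t powr a * (1 + 2 * ln (1 / t)))) \<partial>lborel) \<le>
    (\<integral>\<^sup>+t. ennreal 4 * ennreal (t powr a * ln (1 / t) * \<psi> t) +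
       ennreal (3 * 2 powr \<bar>a\<bar>) * (ennreal (\<psi> t) * indicator {1/2..1} t) \<partial>lborel)"
  proof (rule nn_integral_mono)
    fix t :: real
    \<comment> \<open>Below \<open>1 / 2\<close> the bound \<open>1 \<le> 2 * ln (1 / t)\<close>
      yields the constant 4; above it \<open>1 + 2 * ln (1 / t) \<le> 3\<close> and
      \<open>t powr a \<le> 2 powr \<bar>a\<bar>\<close> yield the other one.\<close>
    consider "t \<notin> {0<..1}" | "0 < t" "t < 1 / 2" | "1 / 2 \<le> t" "t \<le> 1" by fastforce
    then show "ennreal (\<psi> t * (t powr a * (1 + 2 * ln (1 / t)))) \<le> ennreal 4 * ennreal (t powr a * ln (1 / t) * \<psi> t) +
       ennreal (3 * 2 powr \<bar>a\<bar>) * (ennreal (\<psi> t) * indicator {1/2..1} t)"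
    proof cases
      case 1 then show ?thesis by (simp add: \<psi>(3))
    next
      case 2
      have "ln 2 \<le> ln (1 / t)" using 2 by (intro ln_mono) (auto simp: field_simps)
      then have "1 + 2 * ln (1 / t) \<le> 4 * ln (1 / t)" using ln2_ge_two_thirds by simp
      then have "(\<psi> t * t powr a) * (1 + 2 * ln (1 / t)) \<le> (\<psi> t * t powr a) * (4 * ln (1 / t))"
        using \<psi>(2) by (intro mult_left_mono) auto
      then have "ennreal (\<psi> t * (t powr a * (1 + 2 * ln (1 / t)))) \<le> ennreal (4 * (t powr a * ln (1 / t) * \<psi> t))"
        by (intro ennreal_leI) (simp add: ac_simps)
      also have "\<dots> = ennreal 4 * ennreal (t powr a * ln (1 / t) * \<psi> t)"
        using 2 \<psi>(2)[of t] by (intro ennreal_mult) auto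
      finally show ?thesis by (simp add: add_increasing2)
    next
      case 3
      have "t powr a \<le> t powr - \<bar>a\<bar>" using 3 by (intro powr_mono') auto
      also have "\<dots> \<le> (1 / 2) powr - \<bar>a\<bar>" using 3 by (intro powr_mono2') auto
      also have "\<dots> = 2 powr \<bar>a\<bar>" by (simp add: powr_divide powr_minus_divide)
      finally have ta: "t powr a \<le> 2 powr \<bar>a\<bar>" .
      have "ln (1 / t) \<le> 1 / t - 1" using 3 by (intro ln_le_minus_one) auto
      also have "\<dots> \<le> 1" using 3 by (simp add: field_simps)
      finally have l: "1 + 2 * ln (1 / t) \<le> 3" by simp
      have "\<psi> t * (t powr a * (1 + 2 * ln (1 / t))) \<le> \<psi> t * (2 powr \<bar>a\<bar> * 3)"
        using ta l \<psi>(2)[of t] 3 by (intro mult_left_mono mult_mono) auto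
      then have "ennreal (\<psi> t * (t powr a * (1 + 2 * ln (1 / t)))) \<le> ennreal ((3 * 2 powr \<bar>a\<bar>) * \<psi> t)"
        by (intro ennreal_leI) (simp add: ac_simps)
      also have "\<dots> = ennreal (3 * 2 powr \<bar>a\<bar>) * (ennreal (\<psi> t) * indicator {1/2..1} t)"
        using 3 \<psi>(2)[of t] by (subst ennreal_mult) auto
      finally show ?thesis by (simp add: add_increasing)
    qed
  qed
  also have "\<dots> = ennreal 4 * (\<integral>\<^sup>+t. ennreal (t powr a * ln (1 / t) * \<psi> t) \<partial>lborel) +
       ennreal (3 * 2 powr \<bar>a\<bar>) * (\<integral>\<^sup>+t. ennreal (\<psi> t) * indicator {1/2..1} t \<partial>lborel)"
    by (subst nn_integral_add) (auto simp: nn_integral_cmult)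
  also have "\<dots> < \<infinity>" using 1 2 by (simp add: ennreal_mult_less_top)
  finally show ?thesis .
qed

section \<open>The commutator in terms of Borel representatives\<close>

context dunkl_blocks
begin

text \<open>For fixed \<open>t > 0\<close> the preimage of a null set under dilation has Dunkl
  measure 0 by scaling, and is a Lebesgue null set because the weight is positive almost everywhere.
  Tonelli's theorem then exchanges \<open>t\<close> and \<open>x\<close>.\<close>

lemma AE_dil:
  assumes "AE x in PM. P x"
  shows "AE x in PM. AE t in lborel. t \<in> {0<..1} \<longrightarrow> P (dil m d t x)"
proof -
  from assms obtain Z where Z: "{x \<in> space PM. \<not> P x} \<subseteq> Z" "Z \<in> null_sets PM"
    by (auto elim!: AE_E simp: null_sets_def)
  have [measurable]: "Z \<in> sets PM" using Z by auto
  have "AE x in PM. x \<notin> Z" using Z(2) by (rule AE_not_in)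
  then have "(\<integral>\<^sup>+x. ennreal (wt x) * indicator Z x \<partial>PM) = (\<integral>\<^sup>+x. 0 \<partial>PM)"
    by (intro nn_integral_cong_AE) (auto elim!: eventually_mono)
  then have 0: "mnorm (\<lambda>_. 1) (\<lambda>_. 1) (indicator Z) = 0"
    by (subst mnorm_one) auto
  interpret P: sigma_finite_measure PM by (rule PM.sigma_finite) simp
  interpret LP: pair_sigma_finite lborel PM ..
  have "AE x in PM. t \<in> {0<..1} \<longrightarrow> dil m d t x \<notin> Z" for t
  proof (cases "0 < t")
    case True
    have "mnorm (\<lambda>_. 1) (\<lambda>_. 1) (\<lambda>x. indicator Z (dil m d t x)) = 0"
      using True 0 by (subst mnorm_scale[where F="indicator Z"]) auto
    then have "(\<integral>\<^sup>+x. ennreal (wt x) * indicator Z (dil m d t x) \<partial>PM) = 0"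
      by (subst (asm) mnorm_one) measurable
    then have "AE x in PM. ennreal (wt x) * indicator Z (dil m d t x) = 0"
      by (subst (asm) nn_integral_0_iff_AE) auto
    with AE_wt_pos show ?thesis by eventually_elim (auto simp: indicator_eq_0_iff)
  qed simp
  then have "AE t in lborel. AE x in PM. t \<in> {0<..1} \<longrightarrow> dil m d t x \<notin> Z" by simp
  then have ae: "AE x in PM. AE t in lborel. t \<in> {0<..1} \<longrightarrow> dil m d t x \<notin> Z"
    by (subst (asm) LP.AE_commute) measurable
  have "P (dil m d t x)" if "dil m d t x \<notin> Z" for t x
    using Z(1) dil_in_space[of t x] that by blast
  with ae show ?thesis by (auto elim!: eventually_mono)
qed

context
  fixes \<phi> \<psi> :: "real \<Rightarrow> real"
  assumes \<psi>[measurable]: "\<psi> \<in> borel_measurable borel"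
    and \<psi>0: "\<And>t. t \<notin> {0<..1} \<Longrightarrow> \<psi> t = 0"
    and \<psi>ae: "AE t in lborel. t \<in> {0<..1} \<longrightarrow> \<phi> t = \<psi> t"
begin

text \<open>The passage from possibly non-Borel integrands over \<open>lebesgue\<close> to Borel
  ones over \<open>lborel\<close>. The hypothesis on the ray through \<open>x\<close> is what
  \<open>AE_dil\<close> provides for almost every \<open>x\<close>.\<close>

lemma hardy_representative:
  fixes g g' :: "(nat \<Rightarrow> nat \<Rightarrow> real) \<Rightarrow> complex"
  assumes g'[measurable]: "g' \<in> borel_measurable PM"
    and x: "x \<in> space PM"
    and eq: "AE t in lborel. t \<in> {0<..1} \<longrightarrow> g (dil m d t x) = g' (dil m d t x)"
  shows "hardy_defined m d \<phi> g x \<longleftrightarrow> integrable lborel (\<lambda>t. g' (dil m d t x) * complex_of_real (\<psi> t))"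
    and "hardy m d \<phi> g x = (LINT t|lborel. g' (dil m d t x) * complex_of_real (\<psi> t))"
proof -
  let ?f = "\<lambda>t. indicator {0<..1} t *\<^sub>R (g (dil m d t x) * complex_of_real (\<phi> t))"
  let ?h = "\<lambda>t. g' (dil m d t x) * complex_of_real (\<psi> t)"
  have h: "?h \<in> borel_measurable lborel" using x by measurable
  have ae: "AE t in lborel. ?f t = ?h t"
    using eq \<psi>ae by eventually_elim (auto simp: \<psi>0 split: split_indicator)
  have f: "?f \<in> borel_measurable lebesgue" by (rule measurable_completion_cong_AE[OF h ae])
  have h': "?h \<in> borel_measurable lebesgue" by (rule measurable_completion[OF h])
  have ae': "AE t in lebesgue. ?f t = ?h t" by (rule AE_completion[OF ae])
  have "hardy_defined m d \<phi> g x \<longleftrightarrow> integrable lebesgue ?f" by (simp add: hardy_defined_def set_integrable_def)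
  also have "\<dots> \<longleftrightarrow> integrable lebesgue ?h" by (rule integrable_cong_AE[OF f h' ae'])
  also have "\<dots> \<longleftrightarrow> integrable lborel ?h" by (rule integrable_completion[OF h])
  finally show "hardy_defined m d \<phi> g x \<longleftrightarrow> integrable lborel ?h" .
  have "hardy m d \<phi> g x = integral\<^sup>L lebesgue ?f" by (simp add: hardy_def set_lebesgue_integral_def)
  also have "\<dots> = integral\<^sup>L lebesgue ?h" by (rule integral_cong_AE[OF f h' ae'])
  also have "\<dots> = integral\<^sup>L lborel ?h" by (rule integral_completion[OF h])
  finally show "hardy m d \<phi> g x = integral\<^sup>L lborel ?h" .
qed

section \<open>Domination of the commutator by Borel integrals\<close>

context
  fixes f f' b b' :: "(nat \<Rightarrow> nat \<Rightarrow> real) \<Rightarrow> complex"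
  assumes f'[measurable]: "f' \<in> borel_measurable PM" and feq: "AE x in PM. f x = f' x"
    and b'[measurable]: "b' \<in> borel_measurable PM" and beq: "AE x in PM. b x = b' x"
    and \<psi>nn: "\<And>t. 0 \<le> \<psi> t"
begin

text \<open>Definedness asks for two integrals, with \<open>f\<close> and with \<open>b * f\<close>.
  This majorant controls the first; combined with \<open>commutator_abs\<close>, the majorant whose
  norm is estimated, it controls the second as well.\<close>

definition hardy_abs :: "(nat \<Rightarrow> nat \<Rightarrow> real) \<Rightarrow> ennreal" where
  "hardy_abs x = (\<integral>\<^sup>+t. ennreal (\<psi> t) * ennreal (cmod (f' (dil m d t x))) \<partial>lborel)"

definition commutator_abs :: "(nat \<Rightarrow> nat \<Rightarrow> real) \<Rightarrow> ennreal" where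
  "commutator_abs x = (\<integral>\<^sup>+t. ennreal (\<psi> t) *
     (ennreal (cmod (b' x - b' (dil m d t x))) * ennreal (cmod (f' (dil m d t x)))) \<partial>lborel)"

lemma hardy_abs_measurable [measurable]: "hardy_abs \<in> borel_measurable PM"
  unfolding hardy_abs_def by measurable

lemma commutator_abs_measurable [measurable]: "commutator_abs \<in> borel_measurable PM"
  unfolding commutator_abs_def by measurable

lemma AE_representatives:
  "AE x in PM. b x = b' x \<and> (AE t in lborel. t \<in> {0<..1} \<longrightarrow> f (dil m d t x) = f' (dil m d t x)) \<and>
     (AE t in lborel. t \<in> {0<..1} \<longrightarrow> b (dil m d t x) * f (dil m d t x) = b' (dil m d t x) * f' (dil m d t x))"
proof -
  have "AE x in PM. b x * f x = b' x * f' x" using feq beq by eventually_elim simp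
  from beq AE_dil[OF feq] AE_dil[OF this] show ?thesis by eventually_elim simp
qed

text \<open>Parametric Bochner integrals of Borel integrands are Borel in \<open>x\<close>, also at
  points where they do not converge, and the commutator equals such an expression almost
  everywhere.\<close>

lemma commutator_measurable: "commutator m d \<phi> b f \<in> borel_measurable (leb m d)"
  unfolding leb_eq
proof (rule measurable_completion_cong_AE)
  let ?c = "\<lambda>x. b' x * (LINT t|lborel. f' (dil m d t x) * complex_of_real (\<psi> t)) -
     (LINT t|lborel. (b' (dil m d t x) * f' (dil m d t x)) * complex_of_real (\<psi> t))"
  show "?c \<in> borel_measurable PM" by measurable
  show "AE x in PM. commutator m d \<phi> b f x = ?c x"
    using AE_representatives AE_space
  proof eventually_elim
    case (elim x)
    then show ?case
      unfolding commutator_def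
      using hardy_representative(2)[OF f', of x f] hardy_representative(2)[of "\<lambda>x. b' x * f' x" x "\<lambda>x. b x * f x"]
      by simp
  qed
qed

lemma commutator_bound:
  assumes fin: "AE x in PM. hardy_abs x < \<infinity>" "AE x in PM. commutator_abs x < \<infinity>"
  shows "AE x in PM. commutator_defined m d \<phi> b f x \<and> ennreal (cmod (commutator m d \<phi> b f x)) \<le> commutator_abs x"
  using AE_representatives fin AE_space
proof eventually_elim
  case (elim x)
  then have x[measurable]: "x \<in> space PM" and bx: "b x = b' x" by auto
  let ?F = "\<lambda>t. f' (dil m d t x) * complex_of_real (\<psi> t)"
  let ?G = "\<lambda>t. (b' (dil m d t x) * f' (dil m d t x)) * complex_of_real (\<psi> t)"
  let ?D = "\<lambda>t. (b' x - b' (dil m d t x)) * f' (dil m d t x) * complex_of_real (\<psi> t)"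
  have F: "integrable lborel ?F"
  proof (rule integrableI_bounded)
    have "(\<integral>\<^sup>+t. ennreal (norm (?F t)) \<partial>lborel) = hardy_abs x"
      unfolding hardy_abs_def using \<psi>nn
      by (intro nn_integral_cong) (simp add: norm_mult ennreal_mult mult.commute)
    then show "(\<integral>\<^sup>+t. ennreal (norm (?F t)) \<partial>lborel) < \<infinity>" using elim by simp
  qed measurable
  have nD: "(\<integral>\<^sup>+t. ennreal (norm (?D t)) \<partial>lborel) = commutator_abs x"
    unfolding commutator_abs_def using \<psi>nn
    by (intro nn_integral_cong) (simp add: norm_mult ennreal_mult mult.commute)
  have D: "integrable lborel ?D"
  proof (rule integrableI_bounded)
    show "(\<integral>\<^sup>+t. ennreal (norm (?D t)) \<partial>lborel) < \<infinity>" using elim nD by simp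
  qed measurable
  \<comment> \<open>The integrand \<open>?G\<close> of the product is recovered from
    \<open>?F\<close> and \<open>?D\<close>, which avoids estimating \<open>b * f\<close>
    directly.\<close>
  have "integrable lborel (\<lambda>t. b' x * ?F t - ?D t)"
    using F D by (intro Bochner_Integration.integrable_diff integrable_mult_right)
  moreover have "(\<lambda>t. b' x * ?F t - ?D t) = ?G" by (auto simp: algebra_simps)
  ultimately have G: "integrable lborel ?G" by simp
  have "commutator_defined m d \<phi> b f x"
    unfolding commutator_defined_def
    using hardy_representative(1)[OF f' x, of f] hardy_representative(1)[of "\<lambda>x. b' x * f' x" x "\<lambda>x. b x * f x"] elim F G
    by simp
  moreover have "commutator m d \<phi> b f x = b' x * integral\<^sup>L lborel ?F - integral\<^sup>L lborel ?G"
    unfolding commutator_def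
    using hardy_representative(2)[OF f' x, of f] hardy_representative(2)[of "\<lambda>x. b' x * f' x" x "\<lambda>x. b x * f x"] elim
    by simp
  moreover have "b' x * integral\<^sup>L lborel ?F - integral\<^sup>L lborel ?G = integral\<^sup>L lborel ?D"
  proof -
    have "integral\<^sup>L lborel ?D = integral\<^sup>L lborel (\<lambda>t. b' x * ?F t - ?G t)"
      by (rule arg_cong[where f="integral\<^sup>L lborel"]) (auto simp: algebra_simps)
    also have "\<dots> = integral\<^sup>L lborel (\<lambda>t. b' x * ?F t) - integral\<^sup>L lborel ?G"
      using F G by (intro Bochner_Integration.integral_diff integrable_mult_right)
    finally show ?thesis by simp
  qed
  moreover have "ennreal (norm (integral\<^sup>L lborel ?D)) \<le> commutator_abs x"
    unfolding nD[symmetric] by (rule integral_norm_bound_ennreal[OF D])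
  ultimately show ?case by simp
qed

end

end

end

section \<open>Sufficiency of the weight condition\<close>

lemma (in dunkl_blocks) commutator_bounded_if_weight_finite:
  fixes r r1 r2 s s1 s2 :: "nat \<Rightarrow> real" and l :: real and \<phi> \<psi> :: "real \<Rightarrow> real"
  assumes m: "1 \<le> m"
    and r: "\<And>i. i \<in> {1..m} \<Longrightarrow> 1 < r i" and s: "\<And>i. i \<in> {1..m} \<Longrightarrow> 1 < s i"
    and r1: "\<And>i. i \<in> {1..m} \<Longrightarrow> 1 < r1 i" and s1: "\<And>i. i \<in> {1..m} \<Longrightarrow> 1 < s1 i"
    and r2: "\<And>i. i \<in> {1..m} \<Longrightarrow> 1 < r2 i" and s2: "\<And>i. i \<in> {1..m} \<Longrightarrow> 1 < s2 i"
    and r_eq: "\<And>i. i \<in> {1..m} \<Longrightarrow> 1 / r i = 1 / r1 i + 1 / r2 i"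
    and s_eq: "\<And>i. i \<in> {1..m} \<Longrightarrow> 1 / s i = 1 / s1 i + 1 / s2 i"
    and \<psi>[measurable]: "\<psi> \<in> borel_measurable borel" and \<psi>nn: "\<And>t. 0 \<le> \<psi> t"
    and \<psi>0: "\<And>t. t \<notin> {0<..1} \<Longrightarrow> \<psi> t = 0"
    and \<psi>ae: "AE t in lborel. t \<in> {0<..1} \<longrightarrow> \<phi> t = \<psi> t"
    and fin: "(\<integral>\<^sup>+t. ennreal (\<psi> t * (t powr (total_hom_dim m d k * l) * (1 + 2 * ln (1 / t)))) \<partial>lborel) < \<infinity>"
    and b: "b \<in> cmo_space m d k r2 s2"
  shows "commutator_bounded m d k \<phi> b r1 s1 r s l"
proof -
  let ?a = "total_hom_dim m d k * l"
  let ?e = "\<lambda>t. t powr ?a * (1 + 2 * ln (1 / t))"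
  define J where "J = enn2real (\<integral>\<^sup>+t. ennreal (\<psi> t * ?e t) \<partial>lborel)"
  have J: "(\<integral>\<^sup>+t. ennreal (\<psi> t * ?e t) \<partial>lborel) = ennreal J" "0 \<le> J"
    using fin by (auto simp: J_def)
  have int: "\<And>R. 0 < R \<Longrightarrow> set_integrable dunkl (oball m d R) b" and cmo: "cmo_norm m d k r2 s2 b < \<infinity>"
    using b by (auto simp: cmo_space_def)
  have "b \<in> borel_measurable (leb m d)" by (rule locally_integrable_measurable[OF int])
  then obtain b' where b'[measurable]: "b' \<in> borel_measurable PM" and beq: "AE x in PM. b x = b' x"
    unfolding leb_eq by (rule completion_ex_borel_measurable_complex)
  define K where "K = enn2real (cmo_norm m d k r2 s2 b)"
  have K: "cmo_norm m d k r2 s2 b = ennreal K" "0 \<le> K" using cmo by (auto simp: K_def)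
  have osc: "mnorm r2 s2 (\<lambda>x. ennreal (cmod (b' x - ball_mean m d k b R)) * ball_ind R x) \<le> ennreal K * ennreal (bnorm r2 s2 R)"
    if R: "0 < R" for R
  proof -
    have "mnorm r2 s2 (\<lambda>x. ennreal (cmod (b' x - ball_mean m d k b R)) * ball_ind R x) =
      mnorm r2 s2 (\<lambda>x. ennreal (cmod (b x - ball_mean m d k b R)) * ball_ind R x)"
      using beq by (intro mnorm_cong_AE) (auto elim!: eventually_mono)
    moreover have "\<forall>R>0. mnorm r2 s2 (\<lambda>x. ennreal (cmod (b x - ball_mean m d k b R)) * ball_ind R x) \<le>
       ennreal K * ennreal (bnorm r2 s2 R)"
      by (rule cmo_norm_le_iff[THEN iffD1, OF r2 s2 m]) (auto simp: K(1))
    ultimately show ?thesis using R by simp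
  qed
  define D where "D = step_const r2 s2 K"
  have D: "0 \<le> D" unfolding D_def by (rule step_const_nonneg[OF r2 s2 m int b' beq K(2) osc])
  have diff: "mnorm r2 s2 (\<lambda>x. ennreal (cmod (b' x - b' (dil m d t x))) * ball_ind R x) \<le>
      ennreal ((2 * K + (1 + 2 * ln (1 / t)) * D) * bnorm r2 s2 R)" if "0 < t" "t \<le> 1" "0 < R" for t R
    unfolding D_def using that
    by (intro oscillation_dilate[OF r2 s2 m int b' beq K(2) osc])
  \<comment> \<open>By \<open>hdim_add\<close> the powers of \<open>R\<close> in the two ball norms
    multiply to the one for \<open>r\<close>; \<open>c\<close> is the ratio of the remaining
    constants.\<close>
  define c where "c = qnorm r2 s2 * qnorm r1 s1 / qnorm r s"
  have Q: "0 < qnorm r s" by (rule qnorm_pos[OF r s m])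
  have c: "0 \<le> c" using Q by (simp add: c_def)
  have cb: "bnorm r2 s2 R * bnorm r1 s1 R = c * bnorm r s R" for R
  proof -
    have "hdim r = hdim r1 + hdim r2" by (rule hdim_add[OF r_eq])
    then show ?thesis using Q by (simp add: c_def bnorm_def powr_add)
  qed
  \<comment> \<open>The constant collects the oscillation bound \<open>2 * K + D\<close>, the ratio
    \<open>c\<close> of ball norms and the weight integral \<open>J\<close>.\<close>
  have main: "(AE x in leb m d. commutator_defined m d \<phi> b f x) \<and>
        commutator m d \<phi> b f \<in> morrey_space m d k r s l \<and>
        morrey_norm m d k r s l (commutator m d \<phi> b f) \<le> ennreal ((2 * K + D) * c * J) * morrey_norm m d k r1 s1 l f"
    if f: "f \<in> morrey_space m d k r1 s1 l" for f
  proof -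
    define M where "M = morrey_norm m d k r1 s1 l f"
    have M: "M < \<infinity>" using f by (simp add: morrey_space_def M_def)
    have "f \<in> borel_measurable (completion PM)" using f by (simp add: morrey_space_def leb_eq)
    then obtain f' where f'[measurable]: "f' \<in> borel_measurable PM" and feq: "AE x in PM. f x = f' x"
      by (rule completion_ex_borel_measurable_complex)
    have fR: "mnorm r1 s1 (\<lambda>x. ennreal (cmod (f' x)) * ball_ind R x) \<le> M * ennreal (vol R powr l * bnorm r1 s1 R)"
      if R: "0 < R" for R
    proof -
      have "mnorm r1 s1 (\<lambda>x. ennreal (cmod (f' x)) * ball_ind R x) = mnorm r1 s1 (\<lambda>x. ennreal (cmod (f x)) * ball_ind R x)"
        using feq by (intro mnorm_cong_AE) (auto elim!: eventually_mono)
      moreover have "\<forall>R>0. mnorm r1 s1 (\<lambda>x. ennreal (cmod (f x)) * ball_ind R x) \<le>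
         M * ennreal (vol R powr l * bnorm r1 s1 R)"
        by (rule morrey_norm_le_iff[THEN iffD1, OF r1 s1 m]) (auto simp: M_def)
      ultimately show ?thesis using R by simp
    qed
    have fdil: "mnorm r1 s1 (\<lambda>x. ennreal (cmod (f' (dil m d t x))) * ball_ind R x) \<le>
        ennreal (t powr ?a) * (M * ennreal (vol R powr l * bnorm r1 s1 R))" if "0 < t" "0 < R" for t R
      using that by (intro morrey_dilate[OF r1 s1 m f' fR])
    have e1: "t powr ?a \<le> ?e t" and e0: "0 \<le> ?e t" if "0 < t" "t \<le> 1" for t
      using that mult_left_mono[of 1 "1 + 2 * ln (1 / t)" "t powr ?a"] by simp_all
    define H where "H = hardy_abs \<psi> f'"
    define G where "G = commutator_abs \<psi> f' b'"
    have H_eq: "H x = (\<integral>\<^sup>+t. ennreal (\<psi> t) * ennreal (cmod (f' (dil m d t x))) \<partial>lborel)" for x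
      unfolding H_def by (rule hardy_abs_def[OF \<psi> \<psi>0 \<psi>ae f' feq b' beq \<psi>nn])
    have G_eq: "G x = (\<integral>\<^sup>+t. ennreal (\<psi> t) *
     (ennreal (cmod (b' x - b' (dil m d t x))) * ennreal (cmod (f' (dil m d t x)))) \<partial>lborel)" for x
      unfolding G_def by (rule commutator_abs_def[OF \<psi> \<psi>0 \<psi>ae f' feq b' beq \<psi>nn])
    have [measurable]: "H \<in> borel_measurable PM" "G \<in> borel_measurable PM"
      unfolding H_eq[abs_def] G_eq[abs_def] by measurable
    \<comment> \<open>Gives the existence of the Hardy integral of \<open>f\<close> almost
      everywhere. The logarithm is inserted through \<open>e1\<close> so that the same
      \<open>J\<close> bounds this norm.\<close>
    have Hfin: "mnorm r1 s1 (\<lambda>x. H x * ball_ind R x) < \<infinity>" if R: "0 < R" for R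
    proof -
      let ?F = "\<lambda>t x. ennreal (\<psi> t) * (ennreal (cmod (f' (dil m d t x))) * ball_ind R x)"
      have "mnorm r1 s1 (\<lambda>x. H x * ball_ind R x) = mnorm r1 s1 (\<lambda>x. \<integral>\<^sup>+t. ?F t x \<partial>lborel)"
        unfolding H_eq
        by (intro mnorm_cong) (subst nn_integral_multc[symmetric], measurable, simp add: mult.assoc)
      also have "\<dots> \<le> (\<integral>\<^sup>+t. mnorm r1 s1 (?F t) \<partial>lborel)"
        by (intro mnorm_Minkowski r1 s1 lborel.sigma_finite_measure_axioms) measurable
      also have "\<dots> \<le> (\<integral>\<^sup>+t. ennreal (\<psi> t * ?e t) * (M * ennreal (vol R powr l * bnorm r1 s1 R)) \<partial>lborel)"
      proof (rule nn_integral_mono)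
        fix t :: real
        have "mnorm r1 s1 (?F t) = ennreal (\<psi> t) * mnorm r1 s1 (\<lambda>x. ennreal (cmod (f' (dil m d t x))) * ball_ind R x)"
          using r1 s1 by (intro mnorm_cmult) (auto intro: less_trans[OF zero_less_one])
        also have "\<dots> \<le> ennreal (\<psi> t * ?e t) * (M * ennreal (vol R powr l * bnorm r1 s1 R))"
        proof (cases "t \<in> {0<..1}")
          case True
          then have t: "0 < t" "t \<le> 1" by auto
          have "ennreal (\<psi> t) * mnorm r1 s1 (\<lambda>x. ennreal (cmod (f' (dil m d t x))) * ball_ind R x) \<le>
            ennreal (\<psi> t) * (ennreal (?e t) * (M * ennreal (vol R powr l * bnorm r1 s1 R)))"
            by (intro mult_left_mono order_trans[OF fdil[OF t(1) R]] mult_right_mono ennreal_leI e1 t) auto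
          then show ?thesis using \<psi>nn e0[OF t] by (simp only: ennreal_mult mult.assoc)
        qed (simp add: \<psi>0)
        finally show "mnorm r1 s1 (?F t) \<le> ennreal (\<psi> t * ?e t) * (M * ennreal (vol R powr l * bnorm r1 s1 R))" .
      qed
      also have "\<dots> = ennreal J * (M * ennreal (vol R powr l * bnorm r1 s1 R))"
        unfolding J(1)[symmetric] by (rule nn_integral_multc) measurable
      also have "\<dots> < \<infinity>" using M by (simp add: ennreal_mult_less_top)
      finally show ?thesis .
    qed
    \<comment> \<open>Minkowski moves the norm inside the integral in \<open>t\<close>; Hoelder then
      separates the oscillation of \<open>b'\<close> from the dilated \<open>f'\<close>, and both
      are bounded with explicit dependence on \<open>t\<close>.\<close>
    have Gle: "mnorm r s (\<lambda>x. G x * ball_ind R x) \<le> ennreal ((2 * K + D) * c * J) * M * ennreal (vol R powr l * bnorm r s R)"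
      if R: "0 < R" for R
    proof -
      let ?d = "\<lambda>t x. ennreal (cmod (b' x - b' (dil m d t x))) * ball_ind R x"
      let ?f = "\<lambda>t x. ennreal (cmod (f' (dil m d t x))) * ball_ind R x"
      let ?F = "\<lambda>t x. ennreal (\<psi> t) * (?d t x * ?f t x)"
      let ?X = "M * ennreal ((2 * K + D) * c * (vol R powr l * bnorm r s R))"
      have "mnorm r s (\<lambda>x. G x * ball_ind R x) = mnorm r s (\<lambda>x. \<integral>\<^sup>+t. ?F t x \<partial>lborel)"
        unfolding G_eq
        by (intro mnorm_cong) (subst nn_integral_multc[symmetric], measurable,
            auto intro!: nn_integral_cong split: split_indicator)
      also have "\<dots> \<le> (\<integral>\<^sup>+t. mnorm r s (?F t) \<partial>lborel)"
        by (intro mnorm_Minkowski r s lborel.sigma_finite_measure_axioms) measurable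
      also have "\<dots> \<le> (\<integral>\<^sup>+t. ennreal (\<psi> t * ?e t) * ?X \<partial>lborel)"
      proof (rule nn_integral_mono)
        fix t :: real
        have "mnorm r s (?F t) = ennreal (\<psi> t) * mnorm r s (\<lambda>x. ?d t x * ?f t x)"
          using r s by (intro mnorm_cmult) (auto intro: less_trans[OF zero_less_one])
        also have "\<dots> \<le> ennreal (\<psi> t * ?e t) * ?X"
        proof (cases "t \<in> {0<..1}")
          case True
          then have t: "0 < t" "t \<le> 1" by auto
          have ln0: "0 \<le> ln (1 / t)" using t by simp
          have pos: "0 < x" if "1 < x" for x :: real using that by simp
          have "mnorm r s (\<lambda>x. ?d t x * ?f t x) \<le> mnorm r2 s2 (?d t) * mnorm r1 s1 (?f t)"
            by (intro mnorm_Holder conjI pos r s r1 s1 r2 s2) (auto simp: r_eq s_eq)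
          also have "\<dots> \<le> ennreal ((2 * K + (1 + 2 * ln (1 / t)) * D) * bnorm r2 s2 R) *
              (ennreal (t powr ?a) * (M * ennreal (vol R powr l * bnorm r1 s1 R)))"
            by (intro mult_mono diff fdil t R) auto
          \<comment> \<open>Both terms are brought to the common factor
            \<open>1 + 2 * ln (1 / t)\<close>, which is at least 1.\<close>
          also have "\<dots> \<le> ennreal ((2 * K + D) * (1 + 2 * ln (1 / t)) * bnorm r2 s2 R) *
              (ennreal (t powr ?a) * (M * ennreal (vol R powr l * bnorm r1 s1 R)))"
          proof (intro mult_right_mono ennreal_leI)
            show "2 * K + (1 + 2 * ln (1 / t)) * D \<le> (2 * K + D) * (1 + 2 * ln (1 / t))"
              using K(2) ln0 by (simp add: algebra_simps)
          qed auto
          also have "\<dots> = M * ennreal ((?e t * (2 * K + D)) * ((bnorm r2 s2 R * bnorm r1 s1 R) * vol R powr l))"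
            using K(2) D ln0 by (simp add: ennreal_mult ac_simps)
          also have "\<dots> = ennreal (?e t) * ?X"
            unfolding cb using K(2) D c e0[OF t] by (simp add: ennreal_mult[symmetric] mult.left_commute[of _ M] mult.assoc ac_simps)
          finally have "mnorm r s (\<lambda>x. ?d t x * ?f t x) \<le> ennreal (?e t) * ?X" .
          then have "ennreal (\<psi> t) * mnorm r s (\<lambda>x. ?d t x * ?f t x) \<le> ennreal (\<psi> t) * (ennreal (?e t) * ?X)"
            by (rule mult_left_mono) simp
          then show ?thesis using \<psi>nn e0[OF t] by (simp only: ennreal_mult mult.assoc)
        qed (simp add: \<psi>0)
        finally show "mnorm r s (?F t) \<le> ennreal (\<psi> t * ?e t) * ?X" .
      qed
      also have "\<dots> = ennreal J * ?X"
        unfolding J(1)[symmetric] by (rule nn_integral_multc) measurable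
      also have "\<dots> = ennreal ((2 * K + D) * c * J) * M * ennreal (vol R powr l * bnorm r s R)"
        using K(2) D c J(2) by (simp add: ennreal_mult ac_simps)
      finally show ?thesis .
    qed
    have Gfin: "mnorm r s (\<lambda>x. G x * ball_ind R x) < \<infinity>" if "0 < R" for R
      using M by (intro order_le_less_trans[OF Gle[OF that]]) (simp add: ennreal_mult_less_top)
    have Hae: "AE x in PM. H x < \<infinity>" by (rule mnorm_finite_imp_AE[OF r1 s1 _ m Hfin]) measurable
    have Gae: "AE x in PM. G x < \<infinity>" by (rule mnorm_finite_imp_AE[OF r s _ m Gfin]) measurable
    have bd: "AE x in PM. commutator_defined m d \<phi> b f x \<and> ennreal (cmod (commutator m d \<phi> b f x)) \<le> G x"
      unfolding G_def
      by (rule commutator_bound[OF \<psi> \<psi>0 \<psi>ae f' feq b' beq \<psi>nn Hae[unfolded H_def] Gae[unfolded G_def]])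
    have "AE x in leb m d. commutator_defined m d \<phi> b f x"
      unfolding leb_eq using bd by (intro AE_completion) (auto elim!: eventually_mono)
    moreover have le: "morrey_norm m d k r s l (commutator m d \<phi> b f) \<le> ennreal ((2 * K + D) * c * J) * M"
    proof (rule morrey_norm_le_iff[THEN iffD2, OF r s m], assumption, assumption, intro allI impI)
      fix R :: real assume R: "0 < R"
      have "mnorm r s (\<lambda>x. ennreal (cmod (commutator m d \<phi> b f x)) * ball_ind R x) \<le> mnorm r s (\<lambda>x. G x * ball_ind R x)"
      proof (rule mnorm_mono_AE)
        show "AE x in PM. ennreal (cmod (commutator m d \<phi> b f x)) * ball_ind R x \<le> G x * ball_ind R x"
          using bd by eventually_elim (intro mult_right_mono, auto)
      qed (use r s in \<open>auto intro: less_trans[OF zero_less_one]\<close>)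
      also note Gle[OF R]
      finally show "mnorm r s (\<lambda>x. ennreal (cmod (commutator m d \<phi> b f x)) * ball_ind R x) \<le>
         ennreal ((2 * K + D) * c * J) * M * ennreal (vol R powr l * bnorm r s R)" .
    qed
    moreover have "commutator m d \<phi> b f \<in> borel_measurable (leb m d)"
      by (rule commutator_measurable[OF \<psi> \<psi>0 \<psi>ae f' feq b' beq \<psi>nn])
    moreover have "ennreal ((2 * K + D) * c * J) * M < \<infinity>" using M by (simp add: ennreal_mult_less_top)
    ultimately show ?thesis
      unfolding morrey_space_def M_def by (auto intro: order_le_less_trans)
  qed
  then show ?thesis unfolding commutator_bounded_def by blast
qed

section \<open>Necessity of the weight condition\<close>

lemma (in dunkl_blocks) weight_finite_if_commutator_bounded:
  fixes u1 w1 u2 w2 u w :: "nat \<Rightarrow> real" and l :: real and \<phi> :: "real \<Rightarrow> real"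
  assumes m: "1 \<le> m"
    and u1: "\<And>i. i \<in> {1..m} \<Longrightarrow> 1 < u1 i" and w1: "\<And>i. i \<in> {1..m} \<Longrightarrow> 1 < w1 i"
    and u2: "\<And>i. i \<in> {1..m} \<Longrightarrow> 1 < u2 i" and w2: "\<And>i. i \<in> {1..m} \<Longrightarrow> 1 < w2 i"
    and l: "- hdim u1 < total_hom_dim m d k * l"
    and \<phi>: "\<And>t. t \<in> {0<..1} \<Longrightarrow> 0 \<le> \<phi> t"
    and bdd: "\<And>b. b \<in> cmo_space m d k u2 w2 \<Longrightarrow> commutator_bounded m d k \<phi> b u1 w1 u w l"
  shows "(\<integral>\<^sup>+t\<in>{0<..1}. ennreal (t powr (total_hom_dim m d k * l) * ln (1 / t) * \<phi> t) \<partial>lebesgue) < \<infinity>"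
proof (rule ccontr)
  assume inf: "\<not> ?thesis"
  let ?b = "\<lambda>x. complex_of_real (ln (rnorm x))"
  let ?f = "\<lambda>x. complex_of_real (rnorm x powr (total_hom_dim m d k * l))"
  have "commutator_bounded m d k \<phi> ?b u1 w1 u w l"
    by (rule bdd[OF ln_in_cmo_space[OF u2 w2 m]])
  moreover have "?f \<in> morrey_space m d k u1 w1 l"
    by (rule powr_in_morrey_space[OF u1 w1 m l])
  ultimately have "AE x in leb m d. commutator_defined m d \<phi> ?b ?f x"
    unfolding commutator_bounded_def by blast
  then have "AE x in PM. commutator_defined m d \<phi> ?b ?f x"
    unfolding leb_eq AE_completion_iff .
  \<comment> \<open>Were the integral infinite, the commutator would be undefined at every point of
    positive radius, and these points have full measure.\<close>
  then have "AE x in PM. False"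
    using AE_rnorm_pos[OF m]
  proof eventually_elim
    case (elim x)
    then show ?case using commutator_defined_imp_finite[OF elim(1) elim(2) \<phi>] inf by simp
  qed
  then show False using not_AE_False by simp
qed

theorem theorem4p2:
  fixes m :: nat and d :: "nat \<Rightarrow> nat" and k :: "nat \<Rightarrow> nat \<Rightarrow> real"
    and r r1 r2 s s1 s2 :: "nat \<Rightarrow> real" and l :: real and \<phi> :: "real \<Rightarrow> real"
  assumes "total_dim m d \<ge> 2"
    and "\<forall>i\<in>{1..m}. d i \<ge> 1"
    and "\<forall>i\<in>{1..m}. \<forall>v\<in>{1..d i}. k i v \<ge> 0"
    and "\<forall>i\<in>{1..m}. 1 < r i \<and> r i < r1 i"
    and "\<forall>i\<in>{1..m}. 1 < s i \<and> s i < s1 i"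
    and "\<forall>i\<in>{1..m}. 1 / r i = 1 / r1 i + 1 / r2 i"
    and "\<forall>i\<in>{1..m}. 1 / s i = 1 / s1 i + 1 / s2 i"
    and "- (1 / total_hom_dim m d k) * (\<Sum>i=1..m. hom_dim (d i) (k i) / r1 i) < l"
    and "\<forall>t\<in>{0<..1}. \<phi> t \<ge> 0"
    and "\<forall>K. compact K \<and> K \<subseteq> {0<..1} \<longrightarrow> set_integrable lebesgue K \<phi>"
  shows "(\<forall>b\<in>cmo_space m d k r2 s2. commutator_bounded m d k \<phi> b r1 s1 r s l)
     \<longleftrightarrow> (\<integral>\<^sup>+t\<in>{0<..1}. ennreal (t powr (total_hom_dim m d k * l) * ln (1 / t) * \<phi> t) \<partial>lebesgue) < \<infinity>"
proof -
  interpret dunkl_blocks m d k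
    using assms(2,3) by unfold_locales auto
  \<comment> \<open>For \<open>m = 0\<close> the total dimension would be 0.\<close>
  have m: "1 \<le> m" using assms(1) by (cases m) (auto simp: total_dim_def)
  \<comment> \<open>\<open>y < y1\<close> makes \<open>1 / y2\<close> positive and
    \<open>1 < y\<close> keeps it below 1. Duality and Minkowski for the exponents of
    \<open>b\<close> rest on this bound.\<close>
  have conj: "1 < y2" if "1 < y" "y < y1" "1 / y = 1 / y1 + 1 / y2" for y y1 y2 :: real
  proof -
    have "1 / y2 = 1 / y - 1 / y1" using that by simp
    moreover have "1 / y1 < 1 / y" using that by (intro divide_strict_left_mono) auto
    moreover have "1 / y < 1" using that(1) by simp
    moreover have "0 < 1 / y1" using that(1,2) by simp
    ultimately have "0 < 1 / y2" "1 / y2 < 1" by linarith+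
    then show ?thesis by (simp add: zero_less_divide_iff divide_less_eq)
  qed
  have r: "1 < r i" "1 < r1 i" "1 < r2 i" "1 / r i = 1 / r1 i + 1 / r2 i" if "i \<in> {1..m}" for i
    using that assms(4,6) conj[of "r i" "r1 i" "r2 i"] by force+
  have s: "1 < s i" "1 < s1 i" "1 < s2 i" "1 / s i = 1 / s1 i + 1 / s2 i" if "i \<in> {1..m}" for i
    using that assms(5,7) conj[of "s i" "s1 i" "s2 i"] by force+
  have "0 < total_hom_dim m d k"
    unfolding total_hom_dim_eq by (rule hdim_pos[OF m]) simp
  \<comment> \<open>The hypothesis on \<open>l\<close> multiplied by the positive homogeneous
    dimension.\<close>
  then have l: "- hdim r1 < total_hom_dim m d k * l"
    using assms(8) by (simp add: hdim_def field_simps)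
  show ?thesis
  proof
    assume "\<forall>b\<in>cmo_space m d k r2 s2. commutator_bounded m d k \<phi> b r1 s1 r s l"
    then show "(\<integral>\<^sup>+t\<in>{0<..1}. ennreal (t powr (total_hom_dim m d k * l) * ln (1 / t) * \<phi> t) \<partial>lebesgue) < \<infinity>"
      using assms(9)
      by (intro weight_finite_if_commutator_bounded[OF m r(2) s(2) r(3) s(3) l, where u=r and w=s]) auto
  next
    assume fin: "(\<integral>\<^sup>+t\<in>{0<..1}. ennreal (t powr (total_hom_dim m d k * l) * ln (1 / t) * \<phi> t) \<partial>lebesgue) < \<infinity>"
    obtain \<psi> :: "real \<Rightarrow> real" where \<psi>: "\<psi> \<in> borel_measurable borel" "\<And>t. 0 \<le> \<psi> t"
      "\<And>t. t \<notin> {0<..1} \<Longrightarrow> \<psi> t = 0" "AE t in lborel. t \<in> {0<..1} \<longrightarrow> \<phi> t = \<psi> t"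
      using assms(9,10) by (rule_tac weight_representative[of \<phi>]) auto
    \<comment> \<open>Local integrability near \<open>t = 1\<close>, where the factor
      \<open>ln (1 / t)\<close> tends to 0.\<close>
    have loc: "set_integrable lebesgue {1/2..1} \<phi>" by (intro assms(10)[rule_format] conjI) auto
    have "(\<integral>\<^sup>+t. ennreal (\<psi> t * (t powr (total_hom_dim m d k * l) * (1 + 2 * ln (1 / t)))) \<partial>lborel) < \<infinity>"
      by (rule weight_integral_finite[OF \<psi> loc fin])
    then show "\<forall>b\<in>cmo_space m d k r2 s2. commutator_bounded m d k \<phi> b r1 s1 r s l"
      by (intro ballI commutator_bounded_if_weight_finite[where \<psi>=\<psi>] m \<psi>) (simp_all add: r s)
  qed
qed

end
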